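(* Let $\mathfrak{h}$ be an $l$-dimensional complex vector space ($l\ge1$) with a symmetric bilinear form $(\cdot|\cdot)$, $\varepsilon:\mathfrak{h}\times\mathfrak{h}\to\mathbb{C}^\times$ a 2-cocycle, $L\subset\mathfrak{h}$ a lattice with $\mathbb{Z}$-basis $B=\{\beta_1,\ldots,\beta_l\}$ which is also a $\mathbb{C}$-basis of $\mathfrak{h}$, and $A=((\beta_i|\beta_j))_{i,j}$ the Gram matrix. Let $\lambda=j_1\beta_1+\cdots+j_l\beta_l\in L^\circ$ with $\bm{j}=(j_1,\ldots,j_l)\in\mathbb{C}^l$, and let $W_L(\lambda)$ be the generalized principal subspace of weight $\lambda$. Then its graded dimension is $$\chi_{W_L(\lambda)}(\bm{x};q)=\sum_{i_1,\ldots,i_l\ge0}\frac{q^{\frac{(\bm{i}+\bm{j})\cdot A\cdot(\bm{i}+\bm{j})}{2}}}{(q)_{i_1}\cdots(q)_{i_l}}\,x_1^{i_1}\cdots x_l^{i_l},$$ where $\bm{i}=(i_1,\ldots,i_l)$.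
   Context: $(q)_k=(1-q)\cdots(1-q^k)$ for $k\ge1$ and $(q)_0=1$. $L^\circ=\{\mu\in\mathfrak{h}\mid(\mu|\beta)\in\mathbb{Z}\text{ for all }\beta\in L\}$. The GVA $V_{\mathfrak{h}}$: $M(1)=S(\mathfrak{h}\otimes t^{-1}\mathbb{C}[t^{-1}])$; write $h(n)=h\otimes t^n$; for $n<0$, $h(n)$ acts on $M(1)$ by multiplication, and for $n>0$ as the derivation with $h(n)\cdot h'(-m)=n(h|h')\delta_{n,m}$. $V_{\mathfrak{h}}=M(1)\otimes\mathbb{C}[\mathfrak{h}]$ with $\mathbb{C}[\mathfrak{h}]$ the group algebra with basis $e^\alpha$; $1\otimes e^\alpha$ is written $e^\alpha$, $h(0)$ acts on $M(1)\otimes e^\alpha$ as $(h|\alpha)$, $|0\rangle=e^0$, $Y(h(-1)|0\rangle,z)=\sum_{n\in\mathbb{Z}}h(n)z^{-n-1}$ and $Y(e^\alpha,z)=e^\alpha z^{\alpha(0)}\exp(\sum_{n>0}\frac{\alpha(-n)}nz^n)\exp(-\sum_{n>0}\frac{\alpha(n)}nz^{-n})$, where the operator $e^\alpha$ sends $u\otimes e^\beta$ to $u\otimes e^{\alpha+\beta}$ and $z^{\alpha(0)}$ acts on $M(1)\otimes e^\beta$ as $z^{(\alpha|\beta)}$. Write $Y(a,z)=\sum_{n\in\mathbb{C}}a(n)z^{-n-1}$. A 2-cocycle satisfies $\varepsilon(\alpha,\beta)\varepsilon(\alpha+\beta,\gamma)=\varepsilon(\beta,\gamma)\varepsilon(\alpha,\beta+\gamma)$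 and $\varepsilon(\alpha,0)=\varepsilon(0,\alpha)=1$; throughout, $V_{\mathfrak{h}}$ is $\varepsilon$-modified: $Y(a,z)b$ is replaced by $\varepsilon(\alpha,\beta)Y(a,z)b$ for $a\in M(1)\otimes e^\alpha$, $b\in M(1)\otimes e^\beta$. $W_L=W_L(B)$ is the generalized vertex subalgebra generated by $\{e^\beta\mid\beta\in B\}$ (the smallest translation-invariant subspace containing these vectors and $|0\rangle$ and closed under all products $u(n)v$, $n\in\mathbb{C}$), and $W_L(\lambda)=W_L\cdot e^\lambda\subset V_{\mathfrak{h}}$ is the $W_L$-submodule generated by $e^\lambda$. Charge grading: $U^\alpha=U\cap(M(1)\otimes e^\alpha)$. Weight grading: $\mathrm{wt}(h_k(-i_k)\cdots h_1(-i_1)e^\alpha)=i_1+\cdots+i_k+\frac{(\alpha|\alpha)}2$; $U_n$ is the weight-$n$ part, $n\in\mathbb{C}$. The graded dimension is $$\chi_{W_L(\lambda)}(\bm{x};q)=\sum_{\alpha,\,n\in\mathbb{C}}\dim_{\mathbb{C}}\bigl((W_L(\lambda)^{\lambda+\alpha})_n\bigr)\,q^nx_1^{i_1}\cdots x_l^{i_l},$$ where $\alpha=i_1\beta_1+\cdots+i_l\beta_l$ runs over $\mathfrak{h}$ (only $\alpha$ with all $i_r\in\mathbb{Z}_{\ge0}$ contribute). Factors $1/(q)_k$ are expanded as power series in $q$. *)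

theory Defs
  imports
    "HOL-Analysis.Finite_Cartesian_Product"
    "HOL-Analysis.Cartesian_Space"
    "HOL-Library.Poly_Mapping"
    "HOL-Library.Groups_Big_Fun"
    "HOL-Computational_Algebra.Formal_Power_Series"
begin

section \<open>The space \<open>M(1) \<otimes> C[h]\<close>\<close>

text \<open>
  For a basis \<open>\<beta>\<close> of \<open>h\<close>, the symmetric algebra \<open>M(1)\<close> of the space \<open>h \<otimes> t^(-1) C[t^(-1)]\<close> is the
  polynomial algebra on the basis elements \<open>\<beta> r (-n)\<close>, \<open>n \<ge> 1\<close>. The variable \<open>(r, k)\<close> stands
  for \<open>\<beta> r (-(k + 1))\<close>; the shift makes every pair a legitimate variable.
\<close>

type_synonym 'n heis_monom = "('n \<times> nat) \<Rightarrow>\<^sub>0 nat"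
type_synonym 'n fock = "'n heis_monom \<Rightarrow>\<^sub>0 complex"

type_synonym ('h, 'n) gva = "'h \<Rightarrow>\<^sub>0 'n fock"

text \<open>
  An element of \<open>M(1) \<otimes> C[h]\<close> is a finitely supported family of elements of \<open>M(1)\<close> indexed by \<open>h\<close>.
  The multiplication of \<^typ>\<open>('h, 'n) gva\<close> provided by the theory of polynomial mappings is that
  of the algebra \<open>M(1) \<otimes> C[h]\<close>, so it contains the action of \<open>M(1)\<close> by multiplication as
  well as the shift operators \<open>e^\<alpha>\<close>.
\<close>

definition fock_const :: "complex \<Rightarrow> 'n fock" where
  "fock_const c = Poly_Mapping.single 0 c"

definition fock_var :: "'n \<times> nat \<Rightarrow> 'n fock" where
  "fock_var x = Poly_Mapping.single (Poly_Mapping.single x 1) 1"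

definition fock_pderiv :: "'n \<times> nat \<Rightarrow> 'n fock \<Rightarrow> 'n fock" where
  "fock_pderiv x p = (\<Sum>m\<in>Poly_Mapping.keys p.
     Poly_Mapping.single (m - Poly_Mapping.single x 1)
       (of_nat (Poly_Mapping.lookup m x) * Poly_Mapping.lookup p m))"

definition gva_embed :: "'n fock \<Rightarrow> ('h::ab_group_add, 'n) gva" where
  "gva_embed p = Poly_Mapping.single 0 p"

definition gva_scale :: "complex \<Rightarrow> ('h::ab_group_add, 'n) gva \<Rightarrow> ('h, 'n) gva" where
  "gva_scale c v = gva_embed (fock_const c) * v"

definition gva_exp :: "'h \<Rightarrow> ('h::ab_group_add, 'n) gva" where
  "gva_exp \<alpha> = Poly_Mapping.single \<alpha> 1"

abbreviation gva_vac :: "('h::ab_group_add, 'n) gva" where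
  "gva_vac \<equiv> gva_exp 0"

global_interpretation gva: vector_space "gva_scale :: complex \<Rightarrow> ('h::ab_group_add, 'n) gva \<Rightarrow> _"
  by unfold_locales
    (auto simp: gva_scale_def gva_embed_def fock_const_def algebra_simps single_add mult_single
      simp flip: mult.assoc)

section \<open>Fields\<close>

text \<open>
  A field \<open>F\<close> is a formal series with operator coefficients and complex exponents: \<open>F c\<close> is the
  coefficient of \<open>z^c\<close>. All infinite sums below run over finitely many nonzero terms when applied to
  a vector, for the fields to which they are applied.
\<close>

type_synonym ('h, 'n) field_op = "complex \<Rightarrow> ('h, 'n) gva \<Rightarrow> ('h, 'n) gva"

definition field_id :: "('h::ab_group_add, 'n) field_op" where
  "field_id c v = (if c = 0 then v else 0)"

definition field_mult ::
    "('h::ab_group_add, 'n) field_op \<Rightarrow> ('h, 'n) field_op \<Rightarrow> ('h, 'n) field_op"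
    (infixl \<open>\<odot>\<close> 70) where
  "(F \<odot> G) c v = Sum_any (\<lambda>d. F d (G (c - d) v))"

definition field_add ::
    "('h::ab_group_add, 'n) field_op \<Rightarrow> ('h, 'n) field_op \<Rightarrow> ('h, 'n) field_op" where
  "field_add F G c v = F c v + G c v"

definition field_power :: "('h::ab_group_add, 'n) field_op \<Rightarrow> nat \<Rightarrow> ('h, 'n) field_op" where
  "field_power F k = ((\<odot>) F ^^ k) field_id"

definition field_exp :: "('h::ab_group_add, 'n) field_op \<Rightarrow> ('h, 'n) field_op" where
  "field_exp F c v = Sum_any (\<lambda>k. gva_scale (1 / fact k) (field_power F k c v))"

section \<open>The generalized vertex algebra and its principal subspaces\<close>

locale lattice_gva = vector_space scale
  for scale :: "complex \<Rightarrow> 'h::ab_group_add \<Rightarrow> 'h" +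
  fixes form :: "'h \<Rightarrow> 'h \<Rightarrow> complex"
    and \<epsilon> :: "'h \<Rightarrow> 'h \<Rightarrow> complex"
    and \<beta> :: "'n::finite \<Rightarrow> 'h"
  assumes form_sym: "form x y = form y x"
    and form_linear: "Vector_Spaces.linear scale (*) (form x)"
    and cocycle_nonzero: "\<epsilon> x y \<noteq> 0"
    and cocycle: "\<epsilon> x y * \<epsilon> (x + y) w = \<epsilon> y w * \<epsilon> x (y + w)"
    and cocycle_unit: "\<epsilon> x 0 = 1" "\<epsilon> 0 x = 1"
    and basis_inj: "inj \<beta>"
    and basis_independent: "independent (range \<beta>)"
    and basis_span: "span (range \<beta>) = UNIV"
begin

definition lattice :: "'h set" where
  "lattice = {\<Sum>r\<in>UNIV. scale (of_int (k r)) (\<beta> r) | k :: 'n \<Rightarrow> int. True}"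

definition dual_lattice :: "'h set" where
  "dual_lattice = {\<mu>. \<forall>b\<in>lattice. form \<mu> b \<in> \<int>}"

definition gram :: "complex ^ 'n ^ 'n" where
  "gram = (\<chi> r s. form (\<beta> r) (\<beta> s))"

definition coord :: "'h \<Rightarrow> 'n \<Rightarrow> complex" where
  "coord h r = representation (range \<beta>) h (\<beta> r)"

subsection \<open>The Heisenberg operators \<open>h(n)\<close>\<close>

text \<open>The element \<open>h(-(k + 1))\<close> of \<open>M(1)\<close>.\<close>

definition heis_elem :: "'h \<Rightarrow> nat \<Rightarrow> 'n fock" where
  "heis_elem h k = (\<Sum>r\<in>UNIV. fock_const (coord h r) * fock_var (r, k))"

text \<open>The derivation \<open>h(k + 1)\<close> of \<open>M(1)\<close>.\<close>

definition heis_deriv :: "'h \<Rightarrow> nat \<Rightarrow> 'n fock \<Rightarrow> 'n fock" where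
  "heis_deriv h k p =
     (\<Sum>r\<in>UNIV. fock_const (of_nat (k + 1) * form h (\<beta> r)) * fock_pderiv (r, k) p)"

definition heis :: "'h \<Rightarrow> int \<Rightarrow> ('h, 'n) gva \<Rightarrow> ('h, 'n) gva" where
  "heis h n v =
     (if n < 0 then gva_embed (heis_elem h (nat (- n - 1))) * v
      else if n = 0 then (\<Sum>\<alpha>\<in>Poly_Mapping.keys v.
        gva_scale (form h \<alpha>) (Poly_Mapping.single \<alpha> (Poly_Mapping.lookup v \<alpha>)))
      else Poly_Mapping.map (heis_deriv h (nat (n - 1))) v)"

subsection \<open>The state-field correspondence\<close>

text \<open>
  The part of \<open>(1 / k!) (d/dz)^k h(z) = \<Sum>n. binom (-n-1) k h(n) z^(-n-1-k)\<close> given by the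
  modes \<open>n \<in> N\<close>. The sum below has at most one term.
\<close>

definition heis_field :: "int set \<Rightarrow> 'h \<Rightarrow> nat \<Rightarrow> ('h, 'n) field_op" where
  "heis_field N h k c v =
     (\<Sum>n\<in>{n \<in> N. c = of_int (- n - 1 - int k)}.
        gva_scale (of_int (- n - 1) gchoose k) (heis h n v))"

text \<open>The normally ordered product of \<open>(1 / k!) (d/dz)^k h(z)\<close> and \<open>F\<close>.\<close>

definition normal_ordered :: "'h \<Rightarrow> nat \<Rightarrow> ('h, 'n) field_op \<Rightarrow> ('h, 'n) field_op" where
  "normal_ordered h k F =
     field_add (heis_field {..<0} h k \<odot> F) (F \<odot> heis_field {0..} h k)"

definition shift_field :: "'h \<Rightarrow> ('h, 'n) field_op" where
  "shift_field \<alpha> c v = (if c = 0 then gva_exp \<alpha> * v else 0)"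

text \<open>The field \<open>z^\<alpha>(0)\<close>.\<close>

definition zpow_field :: "'h \<Rightarrow> ('h, 'n) field_op" where
  "zpow_field \<alpha> c v = (\<Sum>\<gamma>\<in>{\<gamma> \<in> Poly_Mapping.keys v. form \<alpha> \<gamma> = c}.
     Poly_Mapping.single \<gamma> (Poly_Mapping.lookup v \<gamma>))"

text \<open>The fields \<open>\<Sum>n>0. \<alpha>(-n)/n z^n\<close> and \<open>- (\<Sum>n>0. \<alpha>(n)/n z^(-n))\<close>.\<close>

definition creation_field :: "'h \<Rightarrow> ('h, 'n) field_op" where
  "creation_field \<alpha> c v =
     (\<Sum>n\<in>{n::nat. n > 0 \<and> c = of_nat n}. gva_scale (1 / of_nat n) (heis \<alpha> (- int n) v))"

definition annihilation_field :: "'h \<Rightarrow> ('h, 'n) field_op" where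
  "annihilation_field \<alpha> c v =
     (\<Sum>n\<in>{n::nat. n > 0 \<and> c = - of_nat n}. - gva_scale (1 / of_nat n) (heis \<alpha> (int n) v))"

definition exp_vertex_op :: "'h \<Rightarrow> ('h, 'n) field_op" where
  "exp_vertex_op \<alpha> = shift_field \<alpha> \<odot> zpow_field \<alpha> \<odot>
     field_exp (creation_field \<alpha>) \<odot> field_exp (annihilation_field \<alpha>)"

text \<open>
  The field of \<open>\<beta> r1 (-k1-1) \<dots> \<beta> rs (-ks-1) e^\<alpha>\<close>, which the generating fields \<open>h(z)\<close> and
  \<open>Y(e^\<alpha>, z)\<close> determine as an iterated normally ordered product.
\<close>

primrec list_vertex_op :: "('n \<times> nat) list \<Rightarrow> 'h \<Rightarrow> ('h, 'n) field_op" where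
  "list_vertex_op [] \<alpha> = exp_vertex_op \<alpha>"
| "list_vertex_op (x # xs) \<alpha> = normal_ordered (\<beta> (fst x)) (snd x) (list_vertex_op xs \<alpha>)"

text \<open>
  The factors of a monomial, listed in an arbitrary order; the iterated normally ordered product
  does not depend on this order.
\<close>

definition monom_factors :: "'n heis_monom \<Rightarrow> ('n \<times> nat) list" where
  "monom_factors m = (SOME xs. \<forall>x. count_list xs x = Poly_Mapping.lookup m x)"

definition vertex_op :: "('h, 'n) gva \<Rightarrow> ('h, 'n) field_op" where
  "vertex_op u c v =
     (\<Sum>\<alpha>\<in>Poly_Mapping.keys u. \<Sum>m\<in>Poly_Mapping.keys (Poly_Mapping.lookup u \<alpha>).
        gva_scale (Poly_Mapping.lookup (Poly_Mapping.lookup u \<alpha>) m)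
          (list_vertex_op (monom_factors m) \<alpha> c v))"

text \<open>The product \<open>u(n)v\<close> of the \<open>\<epsilon>\<close>-modified generalized vertex algebra: the coefficient of \<open>z^(-n-1)\<close>.\<close>

definition nth_prod :: "('h, 'n) gva \<Rightarrow> complex \<Rightarrow> ('h, 'n) gva \<Rightarrow> ('h, 'n) gva" where
  "nth_prod u n v =
     (\<Sum>\<alpha>\<in>Poly_Mapping.keys u. \<Sum>\<gamma>\<in>Poly_Mapping.keys v.
        gva_scale (\<epsilon> \<alpha> \<gamma>)
          (vertex_op (Poly_Mapping.single \<alpha> (Poly_Mapping.lookup u \<alpha>)) (- n - 1)
            (Poly_Mapping.single \<gamma> (Poly_Mapping.lookup v \<gamma>))))"

text \<open>
  The translation operator, as determined by the creation property \<open>Y(u, z)|0> = exp(zT) u\<close>.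
\<close>

definition translation :: "('h, 'n) gva \<Rightarrow> ('h, 'n) gva" where
  "translation u = nth_prod u (- 2) gva_vac"

subsection \<open>Principal subspaces and the graded dimension\<close>

definition principal_subspace :: "('h, 'n) gva set" where
  "principal_subspace = \<Inter> {S. gva.subspace S \<and> gva_vac \<in> S \<and> (\<forall>r. gva_exp (\<beta> r) \<in> S) \<and>
     (\<forall>u\<in>S. translation u \<in> S) \<and> (\<forall>u\<in>S. \<forall>v\<in>S. \<forall>n. nth_prod u n v \<in> S)}"

text \<open>Submodules are not required to be invariant under \<open>translation\<close>.\<close>

definition principal_module :: "'h \<Rightarrow> ('h, 'n) gva set" where
  "principal_module \<mu> = \<Inter> {S. gva.subspace S \<and> gva_exp \<mu> \<in> S \<and>
     (\<forall>u\<in>principal_subspace. \<forall>v\<in>S. \<forall>n. nth_prod u n v \<in> S)}"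

definition charge_space :: "'h \<Rightarrow> ('h, 'n) gva set" where
  "charge_space \<alpha> = {v. Poly_Mapping.keys v \<subseteq> {\<alpha>}}"

text \<open>
  The span of the vectors \<open>h_k(-i_k) \<dots> h_1(-i_1) e^\<alpha>\<close> with \<open>i_1 + \<dots> + i_k + (\<alpha>|\<alpha>)/2 = n\<close>.
\<close>

definition weight_space :: "complex \<Rightarrow> ('h, 'n) gva set" where
  "weight_space n = gva.span
     {foldr (\<lambda>(h, i). heis h (- int i)) hs (gva_exp \<alpha>) | hs \<alpha>.
        (\<forall>(h, i)\<in>set hs. i > 0) \<and> of_nat (\<Sum>(h, i)\<leftarrow>hs. i) + form \<alpha> \<alpha> / 2 = n}"

definition graded_piece :: "('h, 'n) gva set \<Rightarrow> 'h \<Rightarrow> complex \<Rightarrow> ('h, 'n) gva set" where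
  "graded_piece U \<alpha> n = U \<inter> charge_space \<alpha> \<inter> weight_space n"

end

text \<open>
  A formal series in \<open>x_1, \<dots>, x_l, q\<close> with complex exponents: \<open>f a n\<close> is the coefficient
  of \<open>x_1^(a $ 1) \<dots> x_l^(a $ l) q^n\<close>.
\<close>

type_synonym 'n xq_series = "complex ^ 'n \<Rightarrow> complex \<Rightarrow> rat"

context lattice_gva
begin

text \<open>
  \<^const>\<open>vector_space.dim\<close> is \<open>0\<close> on infinite-dimensional spaces, so the statement has to assert
  the finite-dimensionality of the graded pieces separately.
\<close>

definition graded_dimension :: "'h \<Rightarrow> 'n xq_series" where
  "graded_dimension \<mu> a n =
     of_nat (gva.dim (graded_piece (principal_module \<mu>)
       (\<mu> + (\<Sum>r\<in>UNIV. scale (a $ r) (\<beta> r))) n))"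

end

definition gva_finite_dim :: "('h::ab_group_add, 'n) gva set \<Rightarrow> bool" where
  "gva_finite_dim S \<longleftrightarrow> (\<exists>F. finite F \<and> S \<subseteq> gva.span F)"

definition vec_of_nat :: "nat ^ 'n \<Rightarrow> complex ^ 'n" where
  "vec_of_nat i = (\<chi> r. of_nat (i $ r))"

text \<open>\<open>(q)_k\<close> as a power series in \<open>q\<close>.\<close>

definition q_poch :: "nat \<Rightarrow> rat fps" where
  "q_poch k = (\<Prod>j=1..k. 1 - fps_X ^ j)"

text \<open>The series \<open>q^c F(q)\<close>; the sum has at most one term.\<close>

definition q_shift :: "complex \<Rightarrow> rat fps \<Rightarrow> complex \<Rightarrow> rat" where
  "q_shift c F n = (\<Sum>m\<in>{m. n = c + of_nat m}. fps_nth F m)"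

text \<open>
  The series \<open>\<Sum>i. G i x_1^(i $ 1) \<dots> x_l^(i $ l)\<close>, where \<open>i\<close> runs over the tuples of natural numbers;
  the sum defining a coefficient has at most one term.
\<close>

definition x_series :: "(nat ^ 'n \<Rightarrow> complex \<Rightarrow> rat) \<Rightarrow> 'n xq_series" where
  "x_series G a n = (\<Sum>i\<in>{i. a = vec_of_nat i}. G i n)"

end

theory Submission
  imports Defs "HOL-Computational_Algebra.Formal_Laurent_Series"
begin

text \<open>
  Let \<open>S m b\<close> be the coefficient of \<open>z^m\<close> in \<open>exp (\<Sum>j>0. b(-j) z^j / j)\<close>. The principal subspace
  of weight \<open>\<lambda>\<close> is spanned by the vectors \<open>u e^(\<lambda> + \<alpha>)\<close>, where \<open>\<alpha>\<close> is a sum of basis vectors \<open>b\<close>,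
  with repetitions, and \<open>u\<close> is a product with one factor \<open>S m b\<close>, \<open>m \<ge> 0\<close>, for each summand \<open>b\<close>.
  These vectors are obtained from \<open>e^\<lambda>\<close> by applying the modes of the fields \<open>Y(e^b, z)\<close>, by induction
  on the degree: the creation part of \<open>Y(e^b, z)\<close> multiplies by \<open>\<Sum>m. S m b z^m\<close>, and its annihilation
  part is the identity plus operators lowering the degree. Conversely, their span is closed under the
  products with vectors of the same form for \<open>\<lambda> = 0\<close>: the field of such a vector is the coefficient
  of a monomial in variables \<open>w\<close>, one for each factor, of the normally ordered product of the fields
  \<open>Y(e^b, z + w)\<close>, hence it is composed of multiplications by elements \<open>S m b\<close> and of annihilation
  operators, which preserve the span. The \<open>S m b\<close> with \<open>m \<ge> 1\<close> are algebraically independent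
  generators of the Fock space, so the dimensions count families of multisets of natural numbers with
  prescribed sizes \<open>i r\<close> and prescribed total sum. A multiset of size \<open>k\<close> either contains \<open>0\<close> or
  consists of successors, which gives the recursion for the generating function \<open>1 / (q)\<^sub>k\<close>.
\<close>

text \<open>The obstacle is that \<open>vertex_op\<close> is defined through monomials in the modes
  \<open>\<beta> r (-n)\<close>, while the spanning vectors are products of Schur polynomials, whose
  expansion in monomials is unwieldy. Neither side is expanded. The differential equation of the
  exponential gives m S_m = sum of b(-j) S_(m-j), and the field Y(e^b, z + w), differentiated in w,
  satisfies the same recursion with multiplication by b(-j) replaced by the normally ordered product
  with a derivative of b(z). Division by m makes the solution unique, so the two agree; no
  associativity or locality statement is invoked. On vectors of charge \<delta> a field of charge
  \<alpha> is z^(\<alpha>|\<delta>) times an ordinary Laurent series over the Fock space, so complex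
  exponents enter only as an offset. A degree bound N on the vectors makes the annihilation sums
  finite. The factors S_0 = 1 keep the number of factors of each color equal to the charge; they are
  the entries 0 of the counted multisets. The degree of u adds to the weight of e^(\<lambda> +
  \<alpha>), which is half the norm of \<lambda> + \<alpha>: this is the quadratic form in the
  exponent of q.\<close>

section \<open>The Fock space as a complex vector space\<close>

abbreviation fock_scale :: "complex \<Rightarrow> 'n fock \<Rightarrow> 'n fock" where
  "fock_scale c p \<equiv> fock_const c * p"

lemma fock_const_simps [simp]:
  "fock_const 0 = 0" "fock_const 1 = 1"
  by (simp_all add: fock_const_def)

lemma fock_const_add: "fock_const (a + b) = fock_const a + fock_const b"
  by (simp add: fock_const_def single_add)

lemma fock_const_mult: "fock_const (a * b) = fock_const a * fock_const b"
  by (simp add: fock_const_def mult_single)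

lemma fock_const_sum: "fock_const (sum f A) = (\<Sum>x\<in>A. fock_const (f x))"
  by (induction A rule: infinite_finite_induct) (auto simp: fock_const_add)

lemma fock_scale_single: "fock_scale c (Poly_Mapping.single m a) = Poly_Mapping.single m (c * a)"
  by (simp add: fock_const_def mult_single)

global_interpretation fock: vector_space "fock_scale :: complex \<Rightarrow> 'n fock \<Rightarrow> _"
  by unfold_locales (auto simp: algebra_simps fock_const_add fock_const_mult)

global_interpretation fock_pair: vector_space_pair
  "fock_scale :: complex \<Rightarrow> 'n fock \<Rightarrow> _" "fock_scale :: complex \<Rightarrow> 'n fock \<Rightarrow> _"
  by unfold_locales

abbreviation fock_linear :: "('n fock \<Rightarrow> 'n fock) \<Rightarrow> bool" where
  "fock_linear \<equiv> Vector_Spaces.linear fock_scale fock_scale"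

lemma fock_linearI:
  assumes "\<And>p q. f (p + q) = f p + f q" "\<And>c p. f (fock_scale c p) = fock_scale c (f p)"
  shows "fock_linear f"
  using assms fock.vector_space_axioms by (auto simp: Vector_Spaces.linear_iff)

lemma fock_expand: "p = (\<Sum>m\<in>Poly_Mapping.keys p. Poly_Mapping.single m (Poly_Mapping.lookup p m))"
  by (rule poly_mapping_eqI) (auto simp: lookup_sum lookup_single when_def in_keys_iff)

lemma fock_linear_eqI:
  assumes "fock_linear f" "fock_linear g"
    "\<And>m. f (Poly_Mapping.single m 1) = g (Poly_Mapping.single m 1)"
  shows "f p = g p"
proof -
  have "f (Poly_Mapping.single m c) = g (Poly_Mapping.single m c)" for m c
    using fock_pair.linear_scale[OF assms(1), of c "Poly_Mapping.single m 1"]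
      fock_pair.linear_scale[OF assms(2), of c "Poly_Mapping.single m 1"] assms(3)
    by (simp add: fock_scale_single)
  then have "f (\<Sum>m\<in>Poly_Mapping.keys p. Poly_Mapping.single m (Poly_Mapping.lookup p m)) =
      g (\<Sum>m\<in>Poly_Mapping.keys p. Poly_Mapping.single m (Poly_Mapping.lookup p m))"
    by (simp only: fock_pair.linear_sum[OF assms(1)] fock_pair.linear_sum[OF assms(2)])
  then show ?thesis
    by (simp only: fock_expand[symmetric])
qed

lemma fock_linear_compose: "fock_linear f \<Longrightarrow> fock_linear g \<Longrightarrow> fock_linear (\<lambda>p. f (g p))"
  by (auto simp: Vector_Spaces.linear_iff)

lemma fock_linear_mult: "fock_linear ((*) p)"
  by (rule fock_linearI) (auto simp: algebra_simps)

lemma fock_linear_mult_right: "fock_linear (\<lambda>q. q * p)"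
  by (rule fock_linearI) (auto simp: algebra_simps)

lemma fock_linear_sum: "(\<And>i. i \<in> A \<Longrightarrow> fock_linear (f i)) \<Longrightarrow> fock_linear (\<lambda>p. \<Sum>i\<in>A. f i p)"
  by (rule fock_pair.linear_compose_sum) auto

lemma fock_linear_scale: "fock_linear f \<Longrightarrow> fock_linear (\<lambda>p. fock_scale c (f p))"
  by (rule fock_pair.linear_compose_scale_right)

lemma fock_linear_id: "fock_linear (\<lambda>p. p)"
  by (rule fock_linearI) auto

subsection \<open>Derivations\<close>

lemma fock_pderiv_superset:
  assumes "finite A" "Poly_Mapping.keys p \<subseteq> A"
  shows "fock_pderiv x p = (\<Sum>m\<in>A. Poly_Mapping.single (m - Poly_Mapping.single x 1)
       (of_nat (Poly_Mapping.lookup m x) * Poly_Mapping.lookup p m))"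
  unfolding fock_pderiv_def
  by (rule sum.mono_neutral_left) (use assms in \<open>auto simp: in_keys_iff\<close>)

lemma fock_pderiv_single:
  "fock_pderiv x (Poly_Mapping.single m c) =
     Poly_Mapping.single (m - Poly_Mapping.single x 1) (of_nat (Poly_Mapping.lookup m x) * c)"
  by (subst fock_pderiv_superset[of "{m}"]) auto

lemma fock_linear_pderiv: "fock_linear (fock_pderiv x)"
proof (rule fock_linearI)
  fix p q :: "'a fock"
  let ?A = "Poly_Mapping.keys p \<union> Poly_Mapping.keys q"
  show "fock_pderiv x (p + q) = fock_pderiv x p + fock_pderiv x q"
    using keys_add[of p q]
    by (simp add: fock_pderiv_superset[of ?A] lookup_add ring_distribs single_add sum.distrib)
next
  fix c and p :: "'a fock"
  have l: "Poly_Mapping.lookup (fock_scale c p) m = c * Poly_Mapping.lookup p m" for m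
    by (simp add: fock_const_def mult_map_scale_conv_mult[symmetric] map.rep_eq when_def)
  then have "Poly_Mapping.keys (fock_scale c p) \<subseteq> Poly_Mapping.keys p"
    by (auto simp: in_keys_iff)
  then show "fock_pderiv x (fock_scale c p) = fock_scale c (fock_pderiv x p)"
    by (simp add: fock_pderiv_superset[of "Poly_Mapping.keys p"] l sum_distrib_left
      fock_scale_single mult.left_commute)
qed

lemma single_diff_add:
  fixes m n :: "'x \<Rightarrow>\<^sub>0 nat"
  assumes "Poly_Mapping.lookup m x \<noteq> 0"
  shows "m - Poly_Mapping.single x 1 + n = m + n - Poly_Mapping.single x 1"
  by (rule poly_mapping_eqI) (use assms in \<open>auto simp: lookup_add lookup_minus lookup_single when_def\<close>)

text \<open>By bilinearity the Leibniz rule reduces to monomials, first in the right factor and then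
  in the left one.\<close>

lemma fock_pderiv_mult: "fock_pderiv x (p * q) = fock_pderiv x p * q + p * fock_pderiv x q"
proof -
  have 1: "fock_pderiv x (Poly_Mapping.single m 1 * Poly_Mapping.single n 1) =
      fock_pderiv x (Poly_Mapping.single m 1) * Poly_Mapping.single n 1
      + Poly_Mapping.single m 1 * fock_pderiv x (Poly_Mapping.single n 1)" for m n
  proof -
    \<comment> \<open>If x does not divide m, truncated subtraction makes the two exponents differ,
      but then the coefficient is zero.\<close>
    have a: "Poly_Mapping.single (m + n - Poly_Mapping.single x 1) (of_nat (Poly_Mapping.lookup m x))
       = Poly_Mapping.single (m - Poly_Mapping.single x 1 + n) (of_nat (Poly_Mapping.lookup m x) :: complex)"
      by (cases "Poly_Mapping.lookup m x = 0") (simp_all add: single_diff_add del: One_nat_def)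
    have b: "Poly_Mapping.single (m + n - Poly_Mapping.single x 1) (of_nat (Poly_Mapping.lookup n x))
       = Poly_Mapping.single (m + (n - Poly_Mapping.single x 1)) (of_nat (Poly_Mapping.lookup n x) :: complex)"
      by (cases "Poly_Mapping.lookup n x = 0")
        (simp_all add: single_diff_add add.commute[of m] del: One_nat_def)
    show ?thesis
      unfolding mult_single fock_pderiv_single lookup_add of_nat_add mult_1_right single_add a b
      by simp
  qed
  note simps = fock_pair.linear_add[OF fock_linear_pderiv] fock_pair.linear_scale[OF fock_linear_pderiv]
  have 2: "fock_pderiv x (Poly_Mapping.single m 1 * q) =
      fock_pderiv x (Poly_Mapping.single m 1) * q + Poly_Mapping.single m 1 * fock_pderiv x q" for m
  proof (rule fock_linear_eqI[where p = q])
    show "fock_linear (\<lambda>q. fock_pderiv x (Poly_Mapping.single m 1 * q))"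
      by (rule fock_linearI) (simp_all add: simps ring_distribs mult.left_commute[of _ "fock_const _"])
    show "fock_linear (\<lambda>q. fock_pderiv x (Poly_Mapping.single m 1) * q
        + Poly_Mapping.single m 1 * fock_pderiv x q)"
      by (rule fock_linearI) (simp_all add: simps ring_distribs mult.left_commute[of _ "fock_const _"])
  qed (rule 1)
  show ?thesis
  proof (rule fock_linear_eqI[where p = p])
    show "fock_linear (\<lambda>p. fock_pderiv x (p * q))"
      by (rule fock_linearI) (simp_all add: simps ring_distribs mult.assoc)
    show "fock_linear (\<lambda>p. fock_pderiv x p * q + p * fock_pderiv x q)"
      by (rule fock_linearI) (simp_all add: simps ring_distribs mult.assoc)
  qed (rule 2)
qed

lemma fock_pderiv_commute: "fock_pderiv x (fock_pderiv y p) = fock_pderiv y (fock_pderiv x p)"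
proof (rule fock_linear_eqI[where p = p])
  fix m
  have "m - Poly_Mapping.single x 1 - Poly_Mapping.single y 1 =
      m - Poly_Mapping.single y 1 - Poly_Mapping.single x (1::nat)"
    by (rule poly_mapping_eqI) (auto simp: lookup_minus)
  then show "fock_pderiv x (fock_pderiv y (Poly_Mapping.single m 1)) =
      fock_pderiv y (fock_pderiv x (Poly_Mapping.single m 1))"
    by (cases "x = y") (auto simp: fock_pderiv_single lookup_minus lookup_single_not_eq mult.commute)
next
  show "fock_linear (\<lambda>p. fock_pderiv x (fock_pderiv y p))" for x y :: "'a \<times> nat"
    by (rule fock_linear_compose[OF fock_linear_pderiv fock_linear_pderiv])
  then show "fock_linear (\<lambda>p. fock_pderiv y (fock_pderiv x p))" .
qed

lemma fock_pderiv_var: "fock_pderiv x (fock_var y) = (if x = y then 1 else 0)"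
  by (auto simp: fock_var_def fock_pderiv_single lookup_single_not_eq)

subsection \<open>Grading\<close>

definition monom_wt :: "'n heis_monom \<Rightarrow> nat" where
  "monom_wt m = (\<Sum>x\<in>Poly_Mapping.keys m. (snd x + 1) * Poly_Mapping.lookup m x)"

text \<open>A set of admissible degrees replaces a single degree: lowering below zero gives the
  empty set without any truncated subtraction, and \<open>fock_graded_empty\<close> turns this into
  vanishing.\<close>

definition fock_graded :: "nat set \<Rightarrow> 'n fock \<Rightarrow> bool" where
  "fock_graded T p \<longleftrightarrow> monom_wt ` Poly_Mapping.keys p \<subseteq> T"

lemma monom_wt_superset:
  assumes "finite A" "Poly_Mapping.keys m \<subseteq> A"
  shows "monom_wt m = (\<Sum>x\<in>A. (snd x + 1) * Poly_Mapping.lookup m x)"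
  unfolding monom_wt_def
  by (rule sum.mono_neutral_left) (use assms in \<open>auto simp: in_keys_iff\<close>)

lemma monom_wt_add: "monom_wt (m + n) = monom_wt m + monom_wt n"
  using keys_add[of m n]
  by (simp add: monom_wt_superset[of "Poly_Mapping.keys m \<union> Poly_Mapping.keys n"]
      lookup_add ring_distribs sum.distrib)

lemma monom_wt_0 [simp]: "monom_wt 0 = 0"
  by (simp add: monom_wt_def)

lemma monom_wt_single [simp]: "monom_wt (Poly_Mapping.single x c) = (snd x + 1) * c"
  by (simp add: monom_wt_def)

lemma fock_graded_0 [simp]: "fock_graded T 0"
  by (simp add: fock_graded_def)

lemma fock_graded_empty: "fock_graded {} p \<longleftrightarrow> p = 0"
  by (simp add: fock_graded_def)

lemma fock_graded_mono: "fock_graded T p \<Longrightarrow> T \<subseteq> T' \<Longrightarrow> fock_graded T' p"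
  by (auto simp: fock_graded_def)

lemma fock_graded_add: "fock_graded T p \<Longrightarrow> fock_graded T q \<Longrightarrow> fock_graded T (p + q)"
  using keys_add[of p q] by (fastforce simp: fock_graded_def)

lemma fock_graded_sum: "(\<And>i. i \<in> A \<Longrightarrow> fock_graded T (f i)) \<Longrightarrow> fock_graded T (\<Sum>i\<in>A. f i)"
  by (induction A rule: infinite_finite_induct) (auto intro: fock_graded_add)

lemma fock_graded_mult:
  assumes "fock_graded T p" "fock_graded T' q"
  shows "fock_graded {a + b | a b. a \<in> T \<and> b \<in> T'} (p * q)"
  unfolding fock_graded_def
proof (rule image_subsetI)
  fix m assume "m \<in> Poly_Mapping.keys (p * q)"
  then obtain m1 m2 where "m = m1 + m2" "m1 \<in> Poly_Mapping.keys p" "m2 \<in> Poly_Mapping.keys q"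
    using keys_mult[of p q] by blast
  then show "monom_wt m \<in> {a + b | a b. a \<in> T \<and> b \<in> T'}"
    using assms by (simp add: fock_graded_def monom_wt_add image_subset_iff) blast
qed

lemma fock_graded_single: "fock_graded {monom_wt m} (Poly_Mapping.single m c)"
  by (auto simp: fock_graded_def)

lemma fock_graded_const: "fock_graded {0} (fock_const c)"
  unfolding fock_const_def using fock_graded_single[of 0] by simp

lemma fock_graded_scale: "fock_graded T p \<Longrightarrow> fock_graded T (fock_scale c p)"
  using fock_graded_mult[OF fock_graded_const] by fastforce

lemma fock_graded_var: "fock_graded {snd x + 1} (fock_var x)"
  unfolding fock_var_def using fock_graded_single[of "Poly_Mapping.single x 1" 1] by simp

lemma fock_subspace_graded: "fock.subspace {p. fock_graded T p}"
  by (auto simp: fock.subspace_def intro: fock_graded_add fock_graded_scale)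

lemma fock_graded_pderiv:
  assumes "fock_graded T p"
  shows "fock_graded {w. w + snd x + 1 \<in> T} (fock_pderiv x p)"
proof -
  have "fock_graded {w. w + snd x + 1 \<in> T}
     (Poly_Mapping.single (m - Poly_Mapping.single x 1) (of_nat (Poly_Mapping.lookup m x) * c))"
    if m: "m \<in> Poly_Mapping.keys p" for m c
  proof (cases "Poly_Mapping.lookup m x = 0")
    case False
    have "m - Poly_Mapping.single x 1 + Poly_Mapping.single x 1 = m"
      by (rule poly_mapping_eqI) (use False in \<open>auto simp: lookup_add lookup_minus lookup_single when_def\<close>)
    then have "monom_wt (m - Poly_Mapping.single x 1) + (snd x + 1) = monom_wt m"
      by (metis monom_wt_add monom_wt_single mult_1_right)
    then have "monom_wt (m - Poly_Mapping.single x 1) + snd x + 1 \<in> T"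
      using assms m by (auto simp: fock_graded_def)
    then show ?thesis
      by (intro fock_graded_mono[OF fock_graded_single]) auto
  qed simp
  then show ?thesis
    unfolding fock_pderiv_def by (rule fock_graded_sum)
qed

subsection \<open>Exponentials of operator series\<close>

text \<open>This reindexing and the next one enumerate triples of total m. They bring the two halves
  of a product rule into a common shape with the differentiated index j outermost.\<close>

lemma sum_triangle_left:
  fixes F :: "nat \<Rightarrow> nat \<Rightarrow> nat \<Rightarrow> 'a::comm_monoid_add"
  shows "(\<Sum>i\<le>m. \<Sum>j\<in>{1..i}. F j (i - j) (m - i)) = (\<Sum>j\<in>{1..m}. \<Sum>i\<le>m - j. F j i (m - j - i))"
  unfolding sum.Sigma[OF finite_atMost ballI[OF finite_atLeastAtMost]]
    sum.Sigma[OF finite_atLeastAtMost ballI[OF finite_atMost]]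
  by (rule sum.reindex_bij_witness[of _ "\<lambda>(j, i). (i + j, j)" "\<lambda>(i, j). (j, i - j)"]) auto

lemma sum_triangle_right:
  fixes F :: "nat \<Rightarrow> nat \<Rightarrow> nat \<Rightarrow> 'a::comm_monoid_add"
  shows "(\<Sum>i\<le>m. \<Sum>j\<in>{1..m - i}. F j i (m - i - j)) = (\<Sum>j\<in>{1..m}. \<Sum>i\<le>m - j. F j i (m - j - i))"
  unfolding sum.Sigma[OF finite_atMost ballI[OF finite_atLeastAtMost]]
    sum.Sigma[OF finite_atLeastAtMost ballI[OF finite_atMost]]
  by (rule sum.reindex_bij_witness[of _ "\<lambda>(j, i). (i, j)" "\<lambda>(i, j). (j, i)"])
    (auto simp: diff_commute add.commute)

text \<open>The coefficient of \<open>t^m\<close> in \<open>exp (\<Sum>j>0. f j t^j / j)\<close>, defined by the differential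
  equation of the exponential.\<close>

function exp_op :: "(nat \<Rightarrow> 'n fock \<Rightarrow> 'n fock) \<Rightarrow> nat \<Rightarrow> 'n fock \<Rightarrow> 'n fock" where
  "exp_op f m q = (if m = 0 then q
     else fock_scale (1 / of_nat m) (\<Sum>j\<in>{1..m}. f j (exp_op f (m - j) q)))"
  by pat_completeness auto
termination by (relation "measure (\<lambda>(f, m, q). m)") auto

declare exp_op.simps [simp del]

lemma exp_op_0 [simp]: "exp_op f 0 q = q"
  by (simp add: exp_op.simps)

lemma exp_op_rec:
  "fock_scale (of_nat m) (exp_op f m q) = (\<Sum>j\<in>{1..m}. f j (exp_op f (m - j) q))"
proof (cases "m = 0")
  case False
  then show ?thesis
    by (subst exp_op.simps) (simp flip: fock_const_mult mult.assoc)
qed simp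

lemma fock_scale_of_nat_cancel:
  assumes "fock_scale (of_nat m) p = fock_scale (of_nat m) q" "m > 0"
  shows "p = q"
  using fock.scale_left_imp_eq fock.scale_left_commute assms
  by (metis fock.scale_cancel_left of_nat_0_eq_iff less_numeral_extra(3))

text \<open>For m > 0 the recursion can be divided by m, so it determines all coefficients from the
  constant one. Identities between exponentials are proved below by checking this recursion.\<close>

lemma exp_op_unique:
  assumes "T 0 = q"
    and "\<And>m. fock_scale (of_nat m) (T m) = (\<Sum>j\<in>{1..m}. f j (T (m - j)))"
  shows "T m = exp_op f m q"
proof (induction m rule: less_induct)
  case (less m)
  show ?case
  proof (cases "m = 0")
    case False
    have "fock_scale (of_nat m) (T m) = fock_scale (of_nat m) (exp_op f m q)"
      unfolding assms(2) exp_op_rec by (intro sum.cong refl) (use less False in auto)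
    then show ?thesis
      using False fock_scale_of_nat_cancel by blast
  qed (use assms in simp)
qed

lemma exp_op_commute:
  assumes "fock_linear h" "\<And>j p. h (f j p) = f j (h p)"
  shows "h (exp_op f m q) = exp_op f m (h q)"
proof (rule exp_op_unique[where T = "\<lambda>m. h (exp_op f m q)"])
  fix m
  have "fock_scale (of_nat m) (h (exp_op f m q)) = h (fock_scale (of_nat m) (exp_op f m q))"
    by (simp add: fock_pair.linear_scale[OF assms(1)])
  then show "fock_scale (of_nat m) (h (exp_op f m q)) = (\<Sum>j = 1..m. f j (h (exp_op f (m - j) q)))"
    unfolding exp_op_rec by (simp add: fock_pair.linear_sum[OF assms(1)] assms(2))
qed simp

lemma fock_linear_exp_op:
  assumes "\<And>j. fock_linear (f j)"
  shows "fock_linear (exp_op f m)"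
proof (induction m rule: less_induct)
  case (less m)
  show ?case
  proof (cases "m = 0")
    case False
    have "fock_linear (\<lambda>q. fock_scale (1 / of_nat m) (\<Sum>j\<in>{1..m}. f j (exp_op f (m - j) q)))"
      by (intro fock_linear_scale fock_linear_sum fock_linear_compose[OF assms] less)
        (use False in auto)
    also have "(\<lambda>q. fock_scale (1 / of_nat m) (\<Sum>j\<in>{1..m}. f j (exp_op f (m - j) q))) = exp_op f m"
      using False by (subst (2) exp_op.simps[abs_def]) (simp add: fun_eq_iff)
    finally show ?thesis .
  qed (simp add: fock_linear_id)
qed

text \<open>The family V stays abstract so that one induction serves both the degree grading and the
  spans of Schur products.\<close>

lemma exp_op_lowers:
  fixes V :: "nat set \<Rightarrow> 'n fock set"
  assumes sub: "\<And>T. fock.subspace (V T)"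
    and "\<And>j T p. j > 0 \<Longrightarrow> p \<in> V T \<Longrightarrow> f j p \<in> V {w. w + j \<in> T}"
    and "q \<in> V T"
  shows "exp_op f m q \<in> V {w. w + m \<in> T}"
proof (induction m rule: less_induct)
  case (less m)
  show ?case
  proof (cases "m = 0")
    case False
    have "f j (exp_op f (m - j) q) \<in> V {w. w + m \<in> T}" if "j \<in> {1..m}" for j
      using assms(2)[OF _ less[of "m - j"], of j] that False by (simp add: add.assoc)
    then show ?thesis
      using False by (subst exp_op.simps) (simp only: if_False fock.subspace_scale fock.subspace_sum sub)
  qed (use assms in simp)
qed

text \<open>The product of the two exponentials solves the differential equation of the exponential
  of the sum: the Euler operator t d/dt multiplies a term by m = i + (m - i), one summand for each
  factor.\<close>

lemma exp_op_add:
  assumes lin: "\<And>j. fock_linear (f j)" "\<And>j. fock_linear (g j)"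
    and comm: "\<And>i j p. f i (g j p) = g j (f i p)"
  shows "exp_op (\<lambda>j p. f j p + g j p) m q = (\<Sum>i\<le>m. exp_op f i (exp_op g (m - i) q))"
proof (rule exp_op_unique[where T = "\<lambda>m. \<Sum>i\<le>m. exp_op f i (exp_op g (m - i) q)", symmetric])
  fix m
  have gc: "g j (exp_op f i p) = exp_op f i (g j p)" for i j p
    by (rule exp_op_commute[OF lin(2)]) (simp add: comm)
  have "fock_scale (of_nat m) (\<Sum>i\<le>m. exp_op f i (exp_op g (m - i) q)) =
      (\<Sum>i\<le>m. fock_scale (of_nat i) (exp_op f i (exp_op g (m - i) q))
         + exp_op f i (fock_scale (of_nat (m - i)) (exp_op g (m - i) q)))"
    unfolding sum_distrib_left
    by (intro sum.cong refl)
      (simp add: fock_pair.linear_scale[OF fock_linear_exp_op[OF lin(1)]] of_nat_diff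
        flip: ring_distribs fock_const_add)
  also have "\<dots> = (\<Sum>i\<le>m. \<Sum>j\<in>{1..i}. f j (exp_op f (i - j) (exp_op g (m - i) q)))
         + (\<Sum>i\<le>m. \<Sum>j\<in>{1..m - i}. exp_op f i (g j (exp_op g (m - i - j) q)))"
    by (simp only: exp_op_rec sum.distrib fock_pair.linear_sum[OF fock_linear_exp_op[OF lin(1)]])
  also have "\<dots> = (\<Sum>j\<in>{1..m}. \<Sum>i\<le>m - j. f j (exp_op f i (exp_op g (m - j - i) q)))
         + (\<Sum>j\<in>{1..m}. \<Sum>i\<le>m - j. exp_op f i (g j (exp_op g (m - j - i) q)))"
    unfolding sum_triangle_left[of "\<lambda>j i l. f j (exp_op f i (exp_op g l q))"]
      sum_triangle_right[of "\<lambda>j i l. exp_op f i (g j (exp_op g l q))"] ..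
  also have "\<dots> = (\<Sum>j\<in>{1..m}. f j (\<Sum>i\<le>m - j. exp_op f i (exp_op g (m - j - i) q))
      + g j (\<Sum>i\<le>m - j. exp_op f i (exp_op g (m - j - i) q)))"
    by (simp add: sum.distrib fock_pair.linear_sum[OF lin(1)] fock_pair.linear_sum[OF lin(2)]
        gc)
  finally show "fock_scale (of_nat m) (\<Sum>i\<le>m. exp_op f i (exp_op g (m - i) q)) = \<dots>" .
qed simp

text \<open>The coefficient of \<open>t^m\<close> in \<open>(\<Sum>j>0. f j t^j / j)^k\<close>.\<close>

fun pow_op :: "(nat \<Rightarrow> 'n fock \<Rightarrow> 'n fock) \<Rightarrow> nat \<Rightarrow> nat \<Rightarrow> 'n fock \<Rightarrow> 'n fock" where
  "pow_op f 0 m q = (if m = 0 then q else 0)"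
| "pow_op f (Suc k) m q = (\<Sum>j\<in>{1..m}. fock_scale (1 / of_nat j) (f j (pow_op f k (m - j) q)))"

text \<open>The series raised to the power k has no constant term, so its power starts at
  t^k.\<close>

lemma pow_op_eq_0:
  assumes "\<And>j. fock_linear (f j)"
  shows "k > m \<Longrightarrow> pow_op f k m q = 0"
proof (induction k arbitrary: m)
  case (Suc k)
  then show ?case
    by (auto intro!: sum.neutral simp: fock_pair.linear_0[OF assms])
qed simp

text \<open>This is the power rule for P = (sum of f j t^j / j) in the form t (P^(k+1))' = (k + 1)
  P^k (t P'). The Euler operator cancels the denominators j, and commutativity of the operators is
  what makes the power rule valid.\<close>

lemma pow_op_derivative:
  assumes lin: "\<And>j. fock_linear (f j)" and comm: "\<And>i j p. f i (f j p) = f j (f i p)"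
  shows "fock_scale (of_nat m) (pow_op f (Suc k) m q) =
    fock_scale (of_nat (Suc k)) (\<Sum>j\<in>{1..m}. f j (pow_op f k (m - j) q))"
proof (induction k arbitrary: m)
  case 0
  have "(\<Sum>j = 1..m. fock_scale (of_nat m) (fock_scale (1 / of_nat j) (f j (pow_op f 0 (m - j) q)))) =
      (\<Sum>j = 1..m. f j (pow_op f 0 (m - j) q))"
  proof (rule sum.cong[OF refl])
    fix j assume j: "j \<in> {1..m}"
    show "fock_scale (of_nat m) (fock_scale (1 / of_nat j) (f j (pow_op f 0 (m - j) q))) =
       f j (pow_op f 0 (m - j) q)"
    proof (cases "j = m")
      case True
      then show ?thesis
        using j by (simp flip: fock_const_mult mult.assoc)
    qed (use j in \<open>auto simp: fock_pair.linear_0[OF lin]\<close>)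
  qed
  then show ?case
    by (simp add: sum_distrib_left)
next
  case (Suc k)
  let ?P = "\<lambda>k m. pow_op f k m q"
  have "fock_scale (of_nat m) (?P (Suc (Suc k)) m) =
      (\<Sum>j=1..m. f j (?P (Suc k) (m - j))
        + fock_scale (1 / of_nat j) (f j (fock_scale (of_nat (m - j)) (?P (Suc k) (m - j)))))"
    unfolding pow_op.simps(2)[of f "Suc k"] sum_distrib_left
  proof (rule sum.cong[OF refl])
    fix j assume j: "j \<in> {1..m}"
    \<comment> \<open>The factor m / j splits as j / j for the derivative of the new factor plus (m
      - j) / j for that of the remaining power.\<close>
    then have e: "(of_nat m :: complex) * (1 / of_nat j) = 1 + (1 / of_nat j) * of_nat (m - j)"
      by (simp add: field_simps of_nat_diff)
    show "fock_scale (of_nat m) (fock_scale (1 / of_nat j) (f j (?P (Suc k) (m - j)))) =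
      f j (?P (Suc k) (m - j))
        + fock_scale (1 / of_nat j) (f j (fock_scale (of_nat (m - j)) (?P (Suc k) (m - j))))"
      unfolding fock_pair.linear_scale[OF lin] mult.assoc[symmetric]
        fock_const_mult[symmetric] e fock_const_add by (simp add: ring_distribs)
  qed
  also have "\<dots> = (\<Sum>j=1..m. f j (?P (Suc k) (m - j)))
      + (\<Sum>j=1..m. fock_scale (1 / of_nat j) (f j (fock_scale (of_nat (Suc k)) (\<Sum>i\<in>{1..m - j}. f i (?P k (m - j - i))))))"
    by (simp only: sum.distrib Suc.IH)
  also have "(\<Sum>j=1..m. fock_scale (1 / of_nat j) (f j (fock_scale (of_nat (Suc k)) (\<Sum>i\<in>{1..m - j}. f i (?P k (m - j - i)))))) =
     fock_scale (of_nat (Suc k)) (\<Sum>j=1..m. \<Sum>i\<in>{1..m - j}. fock_scale (1 / of_nat j) (f i (f j (?P k (m - j - i)))))"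
    by (simp only: fock_pair.linear_scale[OF lin] fock_pair.linear_sum[OF lin] sum_distrib_left
        mult.left_commute[of _ "fock_const (of_nat (Suc k))"] comm)
  also have "(\<Sum>j=1..m. \<Sum>i\<in>{1..m - j}. fock_scale (1 / of_nat j) (f i (f j (?P k (m - j - i))))) =
      (\<Sum>i=1..m. \<Sum>j\<in>{1..m - i}. fock_scale (1 / of_nat j) (f i (f j (?P k (m - j - i)))))"
    unfolding sum.Sigma[OF finite_atLeastAtMost ballI[OF finite_atLeastAtMost]]
    by (rule sum.reindex_bij_witness[of _ "\<lambda>(j, i). (i, j)" "\<lambda>(i, j). (j, i)"]) auto
  also have "\<dots> = (\<Sum>i=1..m. f i (?P (Suc k) (m - i)))"
    by (simp add: fock_pair.linear_sum[OF lin] fock_pair.linear_scale[OF lin] diff_commute add.commute)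
  also have "(\<Sum>i=1..m. f i (?P (Suc k) (m - i))) + fock_scale (of_nat (Suc k)) (\<Sum>i=1..m. f i (?P (Suc k) (m - i)))
      = fock_scale (of_nat (Suc (Suc k))) (\<Sum>i=1..m. f i (?P (Suc k) (m - i)))"
    by (simp only: of_nat_Suc[of "Suc k"] fock_const_add ring_distribs fock_const_simps mult_1)
  finally show ?case .
qed

text \<open>This links the recursive description to the sum of powers over factorials by which
  \<open>field_exp\<close> is defined.\<close>

lemma exp_op_eq_sum_pow_op:
  assumes lin: "\<And>j. fock_linear (f j)" and comm: "\<And>i j p. f i (f j p) = f j (f i p)"
  shows "exp_op f m q = (\<Sum>k\<le>m. fock_scale (1 / fact k) (pow_op f k m q))"
proof (rule exp_op_unique[where T = "\<lambda>m. \<Sum>k\<le>m. fock_scale (1 / fact k) (pow_op f k m q)", symmetric])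
  fix m
  \<comment> \<open>The vanishing term k = m + 1 is added because differentiation shifts k by one;
    the term k = 0 then drops out, being constant in t.\<close>
  have "(\<Sum>k\<le>m. fock_scale (1 / fact k) (pow_op f k m q)) =
      (\<Sum>k\<le>Suc m. fock_scale (1 / fact k) (pow_op f k m q))"
    by (simp add: pow_op_eq_0[OF lin] del: pow_op.simps)
  also have "fock_scale (of_nat m) \<dots> = (\<Sum>k\<le>m. fock_scale (1 / fact (Suc k)) (fock_scale (of_nat m) (pow_op f (Suc k) m q)))"
    unfolding sum.atMost_Suc_shift by (simp add: ring_distribs sum_distrib_left mult_ac del: pow_op.simps(2) fact_Suc)
  also have "\<dots> = (\<Sum>k\<le>m. \<Sum>j\<in>{1..m}. fock_scale (1 / fact k) (f j (pow_op f k (m - j) q)))"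
    unfolding pow_op_derivative[OF lin comm] mult.assoc[symmetric] fock_const_mult[symmetric] sum_distrib_left
    by (simp del: of_nat_Suc)
  also have "\<dots> = (\<Sum>j\<in>{1..m}. \<Sum>k\<le>m. fock_scale (1 / fact k) (f j (pow_op f k (m - j) q)))"
    by (rule sum.swap)
  also have "\<dots> = (\<Sum>j\<in>{1..m}. \<Sum>k\<le>m - j. fock_scale (1 / fact k) (f j (pow_op f k (m - j) q)))"
    by (intro sum.cong refl sum.mono_neutral_right)
      (auto simp: pow_op_eq_0[OF lin] fock_pair.linear_0[OF lin])
  finally show "fock_scale (of_nat m) (\<Sum>k\<le>m. fock_scale (1 / fact k) (pow_op f k m q)) =
      (\<Sum>j\<in>{1..m}. f j (\<Sum>k\<le>m - j. fock_scale (1 / fact k) (pow_op f k (m - j) q)))"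
    by (simp add: fock_pair.linear_sum[OF lin] fock_pair.linear_scale[OF lin])
qed simp

context lattice_gva
begin

subsection \<open>Heisenberg operators on the Fock space\<close>

lemma form_add: "form h (x + y) = form h x + form h y" "form (x + y) h = form x h + form y h"
proof -
  show 1: "form h (x + y) = form h x + form h y" for h x y
    using form_linear[of h] by (simp add: Vector_Spaces.linear_iff)
  show "form (x + y) h = form x h + form y h"
    by (metis form_sym 1)
qed

lemma form_scale: "form h (scale c x) = c * form h x" "form (scale c x) h = c * form x h"
proof -
  show 1: "form h (scale c x) = c * form h x" for h
    using form_linear[of h] by (simp add: Vector_Spaces.linear_iff)
  show "form (scale c x) h = c * form x h"
    by (metis form_sym 1)
qed

lemma form_0 [simp]: "form h 0 = 0" "form 0 h = 0"
  using form_add(1)[of h 0 0] form_add(2)[of 0 0 h] by simp_all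

lemma form_sum: "form h (sum f A) = (\<Sum>x\<in>A. form h (f x))"
  by (induction A rule: infinite_finite_induct) (auto simp: form_add)

lemma coord_add: "coord (h + h') r = coord h r + coord h' r"
  unfolding coord_def
  using representation_add[OF basis_independent] basis_span by auto

lemma coord_basis: "coord (\<beta> r) s = (if r = s then 1 else 0)"
  unfolding coord_def
  using representation_basis[OF basis_independent] basis_inj by (auto dest: injD)

lemma heis_elem_add: "heis_elem (h + h') k = heis_elem h k + heis_elem h' k"
  by (simp add: heis_elem_def coord_add fock_const_add ring_distribs sum.distrib)

lemma heis_elem_basis: "heis_elem (\<beta> r) k = fock_var (r, k)"
proof -
  have "heis_elem (\<beta> r) k = (\<Sum>s\<in>UNIV. if r = s then fock_var (s, k) else 0)"
    unfolding heis_elem_def by (rule sum.cong) (auto simp: coord_basis)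
  then show ?thesis
    by simp
qed

lemma fock_linear_heis_deriv: "fock_linear (heis_deriv h k)"
  unfolding heis_deriv_def[abs_def]
  by (intro fock_linear_sum fock_linear_scale fock_linear_pderiv)

lemmas heis_deriv_simps = fock_pair.linear_add[OF fock_linear_heis_deriv]
  fock_pair.linear_scale[OF fock_linear_heis_deriv] fock_pair.linear_sum[OF fock_linear_heis_deriv]
  fock_pair.linear_0[OF fock_linear_heis_deriv] fock_pair.linear_neg[OF fock_linear_heis_deriv]

lemma heis_deriv_mult: "heis_deriv h k (p * q) = heis_deriv h k p * q + p * heis_deriv h k q"
  by (simp add: heis_deriv_def fock_pderiv_mult ring_distribs sum.distrib sum_distrib_left
      sum_distrib_right mult_ac)

lemma heis_deriv_commute: "heis_deriv h k (heis_deriv h' k' p) = heis_deriv h' k' (heis_deriv h k p)"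
  unfolding heis_deriv_def fock_pair.linear_sum[OF fock_linear_pderiv]
    fock_pair.linear_scale[OF fock_linear_pderiv] sum_distrib_left
  by (subst sum.swap) (simp add: fock_pderiv_commute mult.left_commute)

lemma heis_deriv_add: "heis_deriv (h + h') k p = heis_deriv h k p + heis_deriv h' k p"
  by (simp add: heis_deriv_def form_add ring_distribs fock_const_add sum.distrib)

lemma heis_deriv_var:
  "heis_deriv h k (fock_var (r, m)) = (if k = m then fock_const (of_nat (k + 1) * form h (\<beta> r)) else 0)"
proof -
  have "heis_deriv h k (fock_var (r, m)) =
      (\<Sum>s\<in>UNIV. if s = r then if k = m then fock_const (of_nat (k + 1) * form h (\<beta> r)) else 0 else 0)"
    unfolding heis_deriv_def by (rule sum.cong) (auto simp: fock_pderiv_var)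
  then show ?thesis
    by simp
qed

lemma heis_deriv_1 [simp]: "heis_deriv h k 1 = 0"
  using heis_deriv_mult[of h k 1 1] by simp

lemma heis_deriv_graded:
  assumes "fock_graded T p"
  shows "fock_graded {w. w + k + 1 \<in> T} (heis_deriv h k p)"
  unfolding heis_deriv_def
  using fock_graded_pderiv[OF assms, of "(_, k)"]
  by (intro fock_graded_sum fock_graded_scale) auto

lemma heis_elem_graded: "fock_graded {k + 1} (heis_elem h k)"
  unfolding heis_elem_def
  using fock_graded_var[of "(_, k)"] by (intro fock_graded_sum fock_graded_scale) auto

section \<open>Exponentials of the creation and annihilation parts\<close>

text \<open>The coefficients of \<open>z^m\<close> in \<open>exp (\<Sum>j>0. h(-j) z^j / j)\<close> and of \<open>z^(-m)\<close> in
  \<open>exp (- (\<Sum>j>0. h(j) z^(-j) / j))\<close>.\<close>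

definition schur :: "'h \<Rightarrow> nat \<Rightarrow> 'n fock" where
  "schur h m = exp_op (\<lambda>j p. heis_elem h (j - 1) * p) m 1"

definition annih_exp :: "'h \<Rightarrow> nat \<Rightarrow> 'n fock \<Rightarrow> 'n fock" where
  "annih_exp h = exp_op (\<lambda>j p. - heis_deriv h (j - 1) p)"

text \<open>Multiplication by q commutes with the recursion, so an exponential of multiplication
  operators is multiplication by its value at 1.\<close>

lemma exp_op_heis_elem: "exp_op (\<lambda>j p. heis_elem h (j - 1) * p) m q = schur h m * q"
  unfolding schur_def
  by (subst exp_op_commute[of "\<lambda>p. p * q"]) (auto intro: fock_linear_mult_right simp: mult_ac)

lemma schur_0 [simp]: "schur h 0 = 1"
  by (simp add: schur_def)

lemma schur_rec: "fock_scale (of_nat m) (schur h m) = (\<Sum>j\<in>{1..m}. heis_elem h (j - 1) * schur h (m - j))"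
  unfolding schur_def by (rule exp_op_rec)

lemma schur_graded: "fock_graded {m} (schur h m)"
proof (induction m rule: less_induct)
  case (less m)
  show ?case
  proof (cases "m = 0")
    case True
    then show ?thesis
      using fock_graded_const[of 1] by simp
  next
    case False
    have "fock_graded {m} (heis_elem h (j - 1) * schur h (m - j))" if "j \<in> {1..m}" for j
      using fock_graded_mult[OF heis_elem_graded[of "j - 1" h] less[of "m - j"]] that
      by (auto elim!: fock_graded_mono)
    then have "fock_graded {m} (fock_scale (1 / of_nat m) (\<Sum>j\<in>{1..m}. heis_elem h (j - 1) * schur h (m - j)))"
      by (intro fock_graded_scale fock_graded_sum)
    then show ?thesis
      using False unfolding schur_rec[symmetric] by (simp flip: mult.assoc fock_const_mult)
  qed
qed

lemma schur_add: "schur (h + h') m = (\<Sum>i\<le>m. schur h i * schur h' (m - i))"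
proof -
  have "schur (h + h') m = exp_op (\<lambda>j p. heis_elem h (j - 1) * p + heis_elem h' (j - 1) * p) m 1"
    by (simp add: schur_def heis_elem_add ring_distribs)
  also have "\<dots> = (\<Sum>i\<le>m. exp_op (\<lambda>j p. heis_elem h (j - 1) * p) i
      (exp_op (\<lambda>j p. heis_elem h' (j - 1) * p) (m - i) 1))"
    by (rule exp_op_add[OF fock_linear_mult fock_linear_mult]) (simp add: mult.left_commute)
  also have "\<dots> = (\<Sum>i\<le>m. schur h i * schur h' (m - i))"
    by (simp only: exp_op_heis_elem mult_1_right)
  finally show ?thesis .
qed

lemma schur_zero: "schur 0 m = (if m = 0 then 1 else 0)"
proof -
  have "heis_elem 0 k = 0" for k
    using heis_elem_add[of 0 0 k] by simp
  then show ?thesis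
    by (auto simp: schur_def exp_op.simps)
qed

lemma fock_linear_neg_heis_deriv: "fock_linear (\<lambda>p. - heis_deriv h k p)"
  by (rule fock_linearI) (simp_all add: heis_deriv_simps)

lemma fock_linear_annih_exp: "fock_linear (annih_exp h m)"
  unfolding annih_exp_def by (rule fock_linear_exp_op[OF fock_linear_neg_heis_deriv])

lemma annih_exp_0 [simp]: "annih_exp h 0 p = p"
  by (simp add: annih_exp_def)

lemma annih_exp_heis_deriv: "heis_deriv h k (annih_exp h' m p) = annih_exp h' m (heis_deriv h k p)"
  unfolding annih_exp_def
  by (rule exp_op_commute[OF fock_linear_heis_deriv]) (simp add: heis_deriv_simps heis_deriv_commute)

lemma annih_exp_commute: "annih_exp h k (annih_exp h' m p) = annih_exp h' m (annih_exp h k p)"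
  unfolding annih_exp_def[of h']
  by (rule exp_op_commute[OF fock_linear_annih_exp])
    (simp add: fock_pair.linear_neg[OF fock_linear_annih_exp] annih_exp_heis_deriv)

text \<open>Here the derivation acts first, which is where normal ordering places it; this is
  possible because annihilation operators commute.\<close>

lemma annih_exp_rec:
  "fock_scale (of_nat m) (annih_exp h m p) = - (\<Sum>j\<in>{1..m}. annih_exp h (m - j) (heis_deriv h (j - 1) p))"
  using exp_op_rec[of m "\<lambda>j p. - heis_deriv h (j - 1) p" p]
  by (simp only: annih_exp_def[symmetric] sum_negf annih_exp_heis_deriv)

lemma annih_exp_add:
  "annih_exp (h + h') m p = (\<Sum>i\<le>m. annih_exp h i (annih_exp h' (m - i) p))"
proof -
  have "annih_exp (h + h') m p =
      exp_op (\<lambda>j p. - heis_deriv h (j - 1) p + - heis_deriv h' (j - 1) p) m p"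
    by (simp add: annih_exp_def heis_deriv_add)
  also have "\<dots> = (\<Sum>i\<le>m. annih_exp h i (annih_exp h' (m - i) p))"
    unfolding annih_exp_def
    by (rule exp_op_add)
      (auto intro: fock_linear_neg_heis_deriv simp: heis_deriv_simps heis_deriv_commute)
  finally show ?thesis .
qed

lemma annih_exp_graded:
  assumes "fock_graded T p"
  shows "fock_graded {w. w + m \<in> T} (annih_exp h m p)"
proof -
  have "annih_exp h m p \<in> {p. fock_graded {w. w + m \<in> T} p}"
    unfolding annih_exp_def
  proof (rule exp_op_lowers[of "\<lambda>T. {p. fock_graded T p}"])
    fix j :: nat and T and p :: "'n fock" assume "0 < j" "p \<in> {p. fock_graded T p}"
    then show "- heis_deriv h (j - 1) p \<in> {p. fock_graded {w. w + j \<in> T} p}"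
      using heis_deriv_graded[of T p "j - 1" h]
      by (intro fock.subspace_neg[OF fock_subspace_graded]) simp
  qed (use assms fock_subspace_graded in auto)
  then show ?thesis
    by simp
qed

subsection \<open>Products of Schur polynomials\<close>

text \<open>An entry (r, 0) contributes the factor 1 but still counts towards the charge, so the
  multiset records more than the polynomial does.\<close>

definition schur_prod :: "('n \<times> nat) multiset \<Rightarrow> 'n fock" where
  "schur_prod M = (\<Prod>(r, m)\<in>#M. schur (\<beta> r) m)"

definition schur_space :: "'n multiset \<Rightarrow> nat set \<Rightarrow> 'n fock set" where
  "schur_space c T = fock.span {schur_prod M | M. image_mset fst M = c \<and> sum_mset (image_mset snd M) \<in> T}"

lemma schur_prod_simps [simp]:
  "schur_prod {#} = 1" "schur_prod (add_mset (r, m) M) = schur (\<beta> r) m * schur_prod M"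
  by (simp_all add: schur_prod_def)

lemma schur_space_subspace: "fock.subspace (schur_space c T)"
  by (simp add: schur_space_def)

lemma schur_prod_in_space:
  "image_mset fst M = c \<Longrightarrow> sum_mset (image_mset snd M) \<in> T \<Longrightarrow> schur_prod M \<in> schur_space c T"
  unfolding schur_space_def by (rule fock.span_base) blast

lemma schur_space_mono: "T \<subseteq> T' \<Longrightarrow> schur_space c T \<subseteq> schur_space c T'"
  unfolding schur_space_def by (rule fock.span_mono) blast

lemma schur_space_induct:
  assumes "p \<in> schur_space c T" "fock_linear f" "fock.subspace V"
    "\<And>M. image_mset fst M = c \<Longrightarrow> sum_mset (image_mset snd M) \<in> T \<Longrightarrow> f (schur_prod M) \<in> V"
  shows "f p \<in> V"
  using assms(1) unfolding schur_space_def
proof (induction rule: fock.span_induct)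
  show "fock.subspace {p. f p \<in> V}"
    using assms(2,3) by (auto simp: fock.subspace_def fock_pair.linear_0 fock_pair.linear_add fock_pair.linear_scale)
qed (use assms(4) in auto)

lemma schur_prod_graded: "fock_graded {sum_mset (image_mset snd M)} (schur_prod M)"
proof (induction M)
  case empty
  then show ?case
    using fock_graded_const[of 1] by simp
next
  case (add x M)
  then show ?case
    using fock_graded_mult[OF schur_graded[of "snd x" "\<beta> (fst x)"] add]
    by (cases x) auto
qed

lemma schur_space_graded: "p \<in> schur_space c T \<Longrightarrow> fock_graded T p"
  using schur_space_induct[OF _ fock_linear_id fock_subspace_graded, of p c T]
    fock_graded_mono[OF schur_prod_graded] by auto

lemma schur_space_mult:
  assumes "p \<in> schur_space c T" "\<And>t. t \<in> T \<Longrightarrow> t + m \<in> T'"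
  shows "schur (\<beta> r) m * p \<in> schur_space (add_mset r c) T'"
proof (rule schur_space_induct[OF assms(1) fock_linear_mult schur_space_subspace])
  fix M assume "image_mset fst M = c" "sum_mset (image_mset snd M) \<in> T"
  then have "schur_prod (add_mset (r, m) M) \<in> schur_space (add_mset r c) T'"
    by (intro schur_prod_in_space) (auto simp: assms(2) add.commute[of m])
  then show "schur (\<beta> r) m * schur_prod M \<in> schur_space (add_mset r c) T'"
    by simp
qed

text \<open>In generating form, h(k + 1) applied to exp (\<Sum>j>0. b(-j) z^j / j) multiplies it by
  (h|b) z^(k + 1), because only the exponent term j = k + 1 is affected.\<close>

lemma heis_deriv_schur:
  "heis_deriv h k (schur (\<beta> r) m) =
    (if k < m then fock_scale (form h (\<beta> r)) (schur (\<beta> r) (m - (k + 1))) else 0)"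
proof (induction m rule: less_induct)
  case (less m)
  let ?S = "schur (\<beta> r)" and ?b = "form h (\<beta> r)"
  show ?case
  proof (cases "m = 0")
    case False
    have "fock_scale (of_nat m) (heis_deriv h k (?S m)) =
        heis_deriv h k (\<Sum>j\<in>{1..m}. fock_var (r, j - 1) * ?S (m - j))"
      by (simp add: heis_deriv_simps schur_rec heis_elem_basis flip: heis_deriv_simps(2))
    \<comment> \<open>By the Leibniz rule the derivation hits either the variable, where only j = k
      + 1 survives, or the shorter Schur polynomial, where the induction hypothesis applies.\<close>
    also have "\<dots> = (\<Sum>j\<in>{1..m}. if j = k + 1 then fock_scale (of_nat (k + 1) * ?b) (?S (m - j)) else 0)
        + (\<Sum>j\<in>{1..m}. fock_var (r, j - 1) * heis_deriv h k (?S (m - j)))"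
      unfolding heis_deriv_simps heis_deriv_mult sum.distrib
      by (intro arg_cong2[where f = "(+)"] sum.cong refl) (auto simp: heis_deriv_var)
    also have "(\<Sum>j\<in>{1..m}. fock_var (r, j - 1) * heis_deriv h k (?S (m - j))) =
        (\<Sum>j\<in>{1..m - (k + 1)}. fock_scale ?b (fock_var (r, j - 1) * ?S (m - (k + 1) - j)))"
      by (rule sum.mono_neutral_cong_right) (auto simp: less mult.left_commute diff_commute add.commute)
    also have "\<dots> = fock_scale ?b (fock_scale (of_nat (m - (k + 1))) (?S (m - (k + 1))))"
      by (simp only: schur_rec heis_elem_basis sum_distrib_left)
    also have "(\<Sum>j\<in>{1..m}. if j = k + 1 then fock_scale (of_nat (k + 1) * ?b) (?S (m - j)) else 0) =
        (if k < m then fock_scale (of_nat (k + 1) * ?b) (?S (m - (k + 1))) else 0)"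
      by (subst sum.delta) auto
    finally have e: "fock_scale (of_nat m) (heis_deriv h k (?S m)) =
        (if k < m then fock_scale (of_nat (k + 1) * ?b) (?S (m - (k + 1))) else 0)
        + fock_scale ?b (fock_scale (of_nat (m - (k + 1))) (?S (m - (k + 1))))" .
    have "fock_scale (of_nat m) (heis_deriv h k (?S m)) =
      fock_scale (of_nat m) (if k < m then fock_scale ?b (?S (m - (k + 1))) else 0)"
    proof (cases "k < m")
      case True
      \<comment> \<open>The two contributions have weights k + 1 and m - (k + 1), which add up to
        the m of the recursion.\<close>
      then have "of_nat (k + 1) * ?b + ?b * of_nat (m - (k + 1)) = of_nat m * ?b"
        by (simp add: of_nat_diff algebra_simps)
      then show ?thesis
        using True
        by (simp only: e if_True mult.assoc[symmetric] fock_const_mult[symmetric] ring_distribs[symmetric]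
            fock_const_add[symmetric])
    qed (simp add: e)
    then show ?thesis
      using False fock_scale_of_nat_cancel by blast
  qed simp
qed

text \<open>Each Leibniz term replaces one index m by m - (k + 1) and keeps its color. Hence
  annihilation preserves the colors exactly and lowers only the degree.\<close>

lemma heis_deriv_schur_prod:
  "heis_deriv h k (schur_prod M) \<in>
     schur_space (image_mset fst M) {w. w + k + 1 = sum_mset (image_mset snd M)}"
proof (induction M)
  case empty
  then show ?case
    by (simp add: heis_deriv_simps schur_space_def fock.span_zero)
next
  case (add x M)
  obtain r m where x: "x = (r, m)"
    by (cases x)
  let ?V = "schur_space (image_mset fst (add_mset x M)) {w. w + k + 1 = sum_mset (image_mset snd (add_mset x M))}"
  have "schur (\<beta> r) m * heis_deriv h k (schur_prod M) \<in> ?V"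
    using schur_space_mult[OF add, of m "{w. w + k + 1 = sum_mset (image_mset snd (add_mset x M))}" r]
    by (auto simp: x)
  moreover have "schur_prod (add_mset (r, m - (k + 1)) M) \<in> ?V" if "k < m"
    using that by (intro schur_prod_in_space) (auto simp: x)
  then have "heis_deriv h k (schur (\<beta> r) m) * schur_prod M \<in> ?V"
    using fock.subspace_scale[OF schur_space_subspace] fock.subspace_0[OF schur_space_subspace]
    by (auto simp: heis_deriv_schur mult.assoc)
  ultimately show ?case
    using fock.subspace_add[OF schur_space_subspace] by (auto simp: x heis_deriv_mult)
qed

lemma heis_deriv_schur_space:
  assumes "p \<in> schur_space c T"
  shows "heis_deriv h k p \<in> schur_space c {w. w + k + 1 \<in> T}"
proof (rule schur_space_induct[OF assms fock_linear_heis_deriv schur_space_subspace])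
  fix M assume M: "image_mset fst M = c" "sum_mset (image_mset snd M) \<in> T"
  then have "{w. w + k + 1 = sum_mset (image_mset snd M)} \<subseteq> {w. w + k + 1 \<in> T}"
    by auto
  then show "heis_deriv h k (schur_prod M) \<in> schur_space c {w. w + k + 1 \<in> T}"
    using heis_deriv_schur_prod[of h k M] schur_space_mono M(1) by blast
qed

lemma annih_exp_schur_space:
  assumes "p \<in> schur_space c T"
  shows "annih_exp h m p \<in> schur_space c {w. w + m \<in> T}"
  unfolding annih_exp_def
proof (rule exp_op_lowers[of "schur_space c"])
  fix j :: nat and T p assume "0 < j" "p \<in> schur_space c T"
  then show "- heis_deriv h (j - 1) p \<in> schur_space c {w. w + j \<in> T}"
    using heis_deriv_schur_space[of p c T h "j - 1"] fock.subspace_neg[OF schur_space_subspace]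
    by auto
qed (use assms schur_space_subspace in auto)

end

subsection \<open>Formal Laurent series over the Fock space\<close>

abbreviation fls_scale :: "complex \<Rightarrow> 'n fock fls \<Rightarrow> 'n fock fls" where
  "fls_scale c f \<equiv> fls_const (fock_const c) * f"

lemma fls_const_add: "fls_const (a + b) = fls_const a + fls_const b"
  by (rule fls_eqI) simp

lemma fls_scale_shift: "fls_scale c (fls_shift n f) = fls_shift n (fls_scale c f)"
  by (simp add: fls_shifted_times_simps)

lemma fls_shift_sum: "fls_shift n (sum f A) = (\<Sum>x\<in>A. fls_shift n (f x))"
  by (induction A rule: infinite_finite_induct) auto

lemma fls_nth_sum: "fls_nth (sum f A) n = (\<Sum>x\<in>A. fls_nth (f x) n)"
  by (induction A rule: infinite_finite_induct) auto

global_interpretation fls: vector_space "fls_scale :: complex \<Rightarrow> 'n fock fls \<Rightarrow> _"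
  by unfold_locales (auto simp: algebra_simps fock_const_add fock_const_mult fls_const_add
      simp flip: fls_const_mult_const)

global_interpretation fls_pair: vector_space_pair
  "fock_scale :: complex \<Rightarrow> 'n fock \<Rightarrow> _" "fls_scale :: complex \<Rightarrow> 'n fock fls \<Rightarrow> _"
  by unfold_locales

abbreviation fls_linear :: "('n fock \<Rightarrow> 'n fock fls) \<Rightarrow> bool" where
  "fls_linear \<equiv> Vector_Spaces.linear fock_scale fls_scale"

lemma fls_linearI:
  assumes "\<And>p q. f (p + q) = f p + f q" "\<And>c p. f (fock_scale c p) = fls_scale c (f p)"
  shows "fls_linear f"
  using assms fock.vector_space_axioms fls.vector_space_axioms by (auto simp: Vector_Spaces.linear_iff)

lemma fls_linear_eqI:
  assumes "fls_linear f" "fls_linear g"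
    "\<And>m. f (Poly_Mapping.single m 1) = g (Poly_Mapping.single m 1)"
  shows "f p = g p"
proof -
  have "f (Poly_Mapping.single m c) = g (Poly_Mapping.single m c)" for m c
    using fls_pair.linear_scale[OF assms(1), of c "Poly_Mapping.single m 1"]
      fls_pair.linear_scale[OF assms(2), of c "Poly_Mapping.single m 1"] assms(3)
    by (simp add: fock_scale_single)
  then have "f (\<Sum>m\<in>Poly_Mapping.keys p. Poly_Mapping.single m (Poly_Mapping.lookup p m)) =
      g (\<Sum>m\<in>Poly_Mapping.keys p. Poly_Mapping.single m (Poly_Mapping.lookup p m))"
    by (simp only: fls_pair.linear_sum[OF assms(1)] fls_pair.linear_sum[OF assms(2)])
  then show ?thesis
    by (simp only: fock_expand[symmetric])
qed

lemma fls_linear_compose: "fls_linear f \<Longrightarrow> fock_linear g \<Longrightarrow> fls_linear (\<lambda>p. f (g p))"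
  by (auto simp: Vector_Spaces.linear_iff)

lemma fls_linear_mult: "fls_linear f \<Longrightarrow> fls_linear (\<lambda>q. g * f q)"
  by (rule fls_linearI)
    (simp_all add: fls_pair.linear_add fls_pair.linear_scale ring_distribs mult.left_commute)

lemma fls_linear_scale: "fls_linear f \<Longrightarrow> fls_linear (\<lambda>q. fls_scale c (f q))"
  by (rule fls_linear_mult)

lemma fls_linear_add: "fls_linear f \<Longrightarrow> fls_linear g \<Longrightarrow> fls_linear (\<lambda>q. f q + g q)"
  by (rule fls_pair.linear_compose_add)

lemma fls_linear_sum: "(\<And>i. i \<in> A \<Longrightarrow> fls_linear (f i)) \<Longrightarrow> fls_linear (\<lambda>q. \<Sum>i\<in>A. f i q)"
  by (rule fls_pair.linear_compose_sum) auto

lemma fls_linear_shift: "fls_linear f \<Longrightarrow> fls_linear (\<lambda>q. fls_shift n (f q))"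
  by (rule fls_linearI) (simp_all add: fls_pair.linear_add fls_pair.linear_scale fls_scale_shift)

lemma fls_linear_const: "fls_linear fls_const"
  by (rule fls_linearI) (simp_all add: fls_const_add)

lemma fls_linear_extend:
  "fls_linear (\<lambda>p. \<Sum>m\<in>Poly_Mapping.keys p. fls_scale (Poly_Mapping.lookup p m) (\<phi> m))"
proof (rule fls_linearI)
  have sup: "(\<Sum>m\<in>Poly_Mapping.keys p. fls_scale (Poly_Mapping.lookup p m) (\<phi> m)) =
      (\<Sum>m\<in>A. fls_scale (Poly_Mapping.lookup p m) (\<phi> m))"
    if "finite A" "Poly_Mapping.keys p \<subseteq> A" for A p
    by (rule sum.mono_neutral_left) (use that in \<open>auto simp: in_keys_iff\<close>)
  show "(\<Sum>m\<in>Poly_Mapping.keys (p + q). fls_scale (Poly_Mapping.lookup (p + q) m) (\<phi> m)) =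
      (\<Sum>m\<in>Poly_Mapping.keys p. fls_scale (Poly_Mapping.lookup p m) (\<phi> m)) +
      (\<Sum>m\<in>Poly_Mapping.keys q. fls_scale (Poly_Mapping.lookup q m) (\<phi> m))" for p q
  proof -
    have "finite (Poly_Mapping.keys p \<union> Poly_Mapping.keys q)"
      by simp
    note sup = sup[OF this keys_add] sup[OF this Un_upper1] sup[OF this Un_upper2]
    show ?thesis
      unfolding sup
      by (simp add: lookup_add fock_const_add fls_const_add ring_distribs sum.distrib)
  qed
  show "(\<Sum>m\<in>Poly_Mapping.keys (fock_scale c p). fls_scale (Poly_Mapping.lookup (fock_scale c p) m) (\<phi> m)) =
      fls_scale c (\<Sum>m\<in>Poly_Mapping.keys p. fls_scale (Poly_Mapping.lookup p m) (\<phi> m))" for c p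
  proof -
    have l: "Poly_Mapping.lookup (fock_scale c p) m = c * Poly_Mapping.lookup p m" for m
      by (simp add: fock_const_def mult_map_scale_conv_mult[symmetric] map.rep_eq when_def)
    then have sub: "Poly_Mapping.keys (fock_scale c p) \<subseteq> Poly_Mapping.keys p"
      by (auto simp: in_keys_iff)
    show ?thesis
      unfolding sup[OF finite_keys sub]
      by (simp only: l fock_const_mult fls_const_mult_const[symmetric] sum_distrib_left mult.assoc)
  qed
qed

section \<open>Regrouping of truncated sums and order of factors\<close>

text \<open>With both indices cut off at N, the square and the triangle agree because operators
  lowering the degree by more than N in total annihilate the vector. The regrouping is by the total
  c = a + j.\<close>

lemma sum_square_triangle:
  fixes T :: "nat \<Rightarrow> nat \<Rightarrow> 'a::comm_monoid_add"
  assumes "\<And>a j. a + j > N \<Longrightarrow> T a j = 0"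
  shows "(\<Sum>a\<le>N. \<Sum>j\<le>N. T a j) = (\<Sum>c\<le>N. \<Sum>j\<le>c. T (c - j) j)"
proof -
  have "(\<Sum>a\<le>N. \<Sum>j\<le>N. T a j) = (\<Sum>a\<le>N. \<Sum>j\<le>N - a. T a j)"
    by (intro sum.cong refl sum.mono_neutral_right) (auto intro: assms)
  also have "\<dots> = (\<Sum>c\<le>N. \<Sum>j\<le>c. T (c - j) j)"
    unfolding sum.Sigma[OF finite_atMost ballI[OF finite_atMost]]
    by (rule sum.reindex_bij_witness[of _ "\<lambda>(c, j). (c - j, j)" "\<lambda>(a, j). (a + j, j)"]) auto
  finally show ?thesis .
qed

text \<open>This makes the arbitrary order chosen by \<open>monom_factors\<close> immaterial, once
  normally ordered products are known to commute.\<close>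

lemma foldr_mset_eq:
  assumes "\<And>x y. g x \<circ> g y = g y \<circ> g x" "mset xs = mset ys"
  shows "foldr g xs = foldr g ys"
  unfolding foldr_conv_fold
  by (rule fold_multiset_equiv) (use assms in auto)

context lattice_gva
begin

subsection \<open>Normally ordered products\<close>

lemma mset_monom_factors: "count (mset (monom_factors m)) = Poly_Mapping.lookup m"
proof -
  have "finite {x. Poly_Mapping.lookup m x > 0}"
    using finite_lookup_nat[of m] by simp
  then have c: "count (Abs_multiset (Poly_Mapping.lookup m)) = Poly_Mapping.lookup m"
    by (rule count_Abs_multiset)
  obtain xs where "mset xs = Abs_multiset (Poly_Mapping.lookup m)"
    using ex_mset by blast
  then have "\<forall>x. count_list xs x = Poly_Mapping.lookup m x"
    by (metis c count_mset)
  then have "\<forall>x. count_list (monom_factors m) x = Poly_Mapping.lookup m x"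
    unfolding monom_factors_def by (rule someI)
  then show ?thesis
    by (simp add: fun_eq_iff count_mset)
qed

text \<open>This is the creation half of the k-th divided derivative of \<beta> r (z): the binomial
  coefficient is that of z^(m - k) in the divided derivative of z^m, and \<open>fls_shift\<close> by
  k multiplies by z^(-k).\<close>

definition creation_series :: "'n \<Rightarrow> nat \<Rightarrow> 'n fock fls" where
  "creation_series r k = fls_shift (int k)
     (fps_to_fls (Abs_fps (\<lambda>m. fock_scale (of_nat m gchoose k) (fock_var (r, m)))))"

text \<open>The mode h(j), j \<ge> 0, on the charge \<delta> component. The index of
  \<open>heis_deriv\<close> is one less than the mode, and h(0) acts by a scalar.\<close>

definition heis_nonneg :: "'h \<Rightarrow> 'h \<Rightarrow> nat \<Rightarrow> 'n fock \<Rightarrow> 'n fock" where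
  "heis_nonneg \<delta> h j q = (if j = 0 then fock_scale (form h \<delta>) q else heis_deriv h (j - 1) q)"

text \<open>
  \<open>normal_op N \<delta> (r, k) F\<close> is the normally ordered product of \<open>(1 / k!) (d/dz)^k \<beta> r (z)\<close> and \<open>F\<close>
  on vectors of charge \<open>\<delta>\<close> and degree at most \<open>N\<close>. Fixing the bound \<open>N\<close> makes all sums finite.
\<close>

definition normal_op ::
    "nat \<Rightarrow> 'h \<Rightarrow> 'n \<times> nat \<Rightarrow> ('n fock \<Rightarrow> 'n fock fls) \<Rightarrow> 'n fock \<Rightarrow> 'n fock fls" where
  "normal_op N \<delta> x F q = creation_series (fst x) (snd x) * F q +
     (\<Sum>j\<le>N. fls_scale ((- of_nat j - 1) gchoose snd x)
       (fls_shift (int (j + 1 + snd x)) (F (heis_nonneg \<delta> (\<beta> (fst x)) j q))))"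

definition schur_series :: "'h \<Rightarrow> 'n fock fls" where
  "schur_series h = fps_to_fls (Abs_fps (schur h))"

text \<open>This is Y(e^\<alpha>, z) on vectors of degree at most N, stripped of the shift of charge
  and of z^(\<alpha>|\<delta>), so that only integral powers of z remain.\<close>

definition exp_vertex_series :: "nat \<Rightarrow> 'h \<Rightarrow> 'n fock \<Rightarrow> 'n fock fls" where
  "exp_vertex_series N \<alpha> q = schur_series \<alpha> * (\<Sum>a\<le>N. fls_shift (int a) (fls_const (annih_exp \<alpha> a q)))"

definition list_vertex_series ::
    "nat \<Rightarrow> ('n \<times> nat) list \<Rightarrow> 'h \<Rightarrow> 'h \<Rightarrow> 'n fock \<Rightarrow> 'n fock fls" where
  "list_vertex_series N xs \<alpha> \<delta> = foldr (normal_op N \<delta>) xs (exp_vertex_series N \<alpha>)"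

definition vertex_series :: "nat \<Rightarrow> 'n fock \<Rightarrow> 'h \<Rightarrow> 'h \<Rightarrow> 'n fock \<Rightarrow> 'n fock fls" where
  "vertex_series N p \<alpha> \<delta> q = (\<Sum>m\<in>Poly_Mapping.keys p.
     fls_scale (Poly_Mapping.lookup p m) (list_vertex_series N (monom_factors m) \<alpha> \<delta> q))"

lemma heis_nonneg_commute:
  "heis_nonneg \<delta> h j (heis_nonneg \<delta> h' i q) = heis_nonneg \<delta> h' i (heis_nonneg \<delta> h j q)"
  by (simp add: heis_nonneg_def heis_deriv_simps mult.left_commute heis_deriv_commute[of h])

lemma fock_linear_heis_nonneg: "fock_linear (heis_nonneg \<delta> h j)"
  by (cases "j = 0")
    (simp_all add: heis_nonneg_def[abs_def] fock_linear_heis_deriv fock_linear_mult)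

lemma heis_nonneg_graded:
  "fock_graded T p \<Longrightarrow> fock_graded {w. w + j \<in> T} (heis_nonneg \<delta> h j p)"
  using heis_deriv_graded[of T p "j - 1" h] by (auto simp: heis_nonneg_def intro: fock_graded_scale)

text \<open>Creation series commute with each other, and so do nonnegative modes. Normal ordering
  never moves one past the other, so expanding both sides gives four blocks that exchanging x and y
  merely permutes.\<close>

lemma normal_op_commute: "normal_op N \<delta> x \<circ> normal_op N \<delta> y = normal_op N \<delta> y \<circ> normal_op N \<delta> x"
proof (intro ext)
  fix F q
  let ?A = "\<lambda>x. creation_series (fst x) (snd x)" and ?c = "\<lambda>x j. (- complex_of_nat j - 1) gchoose snd x"
    and ?h = "\<lambda>x j. heis_nonneg \<delta> (\<beta> (fst x)) j" and ?s = "\<lambda>x j. int (j + 1 + snd x)"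
  have e: "normal_op N \<delta> x (normal_op N \<delta> y F) q = ?A x * ?A y * F q
     + (\<Sum>j\<le>N. fls_scale (?c y j) (fls_shift (?s y j) (?A x * F (?h y j q))))
     + (\<Sum>j\<le>N. fls_scale (?c x j) (fls_shift (?s x j) (?A y * F (?h x j q))))
     + (\<Sum>j\<le>N. \<Sum>i\<le>N. fls_scale (?c x j) (fls_scale (?c y i) (fls_shift (?s x j + ?s y i) (F (?h x j (?h y i q))))))"
    for x y
    unfolding normal_op_def
    by (simp add: ring_distribs sum_distrib_left sum.distrib fls_shift_sum fls_scale_shift[symmetric]
        mult.assoc mult.left_commute[of "?A x"] fls_shifted_times_simps(1)[of "?A x"]
        heis_nonneg_commute[of \<delta> _ _ "\<beta> (fst x)"] add_ac)
  have "(\<Sum>j\<le>N. \<Sum>i\<le>N. fls_scale (?c x j) (fls_scale (?c y i) (fls_shift (?s x j + ?s y i) (F (?h x j (?h y i q))))))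
    = (\<Sum>j\<le>N. \<Sum>i\<le>N. fls_scale (?c y j) (fls_scale (?c x i) (fls_shift (?s y j + ?s x i) (F (?h y j (?h x i q))))))"
    by (subst sum.swap)
      (simp only: mult.left_commute[of "fls_const (fock_const (?c x _))"] add.commute[of "?s x _"]
        heis_nonneg_commute[of \<delta> "\<beta> (fst x)"])
  then show "(normal_op N \<delta> x \<circ> normal_op N \<delta> y) F q = (normal_op N \<delta> y \<circ> normal_op N \<delta> x) F q"
    unfolding comp_apply e by (simp only: mult.commute[of "?A x"] add_ac)
qed

lemma fls_linear_normal_op: "fls_linear F \<Longrightarrow> fls_linear (normal_op N \<delta> x F)"
  unfolding normal_op_def[abs_def]
  by (intro fls_linear_add fls_linear_mult fls_linear_sum fls_linear_shift
      fls_linear_compose[OF _ fock_linear_heis_nonneg])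

lemma fls_linear_exp_vertex_series: "fls_linear (exp_vertex_series N \<alpha>)"
  unfolding exp_vertex_series_def[abs_def]
  by (intro fls_linear_mult fls_linear_sum fls_linear_shift
      fls_linear_compose[OF fls_linear_const fock_linear_annih_exp])

lemma list_vertex_series_simps:
  "list_vertex_series N [] \<alpha> \<delta> = exp_vertex_series N \<alpha>"
  "list_vertex_series N (x # xs) \<alpha> \<delta> = normal_op N \<delta> x (list_vertex_series N xs \<alpha> \<delta>)"
  by (simp_all add: list_vertex_series_def)

lemma fls_linear_list_vertex_series: "fls_linear (list_vertex_series N xs \<alpha> \<delta>)"
  by (induction xs)
    (auto simp: list_vertex_series_simps intro: fls_linear_exp_vertex_series fls_linear_normal_op)

lemma fls_linear_vertex_series: "fls_linear (vertex_series N p \<alpha> \<delta>)"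
  unfolding vertex_series_def[abs_def]
  by (intro fls_linear_sum fls_linear_scale fls_linear_list_vertex_series)

lemma fls_linear_vertex_series_left: "fls_linear (\<lambda>p. vertex_series N p \<alpha> \<delta> q)"
  unfolding vertex_series_def by (rule fls_linear_extend)

lemma vertex_series_1: "vertex_series N 1 \<alpha> \<delta> = exp_vertex_series N \<alpha>"
proof -
  have "mset (monom_factors (0 :: 'n heis_monom)) = {#}"
    by (rule multiset_eqI) (simp add: mset_monom_factors)
  then have "monom_factors (0 :: 'n heis_monom) = []"
    by simp
  then show ?thesis
    by (simp add: fun_eq_iff vertex_series_def list_vertex_series_simps)
qed

text \<open>The chosen list of factors of the product is a permutation of x followed by the list for
  m. This is the counterpart on fields of multiplying by one variable, through which
  \<open>schur_rec\<close> is transported.\<close>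

lemma vertex_series_var_mult:
  "vertex_series N (fock_var x * p) \<alpha> \<delta> q = normal_op N \<delta> x (vertex_series N p \<alpha> \<delta>) q"
proof (rule fls_linear_eqI[where p = p])
  show "fls_linear (\<lambda>p. vertex_series N (fock_var x * p) \<alpha> \<delta> q)"
    by (rule fls_linear_compose[OF fls_linear_vertex_series_left fock_linear_mult])
  show "fls_linear (\<lambda>p. normal_op N \<delta> x (vertex_series N p \<alpha> \<delta>) q)"
    unfolding normal_op_def
    by (intro fls_linear_add fls_linear_mult fls_linear_sum fls_linear_shift
        fls_linear_vertex_series_left)
next
  fix m
  have 1: "vertex_series N (Poly_Mapping.single m 1) \<alpha> \<delta> = list_vertex_series N (monom_factors m) \<alpha> \<delta>" for m
    by (simp add: vertex_series_def fun_eq_iff)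
  have mset: "mset (monom_factors (Poly_Mapping.single x 1 + m)) = mset (x # monom_factors m)"
    by (rule multiset_eqI) (simp add: mset_monom_factors lookup_add lookup_single when_def)
  have "list_vertex_series N (monom_factors (Poly_Mapping.single x 1 + m)) \<alpha> \<delta> =
      list_vertex_series N (x # monom_factors m) \<alpha> \<delta>"
    unfolding list_vertex_series_def by (simp only: foldr_mset_eq[OF normal_op_commute mset])
  then show "vertex_series N (fock_var x * Poly_Mapping.single m 1) \<alpha> \<delta> q =
      normal_op N \<delta> x (vertex_series N (Poly_Mapping.single m 1) \<alpha> \<delta>) q"
    by (simp add: fock_var_def mult_single 1 list_vertex_series_simps del: One_nat_def)
qed

subsection \<open>The fields of products of Schur polynomials\<close>

definition deriv_series :: "'n \<Rightarrow> nat \<Rightarrow> complex \<Rightarrow> 'n fock fls" where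
  "deriv_series r k t = fls_shift (int k)
     (fps_to_fls (Abs_fps (\<lambda>m. fock_scale ((t + of_nat m) gchoose k) (schur (\<beta> r) m))))"

text \<open>
  Let \<open>E(z)\<close> and \<open>D(z)\<close> be the exponentials of the creation and annihilation parts of \<open>\<beta> r\<close>.
  The coefficient of \<open>w^k\<close> in \<open>(z + w)^t E(z + w)\<close> is \<open>z^t\<close> times \<^term>\<open>deriv_series r k t\<close>.
  The product of the Schur polynomials listed in \<open>xs\<close> has the field below, because
  \<open>exp (\<Sum>j>0. \<beta> r (-j) w^j / j) e^\<alpha>\<close> with \<open>\<alpha> = \<beta> r\<close> has the field \<open>Y(e^\<alpha>, z + w)\<close>.
\<close>

primrec schur_vertex_series ::
    "nat \<Rightarrow> ('n \<times> nat) list \<Rightarrow> 'h \<Rightarrow> 'h \<Rightarrow> 'n fock \<Rightarrow> 'n fock fls" where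
  "schur_vertex_series N [] \<alpha> \<delta> q = exp_vertex_series N \<alpha> q"
| "schur_vertex_series N (x # xs) \<alpha> \<delta> q = (\<Sum>a\<le>N. fls_shift (int a)
     (deriv_series (fst x) (snd x) (form (\<beta> (fst x)) \<delta> - of_nat a) *
       schur_vertex_series N xs \<alpha> \<delta> (annih_exp (\<beta> (fst x)) a q)))"

lemma fls_linear_schur_vertex_series: "fls_linear (schur_vertex_series N xs \<alpha> \<delta>)"
proof (induction xs)
  case Nil
  have "schur_vertex_series N [] \<alpha> \<delta> = exp_vertex_series N \<alpha>"
    by (simp add: fun_eq_iff)
  then show ?case
    by (simp add: fls_linear_exp_vertex_series)
next
  case (Cons x xs)
  have "fls_linear (\<lambda>q. \<Sum>a\<le>N. fls_shift (int a)
     (deriv_series (fst x) (snd x) (form (\<beta> (fst x)) \<delta> - of_nat a) *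
       schur_vertex_series N xs \<alpha> \<delta> (annih_exp (\<beta> (fst x)) a q)))"
    by (intro fls_linear_sum fls_linear_shift fls_linear_mult
        fls_linear_compose[OF Cons fock_linear_annih_exp])
  then show ?case
    unfolding schur_vertex_series.simps(2)[abs_def] .
qed

lemma deriv_series_0: "deriv_series r 0 t = schur_series (\<beta> r)"
  by (simp add: deriv_series_def schur_series_def)

lemma fls_scale_fps: "fls_scale c (fps_to_fls (Abs_fps f)) = fps_to_fls (Abs_fps (\<lambda>m. fock_scale c (f m)))"
  by (rule fls_eqI) simp

lemma fps_to_fls_sum: "fps_to_fls (sum f A) = (\<Sum>x\<in>A. fps_to_fls (f x))"
  by (induction A rule: infinite_finite_induct) auto

lemma gbinomial_Vandermonde':
  assumes "k > 0"
  shows "(\<Sum>n\<in>{1..k}. ((a :: complex) gchoose (n - 1)) * (b gchoose (k - n))) = (a + b) gchoose (k - 1)"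
proof -
  have "(\<Sum>n\<in>{1..k}. (a gchoose (n - 1)) * (b gchoose (k - n))) =
      (\<Sum>n\<in>{0..k - 1}. (a gchoose n) * (b gchoose (k - 1 - n)))"
    by (rule sum.reindex_bij_witness[of _ Suc "\<lambda>n. n - 1"]) (use assms in auto)
  then show ?thesis
    by (simp only: gbinomial_Vandermonde)
qed

text \<open>Both sides are the coefficient of w^(k - 1) in (z + w)^b (z + w)^t E(z + w), divided by
  z^(t + b + 1). It is applied with b = - j - 1, the exponent accompanying the mode j.\<close>

lemma deriv_series_Vandermonde:
  assumes "k > 0"
  shows "(\<Sum>n\<in>{1..k}. fls_scale (b gchoose (n - 1)) (fls_shift (int n) (deriv_series r (k - n) t))) =
    fls_shift 1 (deriv_series r (k - 1) (t + b))"
proof -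
  have "(\<Sum>n\<in>{1..k}. fls_scale (b gchoose (n - 1)) (fls_shift (int n) (deriv_series r (k - n) t))) =
    (\<Sum>n\<in>{1..k}. fls_shift (int k) (fps_to_fls (Abs_fps (\<lambda>m. fock_scale ((b gchoose (n - 1)) *
        ((t + of_nat m) gchoose (k - n))) (schur (\<beta> r) m)))))"
  proof (rule sum.cong[OF refl])
    fix n assume "n \<in> {1..k}"
    then have "int (k - n) + int n = int k"
      by simp
    then show "fls_scale (b gchoose (n - 1)) (fls_shift (int n) (deriv_series r (k - n) t)) =
      fls_shift (int k) (fps_to_fls (Abs_fps (\<lambda>m. fock_scale ((b gchoose (n - 1)) *
        ((t + of_nat m) gchoose (k - n))) (schur (\<beta> r) m))))"
      by (simp only: deriv_series_def fls_shift_fls_shift fls_scale_shift fls_scale_fps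
          mult.assoc[symmetric] fock_const_mult[symmetric])
  qed
  also have "\<dots> = fls_shift (int k) (fps_to_fls (Abs_fps (\<lambda>m.
      fock_scale ((b + (t + of_nat m)) gchoose (k - 1)) (schur (\<beta> r) m))))"
  proof -
    have e: "fock_scale ((b + (t + of_nat m)) gchoose (k - 1)) (schur (\<beta> r) m) =
        (\<Sum>n\<in>{1..k}. fock_scale ((b gchoose (n - 1)) * ((t + of_nat m) gchoose (k - n))) (schur (\<beta> r) m))" for m
      by (simp only: gbinomial_Vandermonde'[OF assms] flip: fock_const_sum sum_distrib_right)
    show ?thesis
    proof (rule fls_eqI)
      fix i
      show "fls_nth (\<Sum>n\<in>{1..k}. fls_shift (int k) (fps_to_fls (Abs_fps (\<lambda>m. fock_scale ((b gchoose (n - 1)) *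
          ((t + of_nat m) gchoose (k - n))) (schur (\<beta> r) m))))) i =
        fls_nth (fls_shift (int k) (fps_to_fls (Abs_fps (\<lambda>m.
          fock_scale ((b + (t + of_nat m)) gchoose (k - 1)) (schur (\<beta> r) m))))) i"
        by (cases "i + int k < 0")
          (simp_all only: fls_nth_sum fls_shift_nth fps_to_fls_nth fps_nth_Abs_fps if_True if_False e
            sum.neutral_const)
    qed
  qed
  also have "\<dots> = fls_shift 1 (deriv_series r (k - 1) (t + b))"
    using assms by (simp add: deriv_series_def add_ac)
  finally show ?thesis .
qed

text \<open>The creation part of \<beta> r times E is E'. Both sides are the coefficient of w^(k -
  1) in (z + w)^t E'(z + w), divided by z^t.\<close>

lemma creation_deriv_series:
  assumes "k > 0"
  shows "(\<Sum>n\<in>{1..k}. creation_series r (n - 1) * deriv_series r (k - n) t) =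
    fls_shift (int k) (fps_to_fls (Abs_fps (\<lambda>m.
      fock_scale (of_nat m * ((t + of_nat m - 1) gchoose (k - 1))) (schur (\<beta> r) m))))"
    (is "_ = fls_shift (int k) ?R")
proof -
  define A where "A n = Abs_fps (\<lambda>m. fock_scale (of_nat m gchoose n) (fock_var (r, m)))" for n
  define G where "G n = Abs_fps (\<lambda>m. fock_scale ((t + of_nat m) gchoose n) (schur (\<beta> r) m))" for n
  have c: "fps_nth (\<Sum>n\<in>{1..k}. A (n - 1) * G (k - n)) m =
      fock_scale (of_nat (Suc m) * ((t + of_nat m) gchoose (k - 1))) (schur (\<beta> r) (Suc m))" for m
  proof -
    have "fps_nth (\<Sum>n\<in>{1..k}. A (n - 1) * G (k - n)) m =
        (\<Sum>n\<in>{1..k}. \<Sum>i\<in>{0..m}. fock_scale ((of_nat i gchoose (n - 1)) * ((t + of_nat (m - i)) gchoose (k - n)))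
           (fock_var (r, i) * schur (\<beta> r) (m - i)))"
      by (simp add: fps_sum_nth fps_mult_nth A_def G_def fock_const_mult mult_ac)
    also have "\<dots> = (\<Sum>i\<in>{0..m}. fock_scale ((of_nat i + (t + of_nat (m - i))) gchoose (k - 1))
           (fock_var (r, i) * schur (\<beta> r) (m - i)))"
      by (subst sum.swap)
        (simp only: gbinomial_Vandermonde'[OF assms, symmetric] fock_const_sum sum_distrib_right)
    also have "\<dots> = (\<Sum>i\<in>{0..m}. fock_scale ((t + of_nat m) gchoose (k - 1))
           (heis_elem (\<beta> r) i * schur (\<beta> r) (m - i)))"
      by (intro sum.cong refl) (simp add: of_nat_diff heis_elem_basis)
    also have "\<dots> = fock_scale ((t + of_nat m) gchoose (k - 1))
          (\<Sum>j\<in>{1..Suc m}. heis_elem (\<beta> r) (j - 1) * schur (\<beta> r) (Suc m - j))"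
      unfolding sum_distrib_left
      by (rule sum.reindex_bij_witness[of _ "\<lambda>n. n - 1" Suc]) auto
    finally show ?thesis
      unfolding schur_rec[symmetric] by (simp only: fock_const_mult mult_ac)
  qed
  have "(\<Sum>n\<in>{1..k}. creation_series r (n - 1) * deriv_series r (k - n) t) =
    (\<Sum>n\<in>{1..k}. fls_shift (int (k - 1)) (fps_to_fls (A (n - 1) * G (k - n))))"
  proof (intro sum.cong refl)
    fix n assume "n \<in> {1..k}"
    then show "creation_series r (n - 1) * deriv_series r (k - n) t =
        fls_shift (int (k - 1)) (fps_to_fls (A (n - 1) * G (k - n)))"
      by (simp add: creation_series_def deriv_series_def A_def G_def fls_times_both_shifted_simp
          fls_times_fps_to_fls of_nat_diff)
  qed
  also have "\<dots> = fls_shift (int (k - 1)) (fps_to_fls (\<Sum>n\<in>{1..k}. A (n - 1) * G (k - n)))"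
    by (simp add: fls_shift_sum fps_to_fls_sum)
  also have "\<dots> = fls_shift (int k) ?R"
  proof (rule fls_eqI)
    fix i
    show "fls_nth (fls_shift (int (k - 1)) (fps_to_fls (\<Sum>n\<in>{1..k}. A (n - 1) * G (k - n)))) i =
        fls_nth (fls_shift (int k) ?R) i"
    proof (cases "i + int (k - 1) < 0")
      case True
      \<comment> \<open>The right side starts one power of z lower, but its first coefficient
        belongs to m = 0 and carries the factor m.\<close>
      then have "i + int k < 0 \<or> i + int k = 0"
        using assms by linarith
      then show ?thesis
        using True by auto
    next
      case False
      then have "nat (i + int k) = Suc (nat (i + int (k - 1)))"
        using assms by linarith
      then show ?thesis
        using False by (simp only: fls_shift_nth fps_to_fls_nth c) (simp add: algebra_simps)
    qed
  qed
  finally show ?thesis .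
qed

text \<open>The product rule for d/dw: the derivative of (z + w)^t E(z + w) is (z + w)^t E'(z + w) +
  t (z + w)^(t - 1) E(z + w).\<close>

lemma deriv_series_rec:
  assumes "k > 0"
  shows "fls_scale (of_nat k) (deriv_series r k t) =
    (\<Sum>n\<in>{1..k}. creation_series r (n - 1) * deriv_series r (k - n) t)
    + fls_scale t (fls_shift 1 (deriv_series r (k - 1) (t - 1)))"
proof -
  \<comment> \<open>Absorption, k binom(x, k) = x binom(x - 1, k - 1), with x = t + m split into its
    two summands.\<close>
  have e: "of_nat k * ((t + of_nat m) gchoose k) =
      of_nat m * ((t + of_nat m - 1) gchoose (k - 1)) + t * ((t - 1 + of_nat m) gchoose (k - 1))" for m
  proof -
    have "t - 1 + of_nat m = t + of_nat m - 1"
      by simp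
    moreover have "of_nat k * ((t + of_nat m) gchoose k) = (t + of_nat m) * ((t + of_nat m - 1) gchoose (k - 1))"
      using gbinomial_absorption[of "k - 1" "t + of_nat m"] assms by (simp del: of_nat_Suc)
    ultimately show ?thesis
      by (simp only: ring_distribs add.commute)
  qed
  have "fls_scale (of_nat k) (deriv_series r k t) = fls_shift (int k) (fps_to_fls (Abs_fps (\<lambda>m.
      fock_scale (of_nat k * ((t + of_nat m) gchoose k)) (schur (\<beta> r) m))))"
    by (simp only: deriv_series_def fls_scale_shift fls_scale_fps mult.assoc[symmetric]
        fock_const_mult[symmetric])
  also have "\<dots> = fls_shift (int k) (fps_to_fls (Abs_fps (\<lambda>m.
        fock_scale (of_nat m * ((t + of_nat m - 1) gchoose (k - 1))) (schur (\<beta> r) m))))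
    + fls_shift (int k) (fps_to_fls (Abs_fps (\<lambda>m.
        fock_scale (t * ((t - 1 + of_nat m) gchoose (k - 1))) (schur (\<beta> r) m))))"
  proof (rule fls_eqI)
    fix i
    show "fls_nth (fls_shift (int k) (fps_to_fls (Abs_fps (\<lambda>m.
        fock_scale (of_nat k * ((t + of_nat m) gchoose k)) (schur (\<beta> r) m))))) i =
      fls_nth (fls_shift (int k) (fps_to_fls (Abs_fps (\<lambda>m.
        fock_scale (of_nat m * ((t + of_nat m - 1) gchoose (k - 1))) (schur (\<beta> r) m))))
      + fls_shift (int k) (fps_to_fls (Abs_fps (\<lambda>m.
        fock_scale (t * ((t - 1 + of_nat m) gchoose (k - 1))) (schur (\<beta> r) m))))) i"
      by (cases "i + int k < 0")
        (simp_all only: fls_plus_nth fls_shift_nth fps_to_fls_nth fps_nth_Abs_fps if_True if_False e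
          fock.scale_left_distrib add_0)
  qed
  also have "fls_shift (int k) (fps_to_fls (Abs_fps (\<lambda>m.
        fock_scale (t * ((t - 1 + of_nat m) gchoose (k - 1))) (schur (\<beta> r) m)))) =
      fls_scale t (fls_shift 1 (deriv_series r (k - 1) (t - 1)))"
  proof -
    have "int (k - 1) + 1 = int k"
      using assms by simp
    then show ?thesis
      by (simp only: deriv_series_def fls_shift_fls_shift fls_scale_shift fls_scale_fps
          mult.assoc[symmetric] fock_const_mult[symmetric])
  qed
  finally show ?thesis
    unfolding creation_deriv_series[OF assms] .
qed

section \<open>Truncation by a degree bound\<close>

lemma annih_exp_eq_0: "fock_graded {..N} q \<Longrightarrow> m > N \<Longrightarrow> annih_exp h m q = 0"
  using annih_exp_graded[of "{..N}" q m h] by (auto simp: fock_graded_def)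

lemma fock_graded_annih: "fock_graded {..N} q \<Longrightarrow> fock_graded {..N} (annih_exp h m q)"
  by (erule fock_graded_mono[OF annih_exp_graded]) auto

lemma fock_graded_heis_nonneg: "fock_graded {..N} q \<Longrightarrow> fock_graded {..N} (heis_nonneg \<delta> h j q)"
  by (erule fock_graded_mono[OF heis_nonneg_graded]) auto

lemma annih_exp_heis_nonneg_eq_0:
  assumes "fock_graded {..N} q" "a + j > N"
  shows "annih_exp h a (heis_nonneg \<delta> h' j q) = 0"
  using annih_exp_graded[OF heis_nonneg_graded[OF assms(1), of j \<delta> h'], of a h] assms(2)
  by (auto simp: fock_graded_def)

text \<open>The coefficients of z d/dz applied to z^(h|\<delta>) D(z): the mode 0 differentiates the
  power of z and the positive modes differentiate the annihilation exponential.\<close>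

lemma sum_annih_exp_heis_nonneg:
  "(\<Sum>j\<le>c. annih_exp h (c - j) (heis_nonneg \<delta> h j q)) =
     fock_scale (form h \<delta> - of_nat c) (annih_exp h c q)"
proof -
  have "(\<Sum>j\<le>c. annih_exp h (c - j) (heis_nonneg \<delta> h j q)) =
      annih_exp h c (heis_nonneg \<delta> h 0 q)
      + (\<Sum>j\<in>{1..c}. annih_exp h (c - j) (heis_nonneg \<delta> h j q))"
  proof -
    have "{..c} = insert 0 {1..c}"
      by auto
    then show ?thesis
      by simp
  qed
  also have "(\<Sum>j\<in>{1..c}. annih_exp h (c - j) (heis_nonneg \<delta> h j q)) =
      (\<Sum>j\<in>{1..c}. annih_exp h (c - j) (heis_deriv h (j - 1) q))"
    by (intro sum.cong refl) (auto simp: heis_nonneg_def)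
  also have "\<dots> = - fock_scale (of_nat c) (annih_exp h c q)"
    by (simp only: annih_exp_rec minus_minus)
  finally have e: "(\<Sum>j\<le>c. annih_exp h (c - j) (heis_nonneg \<delta> h j q)) =
      annih_exp h c (heis_nonneg \<delta> h 0 q) + - fock_scale (of_nat c) (annih_exp h c q)" .
  have "heis_nonneg \<delta> h 0 q = fock_scale (form h \<delta>) q"
    by (simp add: heis_nonneg_def)
  then show ?thesis
    by (simp only: e fock_pair.linear_scale[OF fock_linear_annih_exp]
        fock.scale_left_diff_distrib add_uminus_conv_diff)
qed

text \<open>The counterpart of \<open>schur_rec\<close> on fields. Differentiating Y(e^b, z + w) in
  w yields its normally ordered product with b(z + w), whose coefficient of w^(n - 1) is the divided
  derivative of b(z) of order n - 1; this is compared at w^(k - 1).\<close>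

lemma schur_vertex_series_rec:
  assumes q: "fock_graded {..N} q" and k: "k > 0"
  shows "fls_scale (of_nat k) (schur_vertex_series N ((r, k) # xs) \<alpha> \<delta> q) =
    (\<Sum>n\<in>{1..k}. normal_op N \<delta> (r, n - 1) (schur_vertex_series N ((r, k - n) # xs) \<alpha> \<delta>) q)"
proof -
  define b where "b = form (\<beta> r) \<delta>"
  define R where "R = schur_vertex_series N xs \<alpha> \<delta>"
  define D where "D = annih_exp (\<beta> r)"
  define h where "h = heis_nonneg \<delta> (\<beta> r)"
  define G where "G = deriv_series r"
  have R: "fls_linear R"
    unfolding R_def by (rule fls_linear_schur_vertex_series)
  have step: "schur_vertex_series N ((r, k) # xs) \<alpha> \<delta> q =
      (\<Sum>a\<le>N. fls_shift (int a) (G k (b - of_nat a) * R (D a q)))" for k q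
    by (simp add: b_def R_def D_def G_def)
  have "(\<Sum>n\<in>{1..k}. \<Sum>j\<le>N. fls_scale ((- of_nat j - 1) gchoose (n - 1))
      (fls_shift (int (j + 1 + (n - 1))) (schur_vertex_series N ((r, k - n) # xs) \<alpha> \<delta> (h j q)))) =
    (\<Sum>n\<in>{1..k}. \<Sum>j\<le>N. \<Sum>a\<le>N. fls_shift (int (j + a))
      (fls_scale ((- of_nat j - 1) gchoose (n - 1)) (fls_shift (int n) (G (k - n) (b - of_nat a))) * R (D a (h j q))))"
  proof (intro sum.cong refl)
    fix n j assume "n \<in> {1..k}"
    then have n: "int (j + 1 + (n - 1)) = int j + int n"
      by simp
    show "fls_scale ((- of_nat j - 1) gchoose (n - 1))
        (fls_shift (int (j + 1 + (n - 1))) (schur_vertex_series N ((r, k - n) # xs) \<alpha> \<delta> (h j q))) =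
      (\<Sum>a\<le>N. fls_shift (int (j + a))
        (fls_scale ((- of_nat j - 1) gchoose (n - 1)) (fls_shift (int n) (G (k - n) (b - of_nat a))) * R (D a (h j q))))"
      unfolding step n fls_shift_sum sum_distrib_left
      by (intro sum.cong refl) (simp add: fls_shifted_times_simps mult.assoc add_ac)
  qed
  also have "\<dots> = (\<Sum>j\<le>N. \<Sum>a\<le>N. \<Sum>n\<in>{1..k}. fls_shift (int (j + a))
      (fls_scale ((- of_nat j - 1) gchoose (n - 1)) (fls_shift (int n) (G (k - n) (b - of_nat a))) * R (D a (h j q))))"
    by (subst sum.swap, rule sum.cong[OF refl], rule sum.swap)
  also have "\<dots> = (\<Sum>j\<le>N. \<Sum>a\<le>N. fls_shift (int (j + a))
      (fls_shift 1 (G (k - 1) (b - of_nat a + (- of_nat j - 1))) * R (D a (h j q))))"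
    unfolding G_def deriv_series_Vandermonde[OF k, symmetric]
    by (simp only: fls_shift_sum sum_distrib_right)
  also have "\<dots> = (\<Sum>a\<le>N. \<Sum>j\<le>N. fls_shift (int (j + a))
      (fls_shift 1 (G (k - 1) (b - of_nat a + (- of_nat j - 1))) * R (D a (h j q))))"
    by (rule sum.swap)
  \<comment> \<open>Grouping by the total lowering c = a + j makes the exponent b - a - j - 1
    independent of j, so the inner sum involves only operators on q.\<close>
  also have "\<dots> = (\<Sum>c\<le>N. \<Sum>j\<le>c. fls_shift (int (j + (c - j)))
      (fls_shift 1 (G (k - 1) (b - of_nat (c - j) + (- of_nat j - 1))) * R (D (c - j) (h j q))))"
    by (rule sum_square_triangle)
      (simp add: D_def h_def annih_exp_heis_nonneg_eq_0[OF q] fls_pair.linear_0[OF R])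
  also have "\<dots> = (\<Sum>c\<le>N. \<Sum>j\<le>c. fls_shift (int c)
      (fls_shift 1 (G (k - 1) (b - of_nat c - 1)) * R (D (c - j) (h j q))))"
    by (intro sum.cong refl) (simp add: of_nat_diff algebra_simps)
  also have "\<dots> = (\<Sum>c\<le>N. fls_shift (int c)
      (fls_shift 1 (G (k - 1) (b - of_nat c - 1)) * R (\<Sum>j\<le>c. D (c - j) (h j q))))"
    by (simp only: fls_pair.linear_sum[OF R] sum_distrib_left fls_shift_sum)
  \<comment> \<open>The inner sum produces the factor b - c, exactly the t in the second term of
    \<open>deriv_series_rec\<close>.\<close>
  also have "\<dots> = (\<Sum>c\<le>N. fls_shift (int c)
      (fls_scale (b - of_nat c) (fls_shift 1 (G (k - 1) (b - of_nat c - 1))) * R (D c q)))"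
    unfolding D_def h_def sum_annih_exp_heis_nonneg b_def[symmetric]
    by (simp only: fls_pair.linear_scale[OF R] mult_ac)
  finally have ann: "(\<Sum>n\<in>{1..k}. \<Sum>j\<le>N. fls_scale ((- of_nat j - 1) gchoose (n - 1))
      (fls_shift (int (j + 1 + (n - 1))) (schur_vertex_series N ((r, k - n) # xs) \<alpha> \<delta> (h j q)))) =
    (\<Sum>c\<le>N. fls_shift (int c)
      (fls_scale (b - of_nat c) (fls_shift 1 (G (k - 1) (b - of_nat c - 1))) * R (D c q)))" .
  have cre: "(\<Sum>n\<in>{1..k}. creation_series r (n - 1) * schur_vertex_series N ((r, k - n) # xs) \<alpha> \<delta> q) =
    (\<Sum>c\<le>N. fls_shift (int c)
      ((\<Sum>n\<in>{1..k}. creation_series r (n - 1) * G (k - n) (b - of_nat c)) * R (D c q)))"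
    unfolding step sum_distrib_left sum_distrib_right fls_shift_sum
    by (subst sum.swap) (simp only: fls_shifted_times_simps mult.assoc)
  have "(\<Sum>n\<in>{1..k}. normal_op N \<delta> (r, n - 1) (schur_vertex_series N ((r, k - n) # xs) \<alpha> \<delta>) q) =
    (\<Sum>c\<le>N. fls_shift (int c)
      ((\<Sum>n\<in>{1..k}. creation_series r (n - 1) * G (k - n) (b - of_nat c)) * R (D c q)))
    + (\<Sum>c\<le>N. fls_shift (int c)
      (fls_scale (b - of_nat c) (fls_shift 1 (G (k - 1) (b - of_nat c - 1))) * R (D c q)))"
    unfolding ann[symmetric] cre[symmetric] normal_op_def fst_conv snd_conv sum.distrib h_def ..
  also have "\<dots> = (\<Sum>c\<le>N. fls_shift (int c) (fls_scale (of_nat k) (G k (b - of_nat c)) * R (D c q)))"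
    unfolding G_def deriv_series_rec[OF k] by (simp only: ring_distribs fls_shift_plus sum.distrib)
  also have "\<dots> = fls_scale (of_nat k) (schur_vertex_series N ((r, k) # xs) \<alpha> \<delta> q)"
    unfolding step by (simp only: sum_distrib_left fls_scale_shift mult.assoc)
  finally show ?thesis ..
qed

lemma schur_series_add: "schur_series (\<alpha> + \<gamma>) = schur_series \<alpha> * schur_series \<gamma>"
proof -
  have "Abs_fps (schur (\<alpha> + \<gamma>)) = Abs_fps (schur \<alpha>) * Abs_fps (schur \<gamma>)"
    by (rule fps_ext) (simp add: fps_mult_nth schur_add atMost_atLeast0)
  then show ?thesis
    by (simp add: schur_series_def fls_times_fps_to_fls)
qed

text \<open>Both exponentials of \<alpha> + \<gamma> factor. Creation series commute, and
  annihilation exponentials commute with the ones used by the listed factors, so the part belonging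
  to \<gamma> can be moved to the outside.\<close>

lemma schur_vertex_series_shift:
  assumes "fock_graded {..N} q"
  shows "schur_vertex_series N xs (\<alpha> + \<gamma>) \<delta> q =
    (\<Sum>c\<le>N. fls_shift (int c) (schur_series \<gamma> * schur_vertex_series N xs \<alpha> \<delta> (annih_exp \<gamma> c q)))"
  using assms
proof (induction xs arbitrary: q)
  case Nil
  have "(\<Sum>c\<le>N. fls_shift (int c) (schur_series \<gamma> * exp_vertex_series N \<alpha> (annih_exp \<gamma> c q))) =
      schur_series (\<alpha> + \<gamma>) *
        (\<Sum>c\<le>N. \<Sum>a\<le>N. fls_shift (int c + int a) (fls_const (annih_exp \<alpha> a (annih_exp \<gamma> c q))))"
    unfolding exp_vertex_series_def schur_series_add sum_distrib_left fls_shift_sum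
    by (simp add: fls_shifted_times_simps mult_ac add_ac)
  also have "(\<Sum>c\<le>N. \<Sum>a\<le>N. fls_shift (int c + int a) (fls_const (annih_exp \<alpha> a (annih_exp \<gamma> c q)))) =
      (\<Sum>c\<le>N. \<Sum>a\<le>c. fls_shift (int (c - a) + int a) (fls_const (annih_exp \<alpha> a (annih_exp \<gamma> (c - a) q))))"
  proof (rule sum_square_triangle)
    fix c a assume "c + a > N"
    then have "annih_exp \<alpha> a (annih_exp \<gamma> c q) = 0"
      using annih_exp_graded[OF annih_exp_graded[OF Nil, of c \<gamma>], of a \<alpha>]
      by (auto simp: fock_graded_def)
    then show "fls_shift (int c + int a) (fls_const (annih_exp \<alpha> a (annih_exp \<gamma> c q))) = 0"
      by simp
  qed
  also have "\<dots> = (\<Sum>c\<le>N. fls_shift (int c) (fls_const (annih_exp (\<alpha> + \<gamma>) c q)))"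
    unfolding annih_exp_add fls_pair.linear_sum[OF fls_linear_const] fls_shift_sum
    by (intro sum.cong refl) (simp add: of_nat_diff)
  finally show ?case
    by (simp add: exp_vertex_series_def)
next
  case (Cons x xs)
  let ?h = "\<beta> (fst x)" and ?R = "schur_vertex_series N xs \<alpha> \<delta>"
  let ?G = "\<lambda>a. deriv_series (fst x) (snd x) (form ?h \<delta> - of_nat a)"
  have "schur_vertex_series N (x # xs) (\<alpha> + \<gamma>) \<delta> q =
      (\<Sum>a\<le>N. \<Sum>c\<le>N. fls_shift (int a + int c) (schur_series \<gamma> * (?G a * ?R (annih_exp \<gamma> c (annih_exp ?h a q)))))"
    by (simp add: Cons.IH[OF fock_graded_annih[OF Cons.prems]] sum_distrib_left fls_shift_sum
        fls_shifted_times_simps mult.left_commute add.commute)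
  also have "\<dots> = (\<Sum>c\<le>N. \<Sum>a\<le>N. fls_shift (int a + int c) (schur_series \<gamma> * (?G a * ?R (annih_exp ?h a (annih_exp \<gamma> c q)))))"
    by (subst sum.swap) (simp only: annih_exp_commute[of \<gamma>])
  also have "\<dots> = (\<Sum>c\<le>N. fls_shift (int c) (schur_series \<gamma> * schur_vertex_series N (x # xs) \<alpha> \<delta> (annih_exp \<gamma> c q)))"
    by (simp add: sum_distrib_left fls_shift_sum fls_shifted_times_simps)
  finally show ?case .
qed

text \<open>The coefficient of w^0 involves no derivative, so a factor with index 0 just contributes
  its vector to the exponent. This starts the induction on the index below.\<close>

lemma schur_vertex_series_0:
  assumes "fock_graded {..N} q"
  shows "schur_vertex_series N ((r, 0) # xs) \<alpha> \<delta> q = schur_vertex_series N xs (\<alpha> + \<beta> r) \<delta> q"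
  by (simp add: schur_vertex_series_shift[OF assms] deriv_series_0)

lemma normal_op_cong:
  assumes "fock_graded {..N} q" "\<And>q. fock_graded {..N} q \<Longrightarrow> F q = F' q"
  shows "normal_op N \<delta> x F q = normal_op N \<delta> x F' q"
  unfolding normal_op_def using assms(2)[OF assms(1)] assms(2)[OF fock_graded_heis_nonneg[OF assms(1)]]
  by simp

lemma fls_scale_of_nat_cancel:
  assumes "fls_scale (of_nat k) f = fls_scale (of_nat k) g" "k > 0"
  shows "f = g"
  using assms fls.scale_cancel_left[of "of_nat k" f g] by auto

text \<open>The induction over the factors keeps \<alpha> arbitrary because index 0 merges
  \<open>\<beta> r\<close> into it. Within it, for a positive index k, both sides satisfy the same
  recursion with the invertible factor k.\<close>

theorem vertex_series_schur_prod:
  assumes "fock_graded {..N} q"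
  shows "vertex_series N (schur_prod (mset xs)) (\<alpha> + (\<Sum>x\<leftarrow>xs. \<beta> (fst x))) \<delta> q = schur_vertex_series N xs \<alpha> \<delta> q"
  using assms
proof (induction xs arbitrary: \<alpha> q)
  case Nil
  then show ?case
    by (simp add: vertex_series_1)
next
  case (Cons x xs)
  obtain r k where x: "x = (r, k)"
    by (cases x)
  let ?a = "\<alpha> + (\<Sum>x\<leftarrow>x # xs. \<beta> (fst x))" and ?p = "schur_prod (mset xs)"
  have "vertex_series N (schur (\<beta> r) k * ?p) ?a \<delta> q = schur_vertex_series N ((r, k) # xs) \<alpha> \<delta> q"
    using Cons.prems
  proof (induction k arbitrary: q rule: less_induct)
    case (less k)
    show ?case
    proof (cases "k = 0")
      case True
      then show ?thesis
        using Cons.IH[OF less.prems, of "\<alpha> + \<beta> r"]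
        by (simp only: schur_vertex_series_0[OF less.prems]) (simp add: x add.assoc)
    next
      case False
      have lin: "fls_linear (\<lambda>p. vertex_series N (p * ?p) ?a \<delta> q)"
        by (rule fls_linear_compose[OF fls_linear_vertex_series_left fock_linear_mult_right])
      have "fls_scale (of_nat k) (vertex_series N (schur (\<beta> r) k * ?p) ?a \<delta> q) =
          (\<Sum>n\<in>{1..k}. vertex_series N (fock_var (r, n - 1) * schur (\<beta> r) (k - n) * ?p) ?a \<delta> q)"
        unfolding fls_pair.linear_scale[OF lin, symmetric] schur_rec fls_pair.linear_sum[OF lin]
        by (simp only: heis_elem_basis)
      also have "\<dots> = (\<Sum>n\<in>{1..k}. normal_op N \<delta> (r, n - 1) (schur_vertex_series N ((r, k - n) # xs) \<alpha> \<delta>) q)"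
      proof (rule sum.cong[OF refl])
        fix n assume "n \<in> {1..k}"
        then show "vertex_series N (fock_var (r, n - 1) * schur (\<beta> r) (k - n) * ?p) ?a \<delta> q =
            normal_op N \<delta> (r, n - 1) (schur_vertex_series N ((r, k - n) # xs) \<alpha> \<delta>) q"
          unfolding mult.assoc vertex_series_var_mult
          by (intro normal_op_cong less) auto
      qed
      also have "\<dots> = fls_scale (of_nat k) (schur_vertex_series N ((r, k) # xs) \<alpha> \<delta> q)"
        using False by (intro schur_vertex_series_rec[symmetric] less.prems) simp
      finally show ?thesis
        using False fls_scale_of_nat_cancel by blast
    qed
  qed
  then show ?case
    by (simp add: x)
qed

end

subsection \<open>Series with complex exponents\<close>

definition fls_coeff :: "'n fock fls \<Rightarrow> complex \<Rightarrow> 'n fock" where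
  "fls_coeff f c = (if c \<in> \<int> then fls_nth f \<lfloor>Re c\<rfloor> else 0)"

lemma fls_coeff_of_int [simp]: "fls_coeff f (of_int n) = fls_nth f n"
  by (simp add: fls_coeff_def)

lemma fls_coeff_not_Int: "c \<notin> \<int> \<Longrightarrow> fls_coeff f c = 0"
  by (simp add: fls_coeff_def)

lemma fls_coeff_0 [simp]: "fls_coeff 0 c = 0"
  by (simp add: fls_coeff_def)

lemma fls_coeff_add: "fls_coeff (f + g) c = fls_coeff f c + fls_coeff g c"
  by (simp add: fls_coeff_def)

lemma fls_coeff_sum: "fls_coeff (sum f A) c = (\<Sum>x\<in>A. fls_coeff (f x) c)"
  by (induction A rule: infinite_finite_induct) (auto simp: fls_coeff_add)

lemma fls_coeff_scale: "fls_coeff (fls_scale a f) c = fock_scale a (fls_coeff f c)"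
  by (simp add: fls_coeff_def)

lemma fls_coeff_shift: "fls_coeff (fls_shift (int n) f) c = fls_coeff f (c + of_nat n)"
proof (cases "c \<in> \<int>")
  case True
  then obtain i where c: "c = of_int i"
    by (elim Ints_cases)
  have "c + of_nat n = of_int (i + int n)"
    by (simp add: c)
  then show ?thesis
    by (simp only: fls_coeff_of_int) (simp add: c)
next
  case False
  then have "c + of_nat n \<notin> \<int>"
    by (metis Ints_diff Ints_of_nat add_diff_cancel_right')
  with False show ?thesis
    by (simp add: fls_coeff_not_Int)
qed

text \<open>A product of fields sums over all complex exponents, but only one coset of the integers
  contributes, finitely often. The offsets a and b carry the nonintegral powers of z.\<close>

lemma Sum_any_fls_coeff_mult:
  "Sum_any (\<lambda>d. fls_coeff f (d - a) * fls_coeff g (c - d - b)) = fls_coeff (f * g) (c - a - b)"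
proof (cases "c - a - b \<in> \<int>")
  case True
  then obtain n where n: "c - a - b = of_int n"
    by (elim Ints_cases)
  \<comment> \<open>The lower bounds of the two Laurent series confine the index on both
    sides.\<close>
  let ?A = "{fls_subdegree f..n - fls_subdegree g}" and ?h = "\<lambda>i. of_int i + a"
  have "{d. fls_coeff f (d - a) * fls_coeff g (c - d - b) \<noteq> 0} \<subseteq> ?h ` ?A"
  proof
    fix d assume d: "d \<in> {d. fls_coeff f (d - a) * fls_coeff g (c - d - b) \<noteq> 0}"
    then have "d - a \<in> \<int>"
      by (auto intro: ccontr simp: fls_coeff_not_Int)
    then obtain i where i: "d - a = of_int i"
      by (elim Ints_cases)
    have "c - d - b = (c - a - b) - (d - a)"
      by simp
    then have j: "c - d - b = of_int (n - i)"
      by (simp only: n i of_int_diff)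
    have "fls_nth f i \<noteq> 0" "fls_nth g (n - i) \<noteq> 0"
      using d by (auto simp only: i j fls_coeff_of_int mem_Collect_eq mult_zero_left mult_zero_right)
    then have "i \<in> ?A"
      using fls_subdegree_leI[of f i] fls_subdegree_leI[of g "n - i"] by simp
    moreover have "d = ?h i"
      using i by (simp add: algebra_simps)
    ultimately show "d \<in> ?h ` ?A"
      by blast
  qed
  then have "Sum_any (\<lambda>d. fls_coeff f (d - a) * fls_coeff g (c - d - b)) =
      (\<Sum>d\<in>?h ` ?A. fls_coeff f (d - a) * fls_coeff g (c - d - b))"
    by (intro Sum_any.expand_superset) auto
  also have "\<dots> = (\<Sum>i\<in>?A. fls_nth f i * fls_nth g (n - i))"
  proof (subst sum.reindex)
    show "inj_on ?h ?A"
      by (auto simp: inj_on_def)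
    have "c - ?h i - b = of_int (n - i)" for i
      using n by (simp add: algebra_simps)
    then show "sum ((\<lambda>d. fls_coeff f (d - a) * fls_coeff g (c - d - b)) \<circ> ?h) ?A =
        (\<Sum>i\<in>?A. fls_nth f i * fls_nth g (n - i))"
      by (simp only: comp_def add_diff_cancel_right' fls_coeff_of_int)
  qed
  also have "\<dots> = fls_coeff (f * g) (c - a - b)"
    by (simp add: n fls_times_nth(2))
  finally show ?thesis .
next
  case False
  have "fls_coeff f (d - a) * fls_coeff g (c - d - b) = 0" for d
  proof (cases "d - a \<in> \<int>")
    case True
    have "c - d - b \<notin> \<int>"
    proof
      assume "c - d - b \<in> \<int>"
      then have "(c - d - b) + (d - a) \<in> \<int>"
        using True by (rule Ints_add)
      with False show False
        by (simp add: algebra_simps)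
    qed
    then show ?thesis
      by (simp add: fls_coeff_not_Int)
  qed (simp add: fls_coeff_not_Int)
  with False show ?thesis
    by (simp add: fls_coeff_not_Int)
qed

section \<open>Exponentials of fields on a single charge\<close>

lemma single_eq_0_iff [simp]: "Poly_Mapping.single k v = 0 \<longleftrightarrow> v = 0"
  by (metis lookup_single_eq lookup_zero single_zero)

lemma single_sum: "Poly_Mapping.single k (sum f A) = (\<Sum>x\<in>A. Poly_Mapping.single k (f x))"
  by (induction A rule: infinite_finite_induct) (auto simp: single_add)

lemma Sum_any_single: "Sum_any (\<lambda>d. Poly_Mapping.single k (g d)) = Poly_Mapping.single k (Sum_any g)"
  by (simp add: Sum_any.expand_set single_sum)

lemma gva_scale_single: "gva_scale c (Poly_Mapping.single \<delta> p) = Poly_Mapping.single \<delta> (fock_scale c p)"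
  by (simp add: gva_scale_def gva_embed_def mult_single)

text \<open>The parameter s is 1 for creation and -1 for annihilation, so that one computation
  covers both exponentials.\<close>

definition at_multiple :: "complex \<Rightarrow> (nat \<Rightarrow> 'a) \<Rightarrow> complex \<Rightarrow> 'a::comm_monoid_add" where
  "at_multiple s g c = (\<Sum>m\<in>{m. c = s * of_nat m}. g m)"

lemma at_multiple_eq: "s \<noteq> 0 \<Longrightarrow> at_multiple s g (s * of_nat m) = g m"
  by (simp add: at_multiple_def)

lemma at_multiple_neq: "(\<And>m. c \<noteq> s * of_nat m) \<Longrightarrow> at_multiple s g c = 0"
  by (simp add: at_multiple_def)

lemma field_power_single:
  fixes F :: "('h::ab_group_add, 'n) field_op"
  assumes s: "s \<noteq> 0" and lin: "\<And>j. fock_linear (f j)"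
    and F: "\<And>c q. F c (Poly_Mapping.single \<delta> q) =
      (\<Sum>n\<in>{n::nat. n > 0 \<and> c = s * of_nat n}. Poly_Mapping.single \<delta> (fock_scale (1 / of_nat n) (f n q)))"
  shows "field_power F k c (Poly_Mapping.single \<delta> q) =
    Poly_Mapping.single \<delta> (at_multiple s (\<lambda>m. pow_op f k m q) c)"
proof (induction k arbitrary: c)
  case 0
  show ?case
  proof (cases "\<exists>m. c = s * of_nat m")
    case True
    then obtain m where "c = s * of_nat m"
      by blast
    then show ?thesis
      using s by (simp add: field_power_def field_id_def at_multiple_eq[OF s])
  next
    case False
    then show ?thesis
      by (auto simp: field_power_def field_id_def at_multiple_neq)
  qed
next
  case (Suc k)
  let ?P = "at_multiple s (\<lambda>m. pow_op f k m q)"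
  have F1: "F (s * of_nat n) (Poly_Mapping.single \<delta> p) = Poly_Mapping.single \<delta> (fock_scale (1 / of_nat n) (f n p))"
    if "n > 0" for n p
  proof -
    have "{m. m > 0 \<and> s * of_nat n = s * of_nat m} = {n}"
      using s that by auto
    then show ?thesis
      by (simp add: F)
  qed
  have F2: "F d (Poly_Mapping.single \<delta> p) = 0" if "\<And>n. n > 0 \<Longrightarrow> d \<noteq> s * of_nat n" for d p
  proof -
    have "{n. n > 0 \<and> d = s * of_nat n} = {}"
      using that by auto
    then show ?thesis
      by (simp only: F sum.empty)
  qed
  have F3: "F d 0 = 0" for d
    using F[of d 0] by (simp add: fock_pair.linear_0[OF lin])
  have "field_power F (Suc k) c (Poly_Mapping.single \<delta> q) = Sum_any (\<lambda>d. F d (Poly_Mapping.single \<delta> (?P (c - d))))"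
    by (simp add: field_power_def field_mult_def flip: Suc.IH[unfolded field_power_def])
  also have "\<dots> = Poly_Mapping.single \<delta> (at_multiple s (\<lambda>m. pow_op f (Suc k) m q) c)"
  proof (cases "\<exists>m. c = s * of_nat m")
    case True
    then obtain m where c: "c = s * of_nat m"
      by blast
    have sub: "{d. F d (Poly_Mapping.single \<delta> (?P (c - d))) \<noteq> 0} \<subseteq> (\<lambda>n. s * of_nat n) ` {1..m}"
    proof
      fix d assume d: "d \<in> {d. F d (Poly_Mapping.single \<delta> (?P (c - d))) \<noteq> 0}"
      then obtain n where n: "n > 0" "d = s * of_nat n"
        using F2 by (metis (mono_tags, lifting) mem_Collect_eq)
      have "\<exists>l. c - d = s * of_nat l"
      proof (rule ccontr)
        assume "\<nexists>l. c - d = s * of_nat l"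
        then have "?P (c - d) = 0"
          by (intro at_multiple_neq) blast
        with d F3 show False
          by simp
      qed
      then obtain l where "s * of_nat m = s * (of_nat n + of_nat l)"
        using n c by (auto simp: algebra_simps)
      then have "of_nat m = (of_nat (n + l) :: complex)"
        using s by simp
      then have "m = n + l"
        by (simp only: of_nat_eq_iff)
      with n show "d \<in> (\<lambda>n. s * of_nat n) ` {1..m}"
        by auto
    qed
    have "Sum_any (\<lambda>d. F d (Poly_Mapping.single \<delta> (?P (c - d)))) =
        (\<Sum>d\<in>(\<lambda>n. s * of_nat n) ` {1..m}. F d (Poly_Mapping.single \<delta> (?P (c - d))))"
      using sub by (intro Sum_any.expand_superset) auto
    also have "\<dots> = (\<Sum>n\<in>{1..m}. F (s * of_nat n) (Poly_Mapping.single \<delta> (?P (c - s * of_nat n))))"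
      using s by (subst sum.reindex) (auto simp: inj_on_def)
    also have "\<dots> = (\<Sum>n\<in>{1..m}. Poly_Mapping.single \<delta> (fock_scale (1 / of_nat n) (f n (pow_op f k (m - n) q))))"
    proof (rule sum.cong[OF refl])
      fix n assume n: "n \<in> {1..m}"
      then have "c - s * of_nat n = s * of_nat (m - n)"
        by (simp add: c of_nat_diff algebra_simps)
      then show "F (s * of_nat n) (Poly_Mapping.single \<delta> (?P (c - s * of_nat n))) =
          Poly_Mapping.single \<delta> (fock_scale (1 / of_nat n) (f n (pow_op f k (m - n) q)))"
        using n by (simp only: at_multiple_eq[OF s]) (simp add: F1)
    qed
    finally show ?thesis
      by (simp add: c at_multiple_eq[OF s] single_sum)
  next
    case False
    have "F d (Poly_Mapping.single \<delta> (?P (c - d))) = 0" for d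
    proof (cases "\<exists>n>0. d = s * of_nat n")
      case True
      then obtain n where n: "d = s * of_nat n"
        by blast
      have "c - d \<noteq> s * of_nat l" for l
        using False[simplified, rule_format, of "n + l"] by (auto simp: n algebra_simps)
      then show ?thesis
        by (simp add: at_multiple_neq F3)
    qed (use F2 in blast)
    with False show ?thesis
      by (auto simp: at_multiple_neq)
  qed
  finally show ?case .
qed

lemma field_exp_single:
  fixes F :: "('h::ab_group_add, 'n) field_op"
  assumes s: "s \<noteq> 0" and lin: "\<And>j. fock_linear (f j)" and comm: "\<And>i j p. f i (f j p) = f j (f i p)"
    and F: "\<And>c q. F c (Poly_Mapping.single \<delta> q) =
      (\<Sum>n\<in>{n::nat. n > 0 \<and> c = s * of_nat n}. Poly_Mapping.single \<delta> (fock_scale (1 / of_nat n) (f n q)))"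
  shows "field_exp F c (Poly_Mapping.single \<delta> q) =
    Poly_Mapping.single \<delta> (at_multiple s (\<lambda>m. exp_op f m q) c)"
proof -
  have e: "field_exp F c (Poly_Mapping.single \<delta> q) = Poly_Mapping.single \<delta>
      (Sum_any (\<lambda>k. fock_scale (1 / fact k) (at_multiple s (\<lambda>m. pow_op f k m q) c)))"
    unfolding field_exp_def field_power_single[OF s lin F] gva_scale_single Sum_any_single ..
  show ?thesis
  proof (cases "\<exists>m. c = s * of_nat m")
    case True
    then obtain m where c: "c = s * of_nat m"
      by blast
    have "Sum_any (\<lambda>k. fock_scale (1 / fact k) (pow_op f k m q)) = (\<Sum>k\<le>m. fock_scale (1 / fact k) (pow_op f k m q))"
      by (rule Sum_any.expand_superset) (auto intro: leI dest: pow_op_eq_0[OF lin])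
    then show ?thesis
      unfolding e by (simp only: c at_multiple_eq[OF s] exp_op_eq_sum_pow_op[OF lin comm])
  next
    case False
    then have "at_multiple s g c = 0" for g :: "nat \<Rightarrow> 'n fock"
      by (simp add: at_multiple_neq)
    then show ?thesis
      unfolding e by simp
  qed
qed

context lattice_gva
begin

subsection \<open>Vertex operators on homogeneous vectors\<close>

lemma heis_single:
  "heis h (- int (Suc k)) (Poly_Mapping.single \<delta> q) = Poly_Mapping.single \<delta> (heis_elem h k * q)"
  "heis h (int j) (Poly_Mapping.single \<delta> q) = Poly_Mapping.single \<delta> (heis_nonneg \<delta> h j q)"
proof -
  show "heis h (- int (Suc k)) (Poly_Mapping.single \<delta> q) = Poly_Mapping.single \<delta> (heis_elem h k * q)"
    by (simp add: heis_def gva_embed_def mult_single nat_add_distrib)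
  show "heis h (int j) (Poly_Mapping.single \<delta> q) = Poly_Mapping.single \<delta> (heis_nonneg \<delta> h j q)"
  proof (cases j)
    case 0
    then show ?thesis
      by (cases "q = 0") (simp_all add: heis_def heis_nonneg_def gva_scale_single)
  next
    case (Suc i)
    then show ?thesis
      by (cases "q = 0") (simp_all add: heis_def heis_nonneg_def heis_deriv_simps map_eq_zero_iff)
  qed
qed

lemma heis_field_neg_single:
  "heis_field {..<0} (\<beta> r) k d (Poly_Mapping.single \<gamma> p) =
     Poly_Mapping.single \<gamma> (fls_coeff (creation_series r k) d * p)"
proof (cases "\<exists>e. d = of_int e")
  case True
  then obtain e where d: "d = of_int e"
    by blast
  \<comment> \<open>The power z^e comes from one mode only, and that mode is negative exactly when e
    + k \<ge> 0.\<close>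
  have "d = of_int (- n - 1 - int k) \<longleftrightarrow> n = - e - 1 - int k" for n
    unfolding d of_int_eq_iff by auto
  then have set: "{n \<in> {..<0}. d = of_int (- n - 1 - int k)} = (if e + int k < 0 then {} else {- e - 1 - int k})"
    by auto
  show ?thesis
  proof (cases "e + int k < 0")
    case False
    then obtain m where m: "e + int k = int m"
      by (metis not_less nonneg_int_cases)
    then have n: "- e - 1 - int k = - int (Suc m)"
      by simp
    have "heis_field {..<0} (\<beta> r) k d (Poly_Mapping.single \<gamma> p) =
        gva_scale (of_int (- (- int (Suc m)) - 1) gchoose k) (heis (\<beta> r) (- int (Suc m)) (Poly_Mapping.single \<gamma> p))"
      unfolding heis_field_def set n using False by simp
    also have "\<dots> = Poly_Mapping.single \<gamma> (fls_coeff (creation_series r k) d * p)"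
      unfolding heis_single
      using m by (simp add: d gva_scale_single creation_series_def heis_elem_basis mult.assoc)
    finally show ?thesis .
  qed (unfold heis_field_def set, simp add: d creation_series_def)
next
  case False
  then have "{n \<in> {..<0}. d = of_int (- n - 1 - int k)} = {}" "d \<notin> \<int>"
    by (blast elim: Ints_cases)+
  then show ?thesis
    by (simp only: heis_field_def sum.empty) (simp add: fls_coeff_not_Int)
qed

lemma heis_field_nonneg_single:
  "heis_field {0..} h k (- of_nat (j + 1 + k)) (Poly_Mapping.single \<delta> q) =
     Poly_Mapping.single \<delta> (fock_scale ((- of_nat j - 1) gchoose k) (heis_nonneg \<delta> h j q))"
proof -
  have "(- of_nat (j + 1 + k) :: complex) = of_int (- n - 1 - int k) \<longleftrightarrow> n = int j" for n
  proof -
    have "(- of_nat (j + 1 + k) :: complex) = of_int (- int (j + 1 + k))"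
      by simp
    then show ?thesis
      by (simp only: of_int_eq_iff) auto
  qed
  then have "{n \<in> {0..}. (- of_nat (j + 1 + k) :: complex) = of_int (- n - 1 - int k)} = {int j}"
    by auto
  then show ?thesis
    by (simp only: heis_field_def) (simp add: heis_single gva_scale_single)
qed

lemma heis_field_nonneg_eq_0:
  assumes "\<And>j. e \<noteq> - of_nat (j + 1 + k)"
  shows "heis_field {0..} h k e v = 0"
proof -
  have "{n \<in> {0..}. e = of_int (- n - 1 - int k)} = {}"
  proof (safe, goal_cases)
    case (1 n)
    then have "e = - of_nat (nat n + 1 + k)"
      by simp
    with assms show ?case
      by blast
  qed
  then show ?thesis
    by (simp only: heis_field_def sum.empty)
qed

lemma creation_exp_single:
  "field_exp (creation_field \<alpha>) c (Poly_Mapping.single \<delta> q) =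
     Poly_Mapping.single \<delta> (fls_coeff (schur_series \<alpha>) c * q)"
proof -
  have F: "creation_field \<alpha> c (Poly_Mapping.single \<delta> q) =
      (\<Sum>n\<in>{n::nat. n > 0 \<and> c = 1 * of_nat n}.
        Poly_Mapping.single \<delta> (fock_scale (1 / of_nat n) (heis_elem \<alpha> (n - 1) * q)))" for c q
    unfolding creation_field_def mult_1
  proof (intro sum.cong refl)
    fix n assume "n \<in> {n. n > 0 \<and> c = of_nat n}"
    then have "int n = int (Suc (n - 1))"
      by simp
    then show "gva_scale (1 / of_nat n) (heis \<alpha> (- int n) (Poly_Mapping.single \<delta> q)) =
        Poly_Mapping.single \<delta> (fock_scale (1 / of_nat n) (heis_elem \<alpha> (n - 1) * q))"
      by (simp only: heis_single gva_scale_single)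
  qed
  have "field_exp (creation_field \<alpha>) c (Poly_Mapping.single \<delta> q) =
      Poly_Mapping.single \<delta> (at_multiple 1 (\<lambda>m. exp_op (\<lambda>j p. heis_elem \<alpha> (j - 1) * p) m q) c)"
    by (rule field_exp_single[OF _ fock_linear_mult _ F]) (simp_all add: mult.left_commute)
  also have "\<dots> = Poly_Mapping.single \<delta> (at_multiple 1 (\<lambda>m. schur \<alpha> m * q) c)"
    by (simp only: exp_op_heis_elem)
  also have "at_multiple 1 (\<lambda>m. schur \<alpha> m * q) c = fls_coeff (schur_series \<alpha>) c * q"
  proof (cases "\<exists>m. c = 1 * of_nat m")
    case True
    then obtain m where c: "c = 1 * of_nat m"
      by blast
    then have "c = of_int (int m)"
      by simp
    then have "fls_coeff (schur_series \<alpha>) c = schur \<alpha> m"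
      by (simp only: fls_coeff_of_int) (simp add: schur_series_def)
    then show ?thesis
      by (simp only: c at_multiple_eq[OF one_neq_zero])
  next
    case False
    have "fls_coeff (schur_series \<alpha>) c = 0"
    proof (cases "c \<in> \<int>")
      case True
      then obtain i where i: "c = of_int i"
        by (elim Ints_cases)
      have "i < 0"
      proof (rule ccontr)
        assume "\<not> i < 0"
        then have "c = 1 * of_nat (nat i)"
          by (simp add: i)
        with False show False
          by blast
      qed
      then show ?thesis
        by (simp add: i schur_series_def)
    qed (simp add: fls_coeff_not_Int)
    with False show ?thesis
      by (simp add: at_multiple_neq)
  qed
  finally show ?thesis .
qed

lemma annihilation_exp_single:
  assumes q: "fock_graded {..N} q"
  shows "field_exp (annihilation_field \<alpha>) c (Poly_Mapping.single \<delta> q) =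
     Poly_Mapping.single \<delta> (fls_coeff (\<Sum>a\<le>N. fls_shift (int a) (fls_const (annih_exp \<alpha> a q))) c)"
proof -
  have F: "annihilation_field \<alpha> c (Poly_Mapping.single \<delta> q) =
      (\<Sum>n\<in>{n::nat. n > 0 \<and> c = - 1 * of_nat n}.
        Poly_Mapping.single \<delta> (fock_scale (1 / of_nat n) (- heis_deriv \<alpha> (n - 1) q)))" for c q
    unfolding annihilation_field_def
    by (intro sum.cong) (auto simp: heis_single gva_scale_single heis_nonneg_def single_uminus)
  have "field_exp (annihilation_field \<alpha>) c (Poly_Mapping.single \<delta> q) =
      Poly_Mapping.single \<delta> (at_multiple (- 1) (\<lambda>m. exp_op (\<lambda>j p. - heis_deriv \<alpha> (j - 1) p) m q) c)"
    by (rule field_exp_single[OF _ fock_linear_neg_heis_deriv _ F])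
      (simp_all add: heis_deriv_simps heis_deriv_commute)
  also have "\<dots> = Poly_Mapping.single \<delta> (at_multiple (- 1) (\<lambda>m. annih_exp \<alpha> m q) c)"
    by (simp only: annih_exp_def)
  also have "at_multiple (- 1) (\<lambda>m. annih_exp \<alpha> m q) c =
      fls_coeff (\<Sum>a\<le>N. fls_shift (int a) (fls_const (annih_exp \<alpha> a q))) c"
  proof (cases "\<exists>m. c = - 1 * of_nat m")
    case True
    then obtain m where c: "c = - 1 * of_nat m"
      by blast
    then have "c = of_int (- int m)"
      by simp
    then have "fls_coeff (\<Sum>a\<le>N. fls_shift (int a) (fls_const (annih_exp \<alpha> a q))) c =
        (\<Sum>a\<le>N. if a = m then annih_exp \<alpha> a q else 0)"
      by (simp only: fls_coeff_of_int fls_nth_sum) (intro sum.cong refl, auto)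
    also have "\<dots> = annih_exp \<alpha> m q"
      by (simp add: annih_exp_eq_0[OF q])
    moreover have "at_multiple (- 1) (\<lambda>m. annih_exp \<alpha> m q) c = annih_exp \<alpha> m q"
      unfolding c by (rule at_multiple_eq) simp
    ultimately show ?thesis
      by simp
  next
    case False
    have "fls_coeff (fls_shift (int a) (fls_const (annih_exp \<alpha> a q))) c = 0" for a
    proof (cases "c \<in> \<int>")
      case True
      then obtain i where i: "c = of_int i"
        by (elim Ints_cases)
      have "i + int a \<noteq> 0"
      proof
        assume "i + int a = 0"
        then have "i = - int a"
          by simp
        then have "c = - 1 * of_nat a"
          by (simp add: i)
        with False show False
          by blast
      qed
      then show ?thesis
        by (simp add: i)
    qed (simp add: fls_coeff_not_Int)
    with False show ?thesis
      by (simp add: at_multiple_neq fls_coeff_sum)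
  qed
  finally show ?thesis .
qed

text \<open>The exponentials preserve the charge \<delta>, so z^\<alpha>(0) acts by a single power
  of z; it becomes the offset in the coefficient.\<close>

lemma exp_vertex_op_single:
  assumes "fock_graded {..N} q"
  shows "exp_vertex_op \<alpha> c (Poly_Mapping.single \<delta> q) =
    Poly_Mapping.single (\<alpha> + \<delta>) (fls_coeff (exp_vertex_series N \<alpha> q) (c - form \<alpha> \<delta>))"
proof -
  have zpow: "zpow_field \<alpha> c (Poly_Mapping.single \<delta> p) = (if c = form \<alpha> \<delta> then Poly_Mapping.single \<delta> p else 0)" for c p
  proof (cases "p = 0")
    case False
    then have "{\<gamma> \<in> Poly_Mapping.keys (Poly_Mapping.single \<delta> p). form \<alpha> \<gamma> = c} = (if c = form \<alpha> \<delta> then {\<delta>} else {})"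
      by auto
    then show ?thesis
      by (simp add: zpow_field_def)
  qed (simp add: zpow_field_def)
  have shift: "(shift_field \<alpha> \<odot> zpow_field \<alpha>) c (Poly_Mapping.single \<delta> p) =
      (if c = form \<alpha> \<delta> then Poly_Mapping.single (\<alpha> + \<delta>) p else 0)" for c p
  proof -
    have "(shift_field \<alpha> \<odot> zpow_field \<alpha>) c (Poly_Mapping.single \<delta> p) =
        Sum_any (\<lambda>d. if d = 0 then gva_exp \<alpha> * zpow_field \<alpha> (c - d) (Poly_Mapping.single \<delta> p) else 0)"
      by (simp add: field_mult_def shift_field_def)
    also have "\<dots> = gva_exp \<alpha> * zpow_field \<alpha> c (Poly_Mapping.single \<delta> p)"
      by simp
    finally show ?thesis
      by (simp add: zpow gva_exp_def mult_single)
  qed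
  have cre: "(shift_field \<alpha> \<odot> zpow_field \<alpha> \<odot> field_exp (creation_field \<alpha>)) c (Poly_Mapping.single \<delta> p) =
      Poly_Mapping.single (\<alpha> + \<delta>) (fls_coeff (schur_series \<alpha>) (c - form \<alpha> \<delta>) * p)" for c p
    unfolding field_mult_def[of "shift_field \<alpha> \<odot> zpow_field \<alpha>"] creation_exp_single shift by simp
  show ?thesis
    unfolding exp_vertex_op_def exp_vertex_series_def
      field_mult_def[of "shift_field \<alpha> \<odot> zpow_field \<alpha> \<odot> field_exp (creation_field \<alpha>)"]
      annihilation_exp_single[OF assms] cre Sum_any_single
    using Sum_any_fls_coeff_mult[of "schur_series \<alpha>" "form \<alpha> \<delta>" _ c 0] by simp
qed

lemma list_vertex_op_single:
  assumes "fock_graded {..N} q"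
  shows "list_vertex_op xs \<alpha> c (Poly_Mapping.single \<delta> q) =
    Poly_Mapping.single (\<alpha> + \<delta>) (fls_coeff (list_vertex_series N xs \<alpha> \<delta> q) (c - form \<alpha> \<delta>))"
  using assms
proof (induction xs arbitrary: c q)
  case Nil
  then show ?case
    by (simp add: list_vertex_series_simps exp_vertex_op_single)
next
  case (Cons x xs)
  obtain r k where x: "x = (r, k)"
    by (cases x)
  let ?L = "list_vertex_series N xs \<alpha> \<delta>" and ?F = "list_vertex_op xs \<alpha>" and ?b = "form \<alpha> \<delta>"
    and ?q = "\<lambda>j. fock_scale ((- of_nat j - 1) gchoose k) (heis_nonneg \<delta> (\<beta> r) j q)"
    and ?v = "Poly_Mapping.single \<delta> q"
  have cre: "(heis_field {..<0} (\<beta> r) k \<odot> ?F) c ?v =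
      Poly_Mapping.single (\<alpha> + \<delta>) (fls_coeff (creation_series r k * ?L q) (c - ?b))"
    unfolding field_mult_def Cons.IH[OF Cons.prems] heis_field_neg_single Sum_any_single
    using Sum_any_fls_coeff_mult[of "creation_series r k" 0 "?L q" c ?b] by simp
  have F0: "?F d 0 = 0" for d
    using Cons.IH[of 0 d] by (simp add: fls_pair.linear_0[OF fls_linear_list_vertex_series])
  let ?e = "\<lambda>j. c + of_nat (j + 1 + k)"
  have e: "c - ?e j = - of_nat (j + 1 + k)" for j
    by simp
  have "{d. ?F d (heis_field {0..} (\<beta> r) k (c - d) ?v) \<noteq> 0} \<subseteq> ?e ` {..N}"
  proof
    fix d assume d: "d \<in> {d. ?F d (heis_field {0..} (\<beta> r) k (c - d) ?v) \<noteq> 0}"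
    then have "heis_field {0..} (\<beta> r) k (c - d) ?v \<noteq> 0"
      using F0 by auto
    then obtain j where "c - d = - of_nat (j + 1 + k)"
      using heis_field_nonneg_eq_0 by blast
    then have j: "d = ?e j"
      by (simp add: algebra_simps)
    have "j \<le> N"
    proof (rule ccontr)
      assume "\<not> j \<le> N"
      \<comment> \<open>With index a = 0 the annihilation exponential is the identity, so the
        vanishing lemma speaks about the mode itself.\<close>
      then have "heis_nonneg \<delta> (\<beta> r) j q = 0"
        using annih_exp_heis_nonneg_eq_0[OF Cons.prems, of 0 j 0] by simp
      then show False
        using d F0 unfolding j e heis_field_nonneg_single mem_Collect_eq by simp
    qed
    with j show "d \<in> ?e ` {..N}"
      by blast
  qed
  then have "(?F \<odot> heis_field {0..} (\<beta> r) k) c ?v =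
      (\<Sum>d\<in>?e ` {..N}. ?F d (heis_field {0..} (\<beta> r) k (c - d) ?v))"
    unfolding field_mult_def by (intro Sum_any.expand_superset) auto
  also have "\<dots> = (\<Sum>j\<le>N. ?F (?e j) (heis_field {0..} (\<beta> r) k (c - ?e j) ?v))"
    by (subst sum.reindex) (auto simp: inj_on_def)
  also have "\<dots> = (\<Sum>j\<le>N. Poly_Mapping.single (\<alpha> + \<delta>) (fls_coeff (fls_scale ((- of_nat j - 1) gchoose k)
      (fls_shift (int (j + 1 + k)) (?L (heis_nonneg \<delta> (\<beta> r) j q)))) (c - ?b)))"
  proof (rule sum.cong[OF refl])
    fix j
    have "?e j - ?b = c - ?b + of_nat (j + 1 + k)"
      by simp
    then show "?F (?e j) (heis_field {0..} (\<beta> r) k (c - ?e j) ?v) =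
        Poly_Mapping.single (\<alpha> + \<delta>) (fls_coeff (fls_scale ((- of_nat j - 1) gchoose k)
          (fls_shift (int (j + 1 + k)) (?L (heis_nonneg \<delta> (\<beta> r) j q)))) (c - ?b))"
      unfolding e heis_field_nonneg_single fls_coeff_scale fls_coeff_shift
        Cons.IH[OF fock_graded_scale[OF fock_graded_heis_nonneg[OF Cons.prems]]]
        fls_pair.linear_scale[OF fls_linear_list_vertex_series]
      by (simp only:)
  qed
  finally have ann: "(?F \<odot> heis_field {0..} (\<beta> r) k) c ?v = \<dots>" .
  show ?case
    unfolding x list_vertex_op.simps fst_conv snd_conv normal_ordered_def field_add_def cre ann
      list_vertex_series_simps normal_op_def fls_coeff_add fls_coeff_sum single_add single_sum ..
qed

lemma vertex_op_single:
  assumes "fock_graded {..N} q"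
  shows "vertex_op (Poly_Mapping.single \<alpha> p) c (Poly_Mapping.single \<delta> q) =
    Poly_Mapping.single (\<alpha> + \<delta>) (fls_coeff (vertex_series N p \<alpha> \<delta> q) (c - form \<alpha> \<delta>))"
proof (cases "p = 0")
  case True
  then show ?thesis
    by (simp add: vertex_op_def vertex_series_def)
next
  case False
  then show ?thesis
    by (simp add: vertex_op_def vertex_series_def list_vertex_op_single[OF assms] gva_scale_single
        fls_coeff_sum fls_coeff_scale single_sum)
qed

end

section \<open>Components of a vector by charge\<close>

lemma fock_graded_bound: "\<exists>N. fock_graded {..N} q"
  using finite_nat_set_iff_bounded_le[of "monom_wt ` Poly_Mapping.keys q"]
  by (auto simp: fock_graded_def)

lemma lookup_gva_scale: "Poly_Mapping.lookup (gva_scale c v) \<delta> = fock_scale c (Poly_Mapping.lookup v \<delta>)"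
  by (simp add: gva_scale_def gva_embed_def mult_map_scale_conv_mult[symmetric] map.rep_eq when_def)

lemma gva_expand: "v = (\<Sum>\<delta>\<in>Poly_Mapping.keys v. Poly_Mapping.single \<delta> (Poly_Mapping.lookup v \<delta>))"
  by (rule poly_mapping_eqI) (auto simp: lookup_sum lookup_single when_def in_keys_iff)

global_interpretation gva_pair: vector_space_pair
  "fock_scale :: complex \<Rightarrow> 'n fock \<Rightarrow> _" "gva_scale :: complex \<Rightarrow> ('h::ab_group_add, 'n) gva \<Rightarrow> _"
  by unfold_locales

lemma gva_linear_single: "Vector_Spaces.linear fock_scale gva_scale (Poly_Mapping.single \<delta>)"
  unfolding Vector_Spaces.linear_iff
  using fock.vector_space_axioms gva.vector_space_axioms by (auto simp: single_add gva_scale_single)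

lemma subspace_single_vimage:
  assumes "gva.subspace S"
  shows "fock.subspace {p. Poly_Mapping.single \<delta> p \<in> S}"
  using assms
  by (auto simp: fock.subspace_def gva.subspace_def single_add gva_scale_single[symmetric])

context lattice_gva
begin

subsection \<open>The principal subspaces\<close>

definition charge :: "'n multiset \<Rightarrow> 'h" where
  "charge c = (\<Sum>r\<in>#c. \<beta> r)"

definition charged_space :: "'h \<Rightarrow> 'h \<Rightarrow> 'n fock set" where
  "charged_space \<mu> \<delta> = fock.span {schur_prod M | M. \<mu> + charge (image_mset fst M) = \<delta>}"

text \<open>The explicit span of the overview, described one charge at a time;
  \<open>principal_module_eq\<close> identifies it with the module.\<close>

definition schur_module :: "'h \<Rightarrow> ('h, 'n) gva set" where
  "schur_module \<mu> = {v. \<forall>\<delta>. Poly_Mapping.lookup v \<delta> \<in> charged_space \<mu> \<delta>}"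

lemma charge_simps [simp]: "charge {#} = 0" "charge (add_mset r c) = \<beta> r + charge c"
  by (simp_all add: charge_def)

lemma charged_space_subspace: "fock.subspace (charged_space \<mu> \<delta>)"
  by (simp add: charged_space_def)

lemma schur_prod_charged: "\<mu> + charge (image_mset fst M) = \<delta> \<Longrightarrow> schur_prod M \<in> charged_space \<mu> \<delta>"
  unfolding charged_space_def by (rule fock.span_base) blast

lemma schur_space_charged: "schur_space c T \<subseteq> charged_space \<mu> (\<mu> + charge c)"
  unfolding schur_space_def charged_space_def by (rule fock.span_mono) auto

lemma charged_space_induct:
  assumes "p \<in> charged_space \<mu> \<delta>" "fock_linear f" "fock.subspace V"
    "\<And>M. \<mu> + charge (image_mset fst M) = \<delta> \<Longrightarrow> f (schur_prod M) \<in> V"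
  shows "f p \<in> V"
  using assms(1) unfolding charged_space_def
proof (induction rule: fock.span_induct)
  show "fock.subspace {p. f p \<in> V}"
    using assms(2,3) by (auto simp: fock.subspace_def fock_pair.linear_0 fock_pair.linear_add fock_pair.linear_scale)
qed (use assms(4) in auto)

lemma charged_space_annih_exp: "q \<in> charged_space \<mu> \<delta> \<Longrightarrow> annih_exp h a q \<in> charged_space \<mu> \<delta>"
proof (erule charged_space_induct[OF _ fock_linear_annih_exp charged_space_subspace])
  fix M :: "('n \<times> nat) multiset" assume M: "\<mu> + charge (image_mset fst M) = \<delta>"
  have "schur_prod M \<in> schur_space (image_mset fst M) UNIV"
    by (rule schur_prod_in_space) auto
  then show "annih_exp h a (schur_prod M) \<in> charged_space \<mu> \<delta>"
    using annih_exp_schur_space schur_space_charged M by blast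
qed

lemma charged_space_mult:
  "q \<in> charged_space \<mu> \<delta> \<Longrightarrow> schur (\<beta> r) m * q \<in> charged_space \<mu> (\<beta> r + \<delta>)"
proof (erule charged_space_induct[OF _ fock_linear_mult charged_space_subspace])
  fix M :: "('n \<times> nat) multiset" assume "\<mu> + charge (image_mset fst M) = \<delta>"
  then have "schur_prod (add_mset (r, m) M) \<in> charged_space \<mu> (\<beta> r + \<delta>)"
    by (intro schur_prod_charged) (auto simp: add_ac)
  then show "schur (\<beta> r) m * schur_prod M \<in> charged_space \<mu> (\<beta> r + \<delta>)"
    by simp
qed

text \<open>With \<alpha> = 0 the innermost series has no creation part left, so every
  multiplication comes from a listed factor and raises the charge by exactly its vector;
  annihilation keeps the charge.\<close>

lemma schur_vertex_series_charged:
  assumes "q \<in> charged_space \<mu> \<gamma>"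
  shows "fls_nth (schur_vertex_series N xs 0 \<delta> q) n \<in> charged_space \<mu> ((\<Sum>x\<leftarrow>xs. \<beta> (fst x)) + \<gamma>)"
  using assms
proof (induction xs arbitrary: q n)
  case Nil
  have "schur_series 0 = 1"
  proof -
    have "Abs_fps (schur 0) = 1"
      by (rule fps_ext) (simp add: schur_zero)
    then show ?thesis
      by (simp add: schur_series_def)
  qed
  then show ?case
    using Nil
    by (auto simp: exp_vertex_series_def fls_nth_sum intro!: fock.subspace_sum charged_space_subspace
        charged_space_annih_exp fock.subspace_0)
next
  case (Cons x xs)
  obtain r k where x: "x = (r, k)"
    by (cases x)
  let ?V = "charged_space \<mu> ((\<Sum>x\<leftarrow>x # xs. \<beta> (fst x)) + \<gamma>)"
  have mult: "fls_nth (deriv_series r k t) i * p \<in> ?V"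
    if "p \<in> charged_space \<mu> ((\<Sum>x\<leftarrow>xs. \<beta> (fst x)) + \<gamma>)" for t i p
  proof (cases "i + int k < 0")
    case True
    then show ?thesis
      using fock.subspace_0[OF charged_space_subspace] by (simp add: deriv_series_def)
  next
    case False
    then have "fls_nth (deriv_series r k t) i * p =
        fock_scale ((t + of_nat (nat (i + int k))) gchoose k) (schur (\<beta> r) (nat (i + int k)) * p)"
      by (simp add: deriv_series_def mult.assoc)
    then show ?thesis
      using charged_space_mult[OF that, of r] fock.subspace_scale[OF charged_space_subspace]
      by (simp add: x add.assoc)
  qed
  have "fls_nth (deriv_series r k t * schur_vertex_series N xs 0 \<delta> p) i \<in> ?V"
    if "p \<in> charged_space \<mu> \<gamma>" for t p i
    unfolding fls_times_nth(2)
    by (intro fock.subspace_sum charged_space_subspace mult Cons.IH that)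
  then show ?case
    using Cons.prems
    by (auto simp: x fls_nth_sum simp del: fls_times_nth intro!: fock.subspace_sum[OF charged_space_subspace]
        charged_space_annih_exp)
qed

text \<open>The charge \<alpha> is the sum of the colors of each generator of the left factor, so
  \<open>vertex_series_schur_prod\<close> applies with remaining exponent 0.\<close>

lemma vertex_series_charged:
  assumes p: "p \<in> charged_space 0 \<alpha>" and q: "q \<in> charged_space \<mu> \<gamma>" "fock_graded {..N} q"
  shows "fls_coeff (vertex_series N p \<alpha> \<delta> q) c \<in> charged_space \<mu> (\<alpha> + \<gamma>)"
proof -
  have "fls_nth (vertex_series N p \<alpha> \<delta> q) n \<in> charged_space \<mu> (\<alpha> + \<gamma>)" for n
    using p unfolding charged_space_def[of 0]
  proof (induction rule: fock.span_induct)
    show "fock.subspace {p. fls_nth (vertex_series N p \<alpha> \<delta> q) n \<in> charged_space \<mu> (\<alpha> + \<gamma>)}"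
      using charged_space_subspace[of \<mu> "\<alpha> + \<gamma>"]
      by (auto simp: fock.subspace_def fls_pair.linear_0[OF fls_linear_vertex_series_left]
          fls_pair.linear_add[OF fls_linear_vertex_series_left]
          fls_pair.linear_scale[OF fls_linear_vertex_series_left])
  next
    fix p assume "p \<in> {schur_prod M | M. 0 + charge (image_mset fst M) = \<alpha>}"
    then obtain M where M: "p = schur_prod M" "charge (image_mset fst M) = \<alpha>"
      by auto
    obtain xs where xs: "M = mset xs"
      using ex_mset by metis
    have a: "(\<Sum>x\<leftarrow>xs. \<beta> (fst x)) = \<alpha>"
      using M(2) by (simp add: xs charge_def image_mset.compositionality comp_def
          flip: sum_mset_sum_list mset_map)
    then show "fls_nth (vertex_series N p \<alpha> \<delta> q) n \<in> charged_space \<mu> (\<alpha> + \<gamma>)"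
      using schur_vertex_series_charged[OF q(1), of N xs \<delta> n]
        vertex_series_schur_prod[OF q(2), of xs 0 \<delta>]
      by (simp add: M(1) xs)
  qed
  then show ?thesis
    using fock.subspace_0[OF charged_space_subspace] by (auto simp: fls_coeff_def)
qed

lemma nth_prod_single:
  assumes "fock_graded {..N} q"
  shows "nth_prod (Poly_Mapping.single \<alpha> p) n (Poly_Mapping.single \<gamma> q) =
    gva_scale (\<epsilon> \<alpha> \<gamma>) (Poly_Mapping.single (\<alpha> + \<gamma>) (fls_coeff (vertex_series N p \<alpha> \<gamma> q) (- n - 1 - form \<alpha> \<gamma>)))"
proof (cases "p = 0 \<or> q = 0")
  case True
  then show ?thesis
    by (auto simp: nth_prod_def fls_pair.linear_0[OF fls_linear_vertex_series]
        fls_pair.linear_0[OF fls_linear_vertex_series_left])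
next
  case False
  then show ?thesis
    by (simp add: nth_prod_def vertex_op_single[OF assms])
qed

lemma schur_module_subspace: "gva.subspace (schur_module \<mu>)"
  using charged_space_subspace
  by (auto simp: gva.subspace_def schur_module_def lookup_add lookup_gva_scale fock.subspace_def)

lemma single_in_schur_module: "p \<in> charged_space \<mu> \<delta> \<Longrightarrow> Poly_Mapping.single \<delta> p \<in> schur_module \<mu>"
  using fock.subspace_0[OF charged_space_subspace]
  by (auto simp: schur_module_def lookup_single when_def)

lemma nth_prod_schur_module:
  assumes "u \<in> schur_module 0" "v \<in> schur_module \<mu>"
  shows "nth_prod u n v \<in> schur_module \<mu>"
  unfolding nth_prod_def
proof (intro gva.subspace_sum gva.subspace_scale schur_module_subspace)
  fix \<alpha> \<gamma>
  obtain N where N: "fock_graded {..N} (Poly_Mapping.lookup v \<gamma>)"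
    using fock_graded_bound by blast
  show "vertex_op (Poly_Mapping.single \<alpha> (Poly_Mapping.lookup u \<alpha>)) (- n - 1)
      (Poly_Mapping.single \<gamma> (Poly_Mapping.lookup v \<gamma>)) \<in> schur_module \<mu>"
    unfolding vertex_op_single[OF N]
    by (intro single_in_schur_module vertex_series_charged N)
      (use assms in \<open>auto simp: schur_module_def\<close>)
qed

lemma gva_exp_in_schur_module: "gva_exp \<mu> \<in> schur_module \<mu>" "gva_exp (\<beta> r) \<in> schur_module 0"
proof -
  show "gva_exp \<mu> \<in> schur_module \<mu>"
    unfolding gva_exp_def
    using schur_prod_charged[of \<mu> "{#}" \<mu>] by (intro single_in_schur_module) simp
  show "gva_exp (\<beta> r) \<in> schur_module 0"
    unfolding gva_exp_def
    using schur_prod_charged[of 0 "{#(r, 0)#}" "\<beta> r"] by (intro single_in_schur_module) simp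
qed

text \<open>Translation is itself a product with the vacuum, so closure under it follows from
  closure under products.\<close>

lemma principal_subspace_subset: "principal_subspace \<subseteq> schur_module 0"
  unfolding principal_subspace_def
  by (rule Inter_lower)
    (auto simp: translation_def intro: schur_module_subspace gva_exp_in_schur_module nth_prod_schur_module)

lemma principal_module_subset: "principal_module \<mu> \<subseteq> schur_module \<mu>"
  unfolding principal_module_def
  using principal_subspace_subset
  by (intro Inter_lower)
    (auto intro: schur_module_subspace gva_exp_in_schur_module nth_prod_schur_module)

lemma exp_vertex_series_nth:
  "fls_nth (exp_vertex_series N \<alpha> q) (int m) = (\<Sum>a\<le>N. schur \<alpha> (m + a) * annih_exp \<alpha> a q)"
  by (simp add: exp_vertex_series_def schur_series_def sum_distrib_left fls_shifted_times_simps
      fls_nth_sum nat_add_distrib)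

text \<open>
  By induction on the number of factors and on the degree of \<open>schur_prod M\<close>: the modes of
  \<open>Y(e^\<alpha>, z)\<close>, \<open>\<alpha> = \<beta> r\<close>, map \<open>schur_prod M\<close> to its product with a Schur polynomial, up to terms in
  which \<open>schur_prod M\<close> is replaced by elements of lower degree.
\<close>

lemma schur_prod_in_submodule:
  assumes S: "gva.subspace S" "gva_exp \<mu> \<in> S"
    "\<And>u v n. u \<in> principal_subspace \<Longrightarrow> v \<in> S \<Longrightarrow> nth_prod u n v \<in> S"
  shows "Poly_Mapping.single (\<mu> + charge (image_mset fst M)) (schur_prod M) \<in> S"
proof (induction "image_mset fst M" arbitrary: M)
  case empty
  then show ?case
    using S(2) by (simp add: gva_exp_def)
next
  case (add r c)
  then obtain x M' where M: "M = add_mset x M'" "fst x = r" "image_mset fst M' = c"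
    by (metis msed_map_invR)
  obtain m where x: "x = (r, m)"
    using M(2) by (cases x) auto
  let ?\<delta> = "\<mu> + charge c"
  \<comment> \<open>The index m is arbitrary in the induction on the degree of \<open>M'\<close>,
    since lowering that degree by a raises the index to m + a.\<close>
  have "Poly_Mapping.single (\<beta> r + ?\<delta>) (schur (\<beta> r) m * schur_prod M') \<in> S"
    if "image_mset fst M' = c" for m M'
    using that
  proof (induction "sum_mset (image_mset snd M')" arbitrary: m M' rule: less_induct)
    case less
    define d where "d = sum_mset (image_mset snd M')"
    let ?q = "schur_prod M'"
    have q: "fock_graded {..d} ?q"
      by (rule fock_graded_mono[OF schur_prod_graded]) (simp add: d_def)
    have lower: "Poly_Mapping.single (\<beta> r + ?\<delta>) (schur (\<beta> r) (m + a) * annih_exp (\<beta> r) a ?q) \<in> S"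
      if a: "a > 0" for a
    proof -
      have "annih_exp (\<beta> r) a ?q \<in> schur_space c {w. w + a \<in> {d}}"
        by (intro annih_exp_schur_space schur_prod_in_space) (auto simp: less.prems d_def)
      then have "schur (\<beta> r) (m + a) * annih_exp (\<beta> r) a ?q \<in>
          {p. Poly_Mapping.single (\<beta> r + ?\<delta>) p \<in> S}"
      proof (rule schur_space_induct[OF _ fock_linear_mult subspace_single_vimage[OF S(1)]])
        fix M'' :: "('n \<times> nat) multiset"
        assume "image_mset fst M'' = c" "sum_mset (image_mset snd M'') \<in> {w. w + a \<in> {d}}"
        with a show "schur (\<beta> r) (m + a) * schur_prod M'' \<in> {p. Poly_Mapping.single (\<beta> r + ?\<delta>) p \<in> S}"
          by (simp add: less.hyps d_def)
      qed
      then show ?thesis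
        by simp
    qed
    have "gva_exp (\<beta> r) \<in> principal_subspace"
      by (auto simp: principal_subspace_def)
    moreover have "Poly_Mapping.single ?\<delta> ?q \<in> S"
      using add.hyps(1)[of M'] less.prems by simp
    \<comment> \<open>The mode is chosen so that, after removing the power of z due to the charges,
      the coefficient of z^m is extracted.\<close>
    ultimately have "nth_prod (gva_exp (\<beta> r)) (- of_nat m - 1 - form (\<beta> r) ?\<delta>) (Poly_Mapping.single ?\<delta> ?q) \<in> S"
      by (rule S(3))
    moreover have "- (- of_nat m - 1 - form (\<beta> r) ?\<delta>) - 1 - form (\<beta> r) ?\<delta> = of_int (int m)"
      by simp
    ultimately have "gva_scale (\<epsilon> (\<beta> r) ?\<delta>) (Poly_Mapping.single (\<beta> r + ?\<delta>)
        (\<Sum>a\<le>d. schur (\<beta> r) (m + a) * annih_exp (\<beta> r) a ?q)) \<in> S"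
      by (simp only: gva_exp_def nth_prod_single[OF q] vertex_series_1 fls_coeff_of_int exp_vertex_series_nth)
    then have "gva_scale (inverse (\<epsilon> (\<beta> r) ?\<delta>)) (gva_scale (\<epsilon> (\<beta> r) ?\<delta>) (Poly_Mapping.single (\<beta> r + ?\<delta>)
        (\<Sum>a\<le>d. schur (\<beta> r) (m + a) * annih_exp (\<beta> r) a ?q))) \<in> S"
      by (rule gva.subspace_scale[OF S(1)])
    then have sum: "Poly_Mapping.single (\<beta> r + ?\<delta>) (\<Sum>a\<le>d. schur (\<beta> r) (m + a) * annih_exp (\<beta> r) a ?q) \<in> S"
      by (simp add: cocycle_nonzero)
    \<comment> \<open>The term a = 0 is the wanted product; all others are already in S.\<close>
    have "{..d} = insert 0 {1..d}"
      by auto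
    then have "(\<Sum>a\<le>d. schur (\<beta> r) (m + a) * annih_exp (\<beta> r) a ?q) =
        schur (\<beta> r) m * ?q + (\<Sum>a\<in>{1..d}. schur (\<beta> r) (m + a) * annih_exp (\<beta> r) a ?q)"
      by simp
    then have "Poly_Mapping.single (\<beta> r + ?\<delta>) (schur (\<beta> r) m * ?q) =
        Poly_Mapping.single (\<beta> r + ?\<delta>) (\<Sum>a\<le>d. schur (\<beta> r) (m + a) * annih_exp (\<beta> r) a ?q)
        - (\<Sum>a\<in>{1..d}. Poly_Mapping.single (\<beta> r + ?\<delta>) (schur (\<beta> r) (m + a) * annih_exp (\<beta> r) a ?q))"
      by (simp add: single_add single_sum)
    also have "\<dots> \<in> S"
      by (intro gva.subspace_diff gva.subspace_sum S(1) sum lower) auto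
    finally show ?case .
  qed
  from this[OF M(3), of m] show ?case
    by (simp add: M x add.left_commute flip: add.hyps(2))
qed

theorem principal_module_eq: "principal_module \<mu> = schur_module \<mu>"
proof (rule antisym[OF principal_module_subset], rule subsetI)
  fix v assume v: "v \<in> schur_module \<mu>"
  show "v \<in> principal_module \<mu>"
    unfolding principal_module_def
  proof (rule InterI)
    fix S assume "S \<in> {S. gva.subspace S \<and> gva_exp \<mu> \<in> S \<and>
      (\<forall>u\<in>principal_subspace. \<forall>v\<in>S. \<forall>n. nth_prod u n v \<in> S)}"
    then have S: "gva.subspace S" "gva_exp \<mu> \<in> S"
      "\<And>u v n. u \<in> principal_subspace \<Longrightarrow> v \<in> S \<Longrightarrow> nth_prod u n v \<in> S"
      by auto
    have "Poly_Mapping.lookup v \<delta> \<in> {p. Poly_Mapping.single \<delta> p \<in> S}" for \<delta>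
    proof (rule charged_space_induct[OF _ fock_linear_id subspace_single_vimage[OF S(1)]])
      show "Poly_Mapping.lookup v \<delta> \<in> charged_space \<mu> \<delta>"
        using v by (simp add: schur_module_def)
    next
      fix M :: "('n \<times> nat) multiset" assume "\<mu> + charge (image_mset fst M) = \<delta>"
      then show "schur_prod M \<in> {p. Poly_Mapping.single \<delta> p \<in> S}"
        using schur_prod_in_submodule[OF S, of M] by simp
    qed
    then show "v \<in> S"
      by (subst gva_expand) (auto intro!: gva.subspace_sum S(1))
  qed
qed

end

subsection \<open>Monomials\<close>

lemma prod_fock_var:
  "(\<Prod>x\<in>#M. fock_var x) = Poly_Mapping.single (\<Sum>x\<in>#M. Poly_Mapping.single x 1) 1"
  by (induction M) (simp_all add: fock_var_def mult_single)

lemma lookup_sum_single: "Poly_Mapping.lookup (\<Sum>x\<in>#M. Poly_Mapping.single x (1::nat)) = count M"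
  by (induction M) (auto simp: fun_eq_iff lookup_add lookup_single when_def)

lemma monom_wt_sum_single: "monom_wt (\<Sum>x\<in>#M. Poly_Mapping.single x 1) = (\<Sum>x\<in>#M. snd x + 1)"
  by (induction M) (simp_all add: monom_wt_add)

definition wt_msets :: "nat \<Rightarrow> ('n \<times> nat) multiset set" where
  "wt_msets d = {M. (\<Sum>x\<in>#M. snd x + 1) = d}"

text \<open>Every entry contributes at least 1, so d bounds both the size and the entries, and there
  are finitely many colors.\<close>

lemma finite_wt_msets: "finite (wt_msets d :: ('n::finite \<times> nat) multiset set)"
proof (rule finite_subset)
  show "finite (\<Union>k\<le>d. multisets_of_size (UNIV \<times> {..d}) k :: ('n \<times> nat) multiset set)"
    by auto
  show "wt_msets d \<subseteq> (\<Union>k\<le>d. multisets_of_size (UNIV \<times> {..d}) k :: ('n \<times> nat) multiset set)"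
  proof
    fix M :: "('n \<times> nat) multiset" assume M: "M \<in> wt_msets d"
    have "size M \<le> (\<Sum>x\<in>#M. snd x + 1)"
      by (induction M) auto
    moreover have "snd x \<le> (\<Sum>x\<in>#M. snd x + 1)" if "x \<in># M" for x
      using that by (induction M) fastforce+
    ultimately show "M \<in> (\<Union>k\<le>d. multisets_of_size (UNIV \<times> {..d}) k)"
      using M by (force simp: multisets_of_size_def wt_msets_def)
  qed
qed

lemma inj_prod_fock_var: "inj (\<lambda>M. \<Prod>x\<in>#M. fock_var x :: 'n fock)"
proof (rule injI)
  fix M N :: "('n \<times> nat) multiset"
  assume "(\<Prod>x\<in>#M. fock_var x) = (\<Prod>x\<in>#N. fock_var x)"
  then have "Poly_Mapping.keys (\<Prod>x\<in>#M. fock_var x) = Poly_Mapping.keys (\<Prod>x\<in>#N. fock_var x)"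
    by simp
  then have "(\<Sum>x\<in>#M. Poly_Mapping.single x (1::nat)) = (\<Sum>x\<in>#N. Poly_Mapping.single x 1)"
    by (simp add: prod_fock_var)
  then have "count M = count N"
    by (metis lookup_sum_single)
  then show "M = N"
    by (simp add: multiset_eq_iff)
qed

lemma independent_monomials: "fock.independent ((\<lambda>m. Poly_Mapping.single m 1) ` A)"
proof (subst fock.independent_explicit_finite_subsets, intro allI impI ballI)
  fix S :: "'a fock set" and u v
  assume S: "S \<subseteq> (\<lambda>m. Poly_Mapping.single m 1) ` A" "finite S"
    and 0: "(\<Sum>v\<in>S. fock_scale (u v) v) = 0" and v: "v \<in> S"
  then obtain m where m: "v = Poly_Mapping.single m 1"
    by blast
  have "0 = Poly_Mapping.lookup (\<Sum>v\<in>S. fock_scale (u v) v) m"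
    using 0 by simp
  also have "\<dots> = (\<Sum>w\<in>S. if w = v then u v else 0)"
    unfolding lookup_sum
  proof (rule sum.cong[OF refl])
    fix w assume "w \<in> S"
    then obtain k where k: "w = Poly_Mapping.single k 1"
      using S by blast
    show "Poly_Mapping.lookup (fock_scale (u w) w) m = (if w = v then u v else 0)"
    proof (cases "k = m")
      case False
      then have "w \<noteq> v"
        unfolding k m by (metis lookup_single_eq lookup_single_not_eq one_neq_zero)
      then show ?thesis
        using False by (simp add: k fock_scale_single lookup_single_not_eq)
    qed (simp add: k m fock_scale_single)
  qed
  finally show "u v = 0"
    using S v by simp
qed

text \<open>A dimension count: as many independent vectors as X has elements lie in the span of at
  most that many, so the latter must be distinct and independent.\<close>

lemma independent_span_card:
  assumes "fock.independent (f ` X)" "inj_on f X" "finite X" "f ` X \<subseteq> fock.span (g ` X)"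
  shows "fock.independent (g ` X)" "inj_on g X"
proof -
  obtain B where B: "B \<subseteq> g ` X" "fock.independent B" "g ` X \<subseteq> fock.span B"
    using fock.maximal_independent_subset by blast
  have fin: "finite B"
    using B(1) assms(3) finite_subset by blast
  have "f ` X \<subseteq> fock.span B"
    by (rule order_trans[OF assms(4) fock.span_minimal[OF B(3) fock.subspace_span]])
  then have "card (f ` X) \<le> card B"
    using fock.independent_span_bound[OF fin assms(1)] by blast
  moreover have "card (f ` X) = card X"
    by (rule card_image[OF assms(2)])
  moreover have "card B \<le> card (g ` X)"
    using B(1) assms(3) by (intro card_mono) auto
  moreover have "card (g ` X) \<le> card X"
    by (rule card_image_le[OF assms(3)])
  ultimately have "card B = card (g ` X)" "card (g ` X) = card X"
    by linarith+
  then show "fock.independent (g ` X)" "inj_on g X"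
    using B card_subset_eq[of "g ` X" B] assms(3) by (auto intro: eq_card_imp_inj_on)
qed

context lattice_gva
begin

subsection \<open>Linear independence of products of Schur polynomials\<close>

text \<open>The variable (r, k) stands for \<open>\<beta> r (-(k + 1))\<close> and has the degree of
  \<open>schur (\<beta> r) (k + 1)\<close>, so this matches variables with Schur factors.\<close>

definition raise_index :: "'n \<times> nat \<Rightarrow> 'n \<times> nat" where
  "raise_index x = (fst x, snd x + 1)"

definition pos_schur_space :: "nat \<Rightarrow> 'n fock set" where
  "pos_schur_space d = fock.span ((\<lambda>M. schur_prod (image_mset raise_index M)) ` wt_msets d)"

lemma pos_schur_space_subspace: "fock.subspace (pos_schur_space d)"
  by (simp add: pos_schur_space_def)

lemma schur_prod_union: "schur_prod (M + N) = schur_prod M * schur_prod N"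
  by (simp add: schur_prod_def)

lemma pos_schur_space_mult:
  assumes "p \<in> pos_schur_space a" "q \<in> pos_schur_space b"
  shows "p * q \<in> pos_schur_space (a + b)"
proof -
  have 1: "schur_prod (image_mset raise_index M) * q \<in> pos_schur_space (a + b)"
    if "M \<in> wt_msets a" for M
    using assms(2) unfolding pos_schur_space_def[of b]
  proof (induction rule: fock.span_induct)
    show "fock.subspace {q. schur_prod (image_mset raise_index M) * q \<in> pos_schur_space (a + b)}"
      using pos_schur_space_subspace[of "a + b"]
      by (auto simp: fock.subspace_def ring_distribs mult.left_commute)
  next
    fix q assume "q \<in> (\<lambda>M. schur_prod (image_mset raise_index M)) ` wt_msets b"
    then obtain N where N: "q = schur_prod (image_mset raise_index N)" "N \<in> wt_msets b"
      by blast
    have "M + N \<in> wt_msets (a + b)"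
      using N that by (simp add: wt_msets_def)
    then have "schur_prod (image_mset raise_index (M + N)) \<in> pos_schur_space (a + b)"
      unfolding pos_schur_space_def by (intro fock.span_base imageI)
    then show "schur_prod (image_mset raise_index M) * q \<in> pos_schur_space (a + b)"
      by (simp add: N schur_prod_union)
  qed
  show ?thesis
    using assms(1) unfolding pos_schur_space_def[of a]
  proof (induction rule: fock.span_induct)
    show "fock.subspace {p. p * q \<in> pos_schur_space (a + b)}"
      using pos_schur_space_subspace[of "a + b"]
      by (auto simp: fock.subspace_def ring_distribs mult.assoc)
  qed (use 1 in blast)
qed

lemma schur_in_pos_schur_space: "schur (\<beta> r) (Suc k) \<in> pos_schur_space (Suc k)"
proof -
  have "schur_prod (image_mset raise_index {#(r, k)#}) \<in> pos_schur_space (Suc k)"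
    unfolding pos_schur_space_def by (intro fock.span_base imageI) (simp add: wt_msets_def)
  then show ?thesis
    by (simp add: raise_index_def)
qed

text \<open>\<open>schur_rec\<close> is solved for its last summand, as in Newton's identities; all
  other variables in it have smaller index.\<close>

lemma fock_var_in_pos_schur_space: "fock_var (r, k) \<in> pos_schur_space (Suc k)"
proof (induction k rule: less_induct)
  case (less k)
  have "fock_scale (of_nat (Suc k)) (schur (\<beta> r) (Suc k)) =
      (\<Sum>j\<in>{1..k}. fock_var (r, j - 1) * schur (\<beta> r) (Suc k - j)) + fock_var (r, k)"
    unfolding schur_rec heis_elem_basis by simp
  then have "fock_var (r, k) = fock_scale (of_nat (Suc k)) (schur (\<beta> r) (Suc k)) -
      (\<Sum>j\<in>{1..k}. fock_var (r, j - 1) * schur (\<beta> r) (Suc k - j))"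
    by simp
  also have "\<dots> \<in> pos_schur_space (Suc k)"
  proof (intro fock.subspace_diff fock.subspace_scale fock.subspace_sum pos_schur_space_subspace
      schur_in_pos_schur_space)
    fix j assume j: "j \<in> {1..k}"
    have "fock_var (r, j - 1) * schur (\<beta> r) (Suc (k - j)) \<in> pos_schur_space (Suc (j - 1) + Suc (k - j))"
      using j by (intro pos_schur_space_mult less schur_in_pos_schur_space) auto
    moreover have "Suc (j - 1) + Suc (k - j) = Suc k" "Suc (k - j) = Suc k - j"
      using j by auto
    ultimately show "fock_var (r, j - 1) * schur (\<beta> r) (Suc k - j) \<in> pos_schur_space (Suc k)"
      by simp
  qed
  finally show ?case .
qed

lemma prod_fock_var_in_pos_schur_space:
  "(\<Prod>x\<in>#M. fock_var x) \<in> pos_schur_space (\<Sum>x\<in>#M. snd x + 1)"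
proof (induction M)
  case empty
  have "schur_prod (image_mset raise_index {#}) \<in> pos_schur_space 0"
    unfolding pos_schur_space_def by (intro fock.span_base imageI) (simp add: wt_msets_def)
  then show ?case
    by simp
next
  case (add x M)
  then show ?case
    using pos_schur_space_mult[OF fock_var_in_pos_schur_space[of "fst x" "snd x"] add] by simp
qed

text \<open>Monomials of degree d and products of positive Schur factors of degree d are indexed by
  the same finite set, so the fact that the products span the monomials already gives
  independence.\<close>

lemma pos_schur_prod_independent:
  "fock.independent ((\<lambda>M. schur_prod (image_mset raise_index M)) ` wt_msets d)"
  "inj_on (\<lambda>M. schur_prod (image_mset raise_index M)) (wt_msets d)"
proof -
  have "(\<lambda>M. \<Prod>x\<in>#M. fock_var x) ` wt_msets d =
      (\<lambda>m. Poly_Mapping.single m 1) ` (\<lambda>M. \<Sum>x\<in>#M. Poly_Mapping.single x 1) ` wt_msets d"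
    unfolding image_image prod_fock_var ..
  then have "fock.independent ((\<lambda>M. \<Prod>x\<in>#M. fock_var x :: 'n fock) ` wt_msets d)"
    using independent_monomials by metis
  moreover have "inj_on (\<lambda>M. \<Prod>x\<in>#M. fock_var x :: 'n fock) (wt_msets d)"
    using inj_prod_fock_var by (rule inj_on_subset) simp
  moreover have "(\<lambda>M. \<Prod>x\<in>#M. fock_var x) ` wt_msets d \<subseteq>
      fock.span ((\<lambda>M. schur_prod (image_mset raise_index M)) ` wt_msets d)"
    using prod_fock_var_in_pos_schur_space by (auto simp: wt_msets_def pos_schur_space_def)
  ultimately show "fock.independent ((\<lambda>M. schur_prod (image_mset raise_index M)) ` wt_msets d)"
    "inj_on (\<lambda>M. schur_prod (image_mset raise_index M)) (wt_msets d)"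
    using independent_span_card[OF _ _ finite_wt_msets] by blast+
qed

definition schur_msets :: "'n multiset \<Rightarrow> nat \<Rightarrow> ('n \<times> nat) multiset set" where
  "schur_msets c d = {M. image_mset fst M = c \<and> sum_mset (image_mset snd M) = d}"

text \<open>Entries 0 contribute the factor 1 and are dropped; the others are shifted to the
  indexing of \<open>wt_msets\<close>, inverse to \<open>raise_index\<close>.\<close>

definition lower_positive :: "('n \<times> nat) multiset \<Rightarrow> ('n \<times> nat) multiset" where
  "lower_positive M = image_mset (\<lambda>x. (fst x, snd x - 1)) (filter_mset (\<lambda>x. snd x > 0) M)"

lemma raise_lower_positive: "image_mset raise_index (lower_positive M) = filter_mset (\<lambda>x. snd x > 0) M"
  by (induction M) (auto simp: lower_positive_def raise_index_def)

lemma schur_prod_positive: "schur_prod (filter_mset (\<lambda>x. snd x > 0) M) = schur_prod M"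
proof (induction M)
  case (add x M)
  then show ?case
    by (cases x) auto
qed simp

lemma filter_zero_mset:
  "filter_mset (\<lambda>x. \<not> snd x > 0) M = image_mset (\<lambda>r. (r, 0)) (image_mset fst (filter_mset (\<lambda>x. \<not> snd x > (0::nat)) M))"
  by (induction M) auto

text \<open>The dropped entries are recovered from the prescribed colors c: they are (r, 0) for each
  color that the positive entries leave over.\<close>

lemma inj_on_lower_positive: "inj_on lower_positive (schur_msets c d)"
proof (rule inj_onI)
  fix M N assume M: "M \<in> schur_msets c d" and N: "N \<in> schur_msets c d" and eq: "lower_positive M = lower_positive N"
  let ?P = "filter_mset (\<lambda>x. snd x > (0::nat))" and ?Z = "filter_mset (\<lambda>x. \<not> snd x > (0::nat))"
  have P: "?P M = ?P N"
    using arg_cong[OF eq, of "image_mset raise_index"] by (simp only: raise_lower_positive)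
  have part: "M' = ?P M' + ?Z M'" for M' :: "('n \<times> nat) multiset"
    by (rule multiset_partition)
  have "image_mset fst (?P M) + image_mset fst (?Z M) = image_mset fst (?P N) + image_mset fst (?Z N)"
    using M N unfolding schur_msets_def mem_Collect_eq image_mset_union[symmetric] part[symmetric]
    by (elim conjE) (simp only:)
  then have "image_mset fst (?Z M) = image_mset fst (?Z N)"
    by (simp add: P)
  then have Z: "?Z M = ?Z N"
    by (subst (1 2) filter_zero_mset) (simp only:)
  show "M = N"
    by (subst (1 2) part) (simp only: P Z)
qed

lemma lower_positive_wt: "lower_positive ` schur_msets c d \<subseteq> wt_msets d"
proof -
  have "(\<Sum>x\<in>#lower_positive M. snd x + 1) = sum_mset (image_mset snd M)" for M
    by (induction M) (auto simp: lower_positive_def)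
  then show ?thesis
    by (auto simp: wt_msets_def schur_msets_def)
qed

lemma finite_schur_msets: "finite (schur_msets c d)"
  using inj_on_lower_positive lower_positive_wt finite_wt_msets by (rule inj_on_finite)

lemma schur_prod_independent:
  "fock.independent (schur_prod ` schur_msets c d)" "inj_on schur_prod (schur_msets c d)"
proof -
  let ?f = "\<lambda>M. schur_prod (image_mset raise_index M)"
  have e: "?f \<circ> lower_positive = schur_prod"
    by (simp add: fun_eq_iff raise_lower_positive schur_prod_positive)
  have "schur_prod ` schur_msets c d = ?f ` lower_positive ` schur_msets c d"
    by (simp only: image_comp e)
  also have "\<dots> \<subseteq> ?f ` wt_msets d"
    by (rule image_mono[OF lower_positive_wt])
  finally show "fock.independent (schur_prod ` schur_msets c d)"
    using pos_schur_prod_independent(1) fock.independent_mono by blast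
  have "inj_on ?f (lower_positive ` schur_msets c d)"
    using pos_schur_prod_independent(2) lower_positive_wt by (rule inj_on_subset)
  then have "inj_on (?f \<circ> lower_positive) (schur_msets c d)"
    by (intro comp_inj_on inj_on_lower_positive)
  then show "inj_on schur_prod (schur_msets c d)"
    by (simp only: e)
qed

subsection \<open>Charges and weights\<close>

lemma coord_scale: "coord (scale a h) r = a * coord h r"
  unfolding coord_def using representation_scale[OF basis_independent] basis_span by auto

lemma coord_sum: "coord (sum f A) r = (\<Sum>x\<in>A. coord (f x) r)"
proof -
  have "coord 0 r = 0"
    using coord_add[of 0 0 r] by simp
  then show ?thesis
    by (induction A rule: infinite_finite_induct) (simp_all add: coord_add)
qed

lemma coord_combination: "coord (\<Sum>r\<in>UNIV. scale (x r) (\<beta> r)) s = x s"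
  by (simp add: coord_sum coord_scale coord_basis sum.delta[OF finite_class.finite_UNIV]
      if_distrib[of "(*) _"] cong: if_cong)

lemma charge_eq: "charge c = (\<Sum>r\<in>UNIV. scale (of_nat (count c r)) (\<beta> r))"
proof (induction c)
  case (add s c)
  have "(\<Sum>r\<in>UNIV. scale (of_nat (count (add_mset s c) r)) (\<beta> r)) =
      (\<Sum>r\<in>UNIV. (if r = s then \<beta> r else 0) + scale (of_nat (count c r)) (\<beta> r))"
    by (intro sum.cong refl) (simp add: scale_left_distrib)
  then show ?case
    by (simp add: sum.distrib add.IH)
qed simp

lemma charge_eq_iff: "charge c = (\<Sum>r\<in>UNIV. scale (x r) (\<beta> r)) \<longleftrightarrow> (\<forall>r. x r = of_nat (count c r))"
proof
  assume "charge c = (\<Sum>r\<in>UNIV. scale (x r) (\<beta> r))"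
  then have "coord (charge c) r = x r" for r
    by (simp only: coord_combination)
  then show "\<forall>r. x r = of_nat (count c r)"
    unfolding charge_eq coord_combination by simp
qed (simp add: charge_eq)

lemma charge_inj: "charge c = charge c' \<Longrightarrow> c = c'"
  using charge_eq_iff[of c "\<lambda>r. of_nat (count c' r)"] charge_eq[of c'] by (simp add: multiset_eq_iff)

lemma charged_space_eq: "charged_space \<mu> (\<mu> + charge c) = schur_space c UNIV"
  unfolding charged_space_def schur_space_def by (auto dest: charge_inj intro!: arg_cong[of _ _ fock.span])

lemma schur_space_single_degree: "schur_space c {d} = fock.span (schur_prod ` schur_msets c d)"
  unfolding schur_space_def schur_msets_def by (rule arg_cong[of _ _ fock.span]) auto

definition degree_part :: "nat \<Rightarrow> 'n fock \<Rightarrow> 'n fock" where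
  "degree_part d p = (\<Sum>m\<in>Poly_Mapping.keys p. if monom_wt m = d then Poly_Mapping.single m (Poly_Mapping.lookup p m) else 0)"

lemma lookup_degree_part: "Poly_Mapping.lookup (degree_part d p) m = (if monom_wt m = d then Poly_Mapping.lookup p m else 0)"
proof -
  have "Poly_Mapping.lookup (degree_part d p) m =
      (\<Sum>k\<in>Poly_Mapping.keys p. if k = m then (if monom_wt m = d then Poly_Mapping.lookup p m else 0) else 0)"
    unfolding degree_part_def lookup_sum by (intro sum.cong refl) (auto simp: lookup_single when_def)
  then show ?thesis
    by (auto simp: in_keys_iff)
qed

lemma fock_linear_degree_part: "fock_linear (degree_part d)"
proof (rule fock_linearI; rule poly_mapping_eqI)
  fix c p m
  have l: "Poly_Mapping.lookup (fock_scale c p) m = c * Poly_Mapping.lookup p m" for p :: "'n fock"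
    by (simp add: fock_const_def mult_map_scale_conv_mult[symmetric] map.rep_eq when_def)
  show "Poly_Mapping.lookup (degree_part d (fock_scale c p)) m = Poly_Mapping.lookup (fock_scale c (degree_part d p)) m"
    by (simp add: lookup_degree_part l)
qed (simp add: lookup_degree_part lookup_add)

lemma degree_part_graded: "fock_graded {e} p \<Longrightarrow> degree_part d p = (if d = e then p else 0)"
  by (rule poly_mapping_eqI) (auto simp: lookup_degree_part fock_graded_def in_keys_iff image_subset_iff)

text \<open>Projection to degree d fixes p and either fixes or kills each generator, as the
  generators are homogeneous.\<close>

lemma schur_space_degree:
  assumes "p \<in> schur_space c UNIV" "fock_graded {d} p"
  shows "p \<in> schur_space c {d}"
proof -
  have "degree_part d p \<in> schur_space c {d}"
    using assms(1)
  proof (rule schur_space_induct[OF _ fock_linear_degree_part schur_space_subspace])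
    fix M :: "('n \<times> nat) multiset" assume "image_mset fst M = c"
    then show "degree_part d (schur_prod M) \<in> schur_space c {d}"
      using schur_prod_in_space[of M c "{d}"] fock.subspace_0[OF schur_space_subspace]
      by (auto simp: degree_part_graded[OF schur_prod_graded])
  qed
  then show ?thesis
    by (simp add: degree_part_graded[OF assms(2)])
qed

text \<open>A weight space mixes charges, so the degree is determined separately for each \<delta>;
  the set of admissible degrees has at most one element.\<close>

lemma weight_space_graded:
  assumes "v \<in> weight_space n"
  shows "fock_graded {w. of_nat w + form \<delta> \<delta> / 2 = n} (Poly_Mapping.lookup v \<delta>)"
  using assms unfolding weight_space_def
proof (induction rule: gva.span_induct)
  show "gva.subspace {v. fock_graded {w. of_nat w + form \<delta> \<delta> / 2 = n} (Poly_Mapping.lookup v \<delta>)}"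
    by (auto simp: gva.subspace_def lookup_add lookup_gva_scale intro: fock_graded_add fock_graded_scale)
next
  fix v assume "v \<in> {foldr (\<lambda>(h, i). heis h (- int i)) hs (gva_exp \<alpha>) | hs \<alpha>.
        (\<forall>(h, i)\<in>set hs. i > 0) \<and> of_nat (\<Sum>(h, i)\<leftarrow>hs. i) + form \<alpha> \<alpha> / 2 = n}"
  then obtain hs \<alpha> where v: "v = foldr (\<lambda>(h, i). heis h (- int i)) hs (gva_exp \<alpha>)"
    and pos: "\<forall>(h, i)\<in>set hs. i > 0" and n: "of_nat (\<Sum>(h, i)\<leftarrow>hs. i) + form \<alpha> \<alpha> / 2 = n"
    by blast
  have "\<exists>p. foldr (\<lambda>(h, i). heis h (- int i)) hs (gva_exp \<alpha>) = Poly_Mapping.single \<alpha> p \<and> fock_graded {\<Sum>(h, i)\<leftarrow>hs. i} p"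
    using pos
  proof (induction hs)
    case Nil
    then show ?case
      using fock_graded_const[of 1] by (auto simp: gva_exp_def)
  next
    case (Cons x hs)
    obtain h i where x: "x = (h, Suc i)"
      using Cons.prems by (cases x; cases "snd x") auto
    obtain p where p: "foldr (\<lambda>(h, i). heis h (- int i)) hs (gva_exp \<alpha>) = Poly_Mapping.single \<alpha> p"
      "fock_graded {\<Sum>(h, i)\<leftarrow>hs. i} p"
      using Cons by auto
    have "fock_graded {\<Sum>(h, i)\<leftarrow>x # hs. i} (heis_elem h i * p)"
      by (rule fock_graded_mono[OF fock_graded_mult[OF heis_elem_graded p(2)]]) (auto simp: x)
    moreover have "foldr (\<lambda>(h, i). heis h (- int i)) (x # hs) (gva_exp \<alpha>) = Poly_Mapping.single \<alpha> (heis_elem h i * p)"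
      by (simp only: foldr.simps comp_apply p x prod.case heis_single)
    ultimately show ?case
      by blast
  qed
  then obtain p where "v = Poly_Mapping.single \<alpha> p" "fock_graded {\<Sum>(h, i)\<leftarrow>hs. i} p"
    using v by blast
  then show "fock_graded {w. of_nat w + form \<delta> \<delta> / 2 = n} (Poly_Mapping.lookup v \<delta>)"
    using n by (cases "\<alpha> = \<delta>") (auto simp: lookup_single_not_eq elim!: fock_graded_mono)
qed

lemma single_in_weight_space:
  assumes "fock_graded {d} p" "of_nat d + form \<delta> \<delta> / 2 = n"
  shows "Poly_Mapping.single \<delta> p \<in> weight_space n"
proof -
  have 1: "Poly_Mapping.single \<delta> (Poly_Mapping.single m 1) \<in> weight_space n" if m: "monom_wt m = d" for m
  proof -
    obtain xs where xs: "count (mset xs) = Poly_Mapping.lookup m"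
      using mset_monom_factors by blast
    have m_eq: "m = (\<Sum>x\<in>#mset xs. Poly_Mapping.single x 1)"
      by (rule poly_mapping_eqI) (simp only: lookup_sum_single xs)
    \<comment> \<open>The modes of basis vectors already produce every monomial; \<open>Suc\<close>
      undoes the shift in the encoding of variables.\<close>
    let ?hs = "map (\<lambda>x. (\<beta> (fst x), Suc (snd x))) xs"
    have "foldr (\<lambda>(h, i). heis h (- int i)) ?hs (gva_exp \<delta>) = Poly_Mapping.single \<delta> (\<Prod>x\<in>#mset xs. fock_var x)"
    proof (induction xs)
      case (Cons x xs)
      show ?case
        unfolding list.map foldr.simps comp_apply Cons prod.case heis_single heis_elem_basis by simp
    qed (simp add: gva_exp_def)
    then have e: "foldr (\<lambda>(h, i). heis h (- int i)) ?hs (gva_exp \<delta>) = Poly_Mapping.single \<delta> (Poly_Mapping.single m 1)"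
      by (simp only: prod_fock_var m_eq)
    have "d = (\<Sum>x\<in>#mset xs. snd x + 1)"
      using m unfolding m_eq monom_wt_sum_single by simp
    also have "\<dots> = (\<Sum>(h, i)\<leftarrow>?hs. i)"
      by (induction xs) auto
    finally show ?thesis
      unfolding weight_space_def e[symmetric] using assms(2)
      by (intro gva.span_base CollectI exI[of _ ?hs] exI[of _ \<delta>]) auto
  qed
  have "Poly_Mapping.single \<delta> p = (\<Sum>m\<in>Poly_Mapping.keys p. gva_scale (Poly_Mapping.lookup p m)
      (Poly_Mapping.single \<delta> (Poly_Mapping.single m 1)))"
    by (subst (1) fock_expand[of p]) (simp add: single_sum gva_scale_single fock_scale_single)
  also have "\<dots> \<in> weight_space n"
    unfolding weight_space_def
    using 1 assms(1) unfolding weight_space_def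
    by (intro gva.span_sum gva.span_scale) (auto simp: fock_graded_def)
  finally show ?thesis .
qed

lemma charge_space_single:
  assumes "v \<in> charge_space \<delta>"
  shows "v = Poly_Mapping.single \<delta> (Poly_Mapping.lookup v \<delta>)"
proof (rule poly_mapping_eqI)
  fix k
  show "Poly_Mapping.lookup v k = Poly_Mapping.lookup (Poly_Mapping.single \<delta> (Poly_Mapping.lookup v \<delta>)) k"
    using assms by (cases "k = \<delta>") (auto simp: charge_space_def lookup_single_not_eq in_keys_iff)
qed

lemma graded_piece_schur_module:
  assumes d: "of_nat d + form \<delta> \<delta> / 2 = n" and \<delta>: "\<delta> = \<mu> + charge c"
  shows "graded_piece (schur_module \<mu>) \<delta> n = Poly_Mapping.single \<delta> ` schur_space c {d}"
proof (intro equalityI subsetI)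
  fix v assume v: "v \<in> graded_piece (schur_module \<mu>) \<delta> n"
  then have s: "v = Poly_Mapping.single \<delta> (Poly_Mapping.lookup v \<delta>)"
    by (intro charge_space_single) (simp add: graded_piece_def)
  have "fock_graded {w. of_nat w + form \<delta> \<delta> / 2 = n} (Poly_Mapping.lookup v \<delta>)"
    using v by (intro weight_space_graded) (simp add: graded_piece_def)
  then have "fock_graded {d} (Poly_Mapping.lookup v \<delta>)"
    by (rule fock_graded_mono) (use d in auto)
  moreover have "Poly_Mapping.lookup v \<delta> \<in> charged_space \<mu> \<delta>"
    using v by (simp add: graded_piece_def schur_module_def)
  then have "Poly_Mapping.lookup v \<delta> \<in> schur_space c UNIV"
    by (simp only: \<delta> charged_space_eq)
  ultimately have "Poly_Mapping.lookup v \<delta> \<in> schur_space c {d}"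
    by (intro schur_space_degree)
  then show "v \<in> Poly_Mapping.single \<delta> ` schur_space c {d}"
    using s by blast
next
  fix v assume "v \<in> Poly_Mapping.single \<delta> ` schur_space c {d}"
  then obtain p where p: "v = Poly_Mapping.single \<delta> p" "p \<in> schur_space c {d}"
    by blast
  then have "p \<in> charged_space \<mu> \<delta>"
    using schur_space_charged[of c "{d}" \<mu>] \<delta> by blast
  then have "v \<in> schur_module \<mu>"
    unfolding p(1) by (rule single_in_schur_module)
  then show "v \<in> graded_piece (schur_module \<mu>) \<delta> n"
    using single_in_weight_space[OF schur_space_graded[OF p(2)] d]
    by (simp add: graded_piece_def charge_space_def p(1))
qed

lemma graded_piece_trivial:
  assumes "\<And>c d. \<delta> = \<mu> + charge c \<Longrightarrow> of_nat d + form \<delta> \<delta> / 2 \<noteq> n"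
  shows "graded_piece (schur_module \<mu>) \<delta> n \<subseteq> {0}"
proof
  fix v assume v: "v \<in> graded_piece (schur_module \<mu>) \<delta> n"
  have "Poly_Mapping.lookup v \<delta> = 0"
  proof (cases "\<exists>c. \<delta> = \<mu> + charge c")
    case True
    have "fock_graded {w. of_nat w + form \<delta> \<delta> / 2 = n} (Poly_Mapping.lookup v \<delta>)"
      using v by (intro weight_space_graded) (simp add: graded_piece_def)
    moreover have "{w. of_nat w + form \<delta> \<delta> / 2 = n} = {}"
      using True assms by blast
    ultimately show ?thesis
      by (simp add: fock_graded_empty)
  next
    case False
    then have "{schur_prod M | M. \<mu> + charge (image_mset fst M) = \<delta>} = {}"
      by auto
    then have "charged_space \<mu> \<delta> = {0}"
      by (simp add: charged_space_def)
    then show ?thesis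
      using v by (auto simp: graded_piece_def schur_module_def)
  qed
  then show "v \<in> {0}"
    using v charge_space_single[of v \<delta>] by (simp add: graded_piece_def)
qed

lemma graded_piece_basis:
  assumes "of_nat d + form \<delta> \<delta> / 2 = n" and "\<delta> = \<mu> + charge c"
  defines "B \<equiv> (\<lambda>M. Poly_Mapping.single \<delta> (schur_prod M)) ` schur_msets c d"
  shows "graded_piece (schur_module \<mu>) \<delta> n = gva.span B" "gva.independent B" "card B = card (schur_msets c d)"
proof -
  have B: "B = Poly_Mapping.single \<delta> ` schur_prod ` schur_msets c d"
    by (simp add: B_def image_image)
  have inj: "inj_on (Poly_Mapping.single \<delta>) A" for A :: "'n fock set"
    using inj_single by (rule inj_on_subset) simp
  show "graded_piece (schur_module \<mu>) \<delta> n = gva.span B"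
    unfolding graded_piece_schur_module[OF assms(1,2)] schur_space_single_degree B
    by (rule gva_pair.linear_span_image[OF gva_linear_single, symmetric])
  show "gva.independent B"
    unfolding B
    by (rule gva_pair.linear_independent_injective_image[OF gva_linear_single schur_prod_independent(1) inj])
  show "card B = card (schur_msets c d)"
    unfolding B by (simp only: card_image[OF inj] card_image[OF schur_prod_independent(2)])
qed

lemma gva_finite_dim_graded_piece: "gva_finite_dim (graded_piece (schur_module \<mu>) \<delta> n)"
proof (cases "\<exists>c d. \<delta> = \<mu> + charge c \<and> of_nat d + form \<delta> \<delta> / 2 = n")
  case True
  then obtain c d where "of_nat d + form \<delta> \<delta> / 2 = n" "\<delta> = \<mu> + charge c"
    by blast
  then show ?thesis
    using graded_piece_basis(1) finite_schur_msets[of c d]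
    unfolding gva_finite_dim_def by (metis finite_imageI order_refl)
next
  case False
  then have "graded_piece (schur_module \<mu>) \<delta> n \<subseteq> gva.span {}"
    using graded_piece_trivial[of \<delta> \<mu> n] by auto
  then show ?thesis
    unfolding gva_finite_dim_def by blast
qed

lemma dim_graded_piece:
  assumes "of_nat d + form \<delta> \<delta> / 2 = n" "\<delta> = \<mu> + charge c"
  shows "gva.dim (graded_piece (schur_module \<mu>) \<delta> n) = card (schur_msets c d)"
  using graded_piece_basis[OF assms] gva.dim_eq_card by (metis gva.span_span)

lemma dim_graded_piece_0:
  assumes "\<And>c d. \<delta> = \<mu> + charge c \<Longrightarrow> of_nat d + form \<delta> \<delta> / 2 \<noteq> n"
  shows "gva.dim (graded_piece (schur_module \<mu>) \<delta> n) = 0"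
  using gva.dim_le_card[of "graded_piece (schur_module \<mu>) \<delta> n" "{}"] graded_piece_trivial[OF assms]
  by auto

subsection \<open>Counting\<close>

definition count_series :: "'n multiset \<Rightarrow> rat fps" where
  "count_series c = Abs_fps (\<lambda>d. of_nat (card (schur_msets c d)))"

lemma schur_msets_empty: "schur_msets {#} d = (if d = 0 then {{#}} else {})"
  by (auto simp: schur_msets_def)

text \<open>Adding and removing one copy of (r, 0) are inverse, and the sum is unchanged.\<close>

lemma card_schur_msets_zero:
  "card {M \<in> schur_msets (add_mset r c) d. (r, 0) \<in># M} = card (schur_msets c d)"
proof (rule card_bij_eq[symmetric])
  show "inj_on (add_mset (r, 0)) (schur_msets c d)"
    by (auto simp: inj_on_def)
  show "add_mset (r, 0) ` schur_msets c d \<subseteq> {M \<in> schur_msets (add_mset r c) d. (r, 0) \<in># M}"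
    by (auto simp: schur_msets_def)
  show "inj_on (\<lambda>M. M - {#(r, 0)#}) {M \<in> schur_msets (add_mset r c) d. (r, 0) \<in># M}"
    by (auto simp: inj_on_def) (metis insert_DiffM)
  show "(\<lambda>M. M - {#(r, 0)#}) ` {M \<in> schur_msets (add_mset r c) d. (r, 0) \<in># M} \<subseteq> schur_msets c d"
    by (auto simp: schur_msets_def dest!: multi_member_split)
  show "finite (schur_msets c d)"
    by (rule finite_schur_msets)
  show "finite {M \<in> schur_msets (add_mset r c) d. (r, 0) \<in># M}"
    using finite_schur_msets[of "add_mset r c" d] by simp
qed

definition shift_color :: "'n \<Rightarrow> 'n \<times> nat \<Rightarrow> 'n \<times> nat" where
  "shift_color r x = (fst x, if fst x = r then snd x + 1 else snd x)"

lemma shift_color_mset: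
  "image_mset fst (image_mset (shift_color r) M) = image_mset fst M"
  "sum_mset (image_mset snd (image_mset (shift_color r) M)) =
     sum_mset (image_mset snd M) + count (image_mset fst M) r"
  "(r, 0) \<notin># image_mset (shift_color r) M"
  by (induction M) (auto simp: shift_color_def)

text \<open>Without (r, 0) every entry of color r is a successor. Lowering all of them by one keeps
  the colors and lowers the sum by their number; other colors stay fixed.\<close>

lemma card_schur_msets_pos:
  "card {M \<in> schur_msets c (d + count c r). (r, 0) \<notin># M} = card (schur_msets c d)"
proof -
  let ?g = "\<lambda>x. (fst x, if fst x = r then snd x - 1 else snd x)"
  have gs: "?g (shift_color r x) = x" for x
    by (cases x) (simp add: shift_color_def)
  have sg: "shift_color r (?g x) = x" if "x \<noteq> (r, 0)" for x
    using that by (cases x) (auto simp: shift_color_def)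
  have sgM: "image_mset (shift_color r) (image_mset ?g M) = M" if "(r, 0) \<notin># M" for M
    unfolding image_mset.compositionality comp_def
    using that by (intro multiset.map_ident_strong) (metis sg)
  have "bij_betw (image_mset (shift_color r)) (schur_msets c d) {M \<in> schur_msets c (d + count c r). (r, 0) \<notin># M}"
  proof (rule bij_betw_byWitness[where f' = "image_mset ?g"])
    show "\<forall>M\<in>schur_msets c d. image_mset ?g (image_mset (shift_color r) M) = M"
      unfolding image_mset.compositionality comp_def gs by simp
    show "\<forall>M\<in>{M \<in> schur_msets c (d + count c r). (r, 0) \<notin># M}. image_mset (shift_color r) (image_mset ?g M) = M"
      using sgM by blast
    show "image_mset (shift_color r) ` schur_msets c d \<subseteq> {M \<in> schur_msets c (d + count c r). (r, 0) \<notin># M}"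
      using shift_color_mset by (auto simp: schur_msets_def simp del: image_mset.compositionality)
    show "image_mset ?g ` {M \<in> schur_msets c (d + count c r). (r, 0) \<notin># M} \<subseteq> schur_msets c d"
    proof
      fix N assume "N \<in> image_mset ?g ` {M \<in> schur_msets c (d + count c r). (r, 0) \<notin># M}"
      then obtain M where M: "N = image_mset ?g M" "M \<in> schur_msets c (d + count c r)" "(r, 0) \<notin># M"
        by blast
      then have "M = image_mset (shift_color r) N"
        using sgM by simp
      then show "N \<in> schur_msets c d"
        using M(2) shift_color_mset(1,2)[of r N] by (simp only: schur_msets_def mem_Collect_eq) auto
    qed
  qed
  then show ?thesis
    by (simp add: bij_betw_same_card)
qed

text \<open>Without (r, 0) each entry of color r adds at least 1 to the sum.\<close>

lemma schur_msets_pos_empty: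
  assumes "d < count c r"
  shows "{M \<in> schur_msets c d. (r, 0) \<notin># M} = {}"
proof -
  have "count (image_mset fst M) r \<le> sum_mset (image_mset snd M)" if "(r, 0) \<notin># M" for M :: "('n \<times> nat) multiset"
    using that
  proof (induction M)
    case (add x M)
    then show ?case
      by (cases x; cases "snd x") auto
  qed simp
  with assms show ?thesis
    by (fastforce simp: schur_msets_def)
qed

text \<open>With F the series for the enlarged multiset, F = \<open>count_series c\<close> + q^k F:
  the first summand counts the multisets containing (r, 0), the second the others. Here k is the
  number of entries of color r including the new one.\<close>

lemma count_series_rec:
  "count_series (add_mset r c) * (1 - fps_X ^ Suc (count c r)) = count_series c"
proof (rule fps_ext)
  fix d
  let ?c = "add_mset r c" and ?k = "Suc (count c r)"
  have "schur_msets ?c d = {M \<in> schur_msets ?c d. (r, 0) \<in># M} \<union> {M \<in> schur_msets ?c d. (r, 0) \<notin># M}"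
    by blast
  then have "card (schur_msets ?c d) = card {M \<in> schur_msets ?c d. (r, 0) \<in># M} + card {M \<in> schur_msets ?c d. (r, 0) \<notin># M}"
    using finite_schur_msets[of ?c d] by (subst card_Un_disjoint[symmetric]) auto
  also have "card {M \<in> schur_msets ?c d. (r, 0) \<notin># M} = (if d < ?k then 0 else card (schur_msets ?c (d - ?k)))"
  proof (cases "d < ?k")
    case True
    then have "{M \<in> schur_msets ?c d. (r, 0) \<notin># M} = {}"
      by (intro schur_msets_pos_empty) simp
    with True show ?thesis
      by (simp only: card.empty if_True)
  next
    case False
    then show ?thesis
      using card_schur_msets_pos[of ?c "d - ?k" r] by simp
  qed
  finally have "card (schur_msets ?c d) = card (schur_msets c d) + (if d < ?k then 0 else card (schur_msets ?c (d - ?k)))"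
    by (simp only: card_schur_msets_zero)
  then show "fps_nth (count_series ?c * (1 - fps_X ^ ?k)) d = fps_nth (count_series c) d"
    by (simp add: count_series_def ring_distribs fps_X_power_mult_right_nth del: power_Suc)
qed

lemma q_poch_Suc: "q_poch (Suc k) = q_poch k * (1 - fps_X ^ Suc k)"
  by (simp add: q_poch_def del: power_Suc)

text \<open>Adding one element changes only the factor of its own color, by the factor 1 - q^k that
  \<open>count_series_rec\<close> removes.\<close>

lemma count_series_eq: "count_series c = inverse (\<Prod>r\<in>UNIV. q_poch (count c r))"
proof -
  have "(\<Prod>r\<in>UNIV. q_poch (count c r)) * count_series c = 1"
  proof (induction c)
    case empty
    show ?case
      by (rule fps_ext) (simp add: q_poch_def count_series_def schur_msets_empty)
  next
    case (add s c)
    have "(\<Prod>r\<in>UNIV. q_poch (count (add_mset s c) r)) =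
        (\<Prod>r\<in>UNIV. q_poch (count c r) * (if r = s then 1 - fps_X ^ Suc (count c s) else 1))"
      by (intro prod.cong refl) (simp add: q_poch_Suc del: power_Suc)
    also have "\<dots> = (\<Prod>r\<in>UNIV. q_poch (count c r)) * (1 - fps_X ^ Suc (count c s))"
      by (simp add: prod.distrib del: power_Suc)
    finally show ?case
      using add by (simp only: mult.assoc mult.commute[of "1 - _"] count_series_rec)
  qed
  then show ?thesis
    by (rule fps_inverse_unique[symmetric])
qed

lemma form_combination:
  "form (\<Sum>r\<in>UNIV. scale (x $ r) (\<beta> r)) (\<Sum>r\<in>UNIV. scale (x $ r) (\<beta> r)) = scalar_product x (gram *v x)"
proof -
  have l: "form (sum f A) h = (\<Sum>y\<in>A. form (f y) h)" for f :: "'n \<Rightarrow> 'h" and A h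
    by (simp add: form_sym[of _ h] form_sum)
  show ?thesis
    by (simp add: l form_sum form_scale scalar_product_def matrix_vector_mult_def gram_def sum_distrib_left mult_ac)
      (intro sum.cong refl, metis form_sym)
qed

theorem graded_dimension_eq:
  fixes j :: "complex ^ 'n"
  assumes \<mu>: "\<mu> = (\<Sum>r\<in>UNIV. scale (j $ r) (\<beta> r))"
  shows "graded_dimension \<mu> = x_series (\<lambda>i. q_shift
    (scalar_product (vec_of_nat i + j) (gram *v (vec_of_nat i + j)) / 2)
    (inverse (\<Prod>r\<in>UNIV. q_poch (i $ r))))"
proof (intro ext)
  fix a :: "complex ^ 'n" and n :: complex
  define \<delta> where "\<delta> = \<mu> + (\<Sum>r\<in>UNIV. scale (a $ r) (\<beta> r))"
  have gd: "graded_dimension \<mu> a n = of_nat (gva.dim (graded_piece (schur_module \<mu>) \<delta> n))"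
    by (simp add: graded_dimension_def principal_module_eq \<delta>_def)
  have \<delta>_iff: "\<delta> = \<mu> + charge c \<longleftrightarrow> (\<forall>r. a $ r = of_nat (count c r))" for c
    unfolding \<delta>_def add_left_cancel using charge_eq_iff[of c "($) a"] by (simp add: eq_commute)
  show "graded_dimension \<mu> a n = x_series (\<lambda>i. q_shift
    (scalar_product (vec_of_nat i + j) (gram *v (vec_of_nat i + j)) / 2)
    (inverse (\<Prod>r\<in>UNIV. q_poch (i $ r)))) a n"
  proof (cases "\<exists>i. a = vec_of_nat i")
    case True
    then obtain i :: "nat ^ 'n" where a: "a = vec_of_nat i"
      by blast
    \<comment> \<open>The tuple i is read as a multiset of colors, the index used on the algebraic
      side.\<close>
    define c where "c = Abs_multiset (($) i)"
    have c: "count c = ($) i"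
      unfolding c_def by (rule count_Abs_multiset) simp
    have \<delta>: "\<delta> = \<mu> + charge c"
      by (simp add: \<delta>_iff c a vec_of_nat_def)
    have "{k. a = vec_of_nat k} = {i}"
      by (auto simp: a vec_of_nat_def vec_eq_iff)
    then have rhs: "x_series G a n = G i n" for G
      by (simp add: x_series_def)
    have "\<delta> = (\<Sum>r\<in>UNIV. scale ((vec_of_nat i + j) $ r) (\<beta> r))"
      by (simp add: \<delta>_def \<mu> a scale_left_distrib sum.distrib add.commute)
    then have f: "scalar_product (vec_of_nat i + j) (gram *v (vec_of_nat i + j)) = form \<delta> \<delta>"
      using form_combination[of "vec_of_nat i + j"] by simp
    show ?thesis
    proof (cases "\<exists>d. n = form \<delta> \<delta> / 2 + of_nat d")
      case True
      then obtain d where d: "n = form \<delta> \<delta> / 2 + of_nat d"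
        by blast
      then have "{m. n = form \<delta> \<delta> / 2 + of_nat m} = {d}"
        by auto
      moreover have "graded_dimension \<mu> a n = fps_nth (count_series c) d"
        unfolding gd using d \<delta> by (subst dim_graded_piece[of d _ _ _ c]) (auto simp: count_series_def)
      ultimately show ?thesis
        by (simp add: rhs f q_shift_def count_series_eq c)
    next
      case False
      then have "gva.dim (graded_piece (schur_module \<mu>) \<delta> n) = 0"
        by (intro dim_graded_piece_0) (metis add.commute)
      moreover have "{m. n = form \<delta> \<delta> / 2 + of_nat m} = {}"
        using False by blast
      ultimately show ?thesis
        unfolding gd rhs f q_shift_def by (simp only: sum.empty of_nat_0)
    qed
  next
    case False
    have "\<delta> \<noteq> \<mu> + charge c" for c
    proof
      assume "\<delta> = \<mu> + charge c"
      then have "a = vec_of_nat (\<chi> r. count c r)"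
        by (simp add: \<delta>_iff vec_of_nat_def vec_eq_iff)
      with False show False
        by blast
    qed
    then have "gva.dim (graded_piece (schur_module \<mu>) \<delta> n) = 0"
      by (intro dim_graded_piece_0) blast
    moreover have "{i. a = vec_of_nat i} = {}"
      using False by blast
    ultimately show ?thesis
      unfolding gd x_series_def by (simp only: sum.empty of_nat_0)
  qed
qed

end

theorem theorem7p1:
  fixes scale :: "complex \<Rightarrow> 'h::ab_group_add \<Rightarrow> 'h"
    and form \<epsilon> :: "'h \<Rightarrow> 'h \<Rightarrow> complex"
    and \<beta> :: "'n::finite \<Rightarrow> 'h"
    and j :: "complex ^ 'n"
    and lam :: 'h
  assumes "lattice_gva scale form \<epsilon> \<beta>"
    and "lam = (\<Sum>r\<in>UNIV. scale (j $ r) (\<beta> r))"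
    and "lam \<in> lattice_gva.dual_lattice scale form \<beta>"
  shows "(\<forall>\<alpha> n. gva_finite_dim (lattice_gva.graded_piece scale form \<beta>
            (lattice_gva.principal_module scale form \<epsilon> \<beta> lam) (lam + \<alpha>) n)) \<and>
         lattice_gva.graded_dimension scale form \<epsilon> \<beta> lam =
           x_series (\<lambda>i. q_shift
             (scalar_product (vec_of_nat i + j) (lattice_gva.gram form \<beta> *v (vec_of_nat i + j)) / 2)
             (inverse (\<Prod>r\<in>UNIV. q_poch (i $ r))))"
proof -
  interpret lattice_gva scale form \<epsilon> \<beta>
    by (rule assms(1))
  show ?thesis
    using gva_finite_dim_graded_piece graded_dimension_eq[OF assms(2)]
    by (simp add: principal_module_eq)
qed

end
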